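(* Let $\alpha > -1$, let $D\subset\mathbb{C}$ be a domain such that (a) $D$ is unbounded, (b) the union $F$ of all bounded components of $\mathbb{C}_\infty\setminus D$ is bounded, and (c) for the simply connected domain $\Omega=D\cup F$, for all sufficiently large $r>0$ the set $\Omega\cap \{z\in \mathbb{C}:|z|=r\}$ has exactly one component. Then $$\mathrm{h}(D) =\mathrm{b}(D)=\mathrm{h}(\Omega)=\mathrm{b}(\Omega)=\dfrac{\mathrm{b}_{\alpha}(D)}{\alpha+2}=\dfrac{\mathrm{b}_{\alpha}(\Omega)}{\alpha+2}.$$ If, in addition, $D$ is a hyperbolic domain with $0 \in D$, we have $$\mathrm{h}(f_D) = \mathrm{b}(f_D) = \dfrac{\mathrm{b}_{\alpha}(f_D)}{\alpha+2},$$ where $f_D \colon \mathbb{D} \to D$ is a universal covering map with $f_D(0) = 0$.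
   Context: $H^p$ is the Hardy space and $A^p_\alpha$ ($0<p<\infty$, $\alpha>-1$) the weighted Bergman space of holomorphic $f$ on the unit disk $\mathbb{D}$ with $\int_{\mathbb{D}}|f|^p(1-|z|)^\alpha dA<\infty$. For holomorphic $f$ on $\mathbb{D}$: $\mathrm{h}(f)=\sup(\{0\}\cup\{p>0: f\in H^p\})$, $\mathrm{b}(f)=\sup(\{0\}\cup\{p/(\alpha+2): p>0,\alpha>-1, f\in A^p_\alpha\})$, $\mathrm{b}_\alpha(f)=\sup(\{0\}\cup\{p>0: f\in A^p_\alpha\})$. For a domain $D$, $\mathrm{h}(D)$, $\mathrm{b}(D)$, $\mathrm{b}_\alpha(D)$ are the infima of these quantities over holomorphic $f\colon\mathbb{D}\to D$. A domain is hyperbolic if its complement contains at least two points. *)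

theory Defs
  imports "HOL-Analysis.Analysis"
begin

text \<open>Hardy space H^p on the unit disk (normalisation of the measure is irrelevant).\<close>
definition hardy :: "real \<Rightarrow> (complex \<Rightarrow> complex) \<Rightarrow> bool" where
  "hardy p f \<longleftrightarrow> f holomorphic_on ball 0 1 \<and>
     (SUP r\<in>{0<..<1::real}.
        (\<integral>\<^sup>+ t\<in>{0..2*pi}. ennreal (norm (f (complex_of_real r * cis t)) powr p) \<partial>lborel)) < \<infinity>"

definition bergman :: "real \<Rightarrow> real \<Rightarrow> (complex \<Rightarrow> complex) \<Rightarrow> bool" where
  "bergman p \<alpha> f \<longleftrightarrow> f holomorphic_on ball 0 1 \<and>
     (\<integral>\<^sup>+ z\<in>ball 0 1. ennreal (norm (f z) powr p * (1 - norm z) powr \<alpha>) \<partial>lborel) < \<infinity>"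

definition hardy_num :: "(complex \<Rightarrow> complex) \<Rightarrow> ereal" where
  "hardy_num f = Sup ({0} \<union> {ereal p | p. p > 0 \<and> hardy p f})"

definition bergman_num :: "(complex \<Rightarrow> complex) \<Rightarrow> ereal" where
  "bergman_num f = Sup ({0} \<union> {ereal (p / (\<alpha> + 2)) | p \<alpha>. p > 0 \<and> \<alpha> > -1 \<and> bergman p \<alpha> f})"

definition bergman_alpha_num :: "real \<Rightarrow> (complex \<Rightarrow> complex) \<Rightarrow> ereal" where
  "bergman_alpha_num \<alpha> f = Sup ({0} \<union> {ereal p | p. p > 0 \<and> bergman p \<alpha> f})"

definition hardy_dom :: "complex set \<Rightarrow> ereal" where
  "hardy_dom D = Inf {hardy_num f | f. f holomorphic_on ball 0 1 \<and> f ` ball 0 1 \<subseteq> D}"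

definition bergman_dom :: "complex set \<Rightarrow> ereal" where
  "bergman_dom D = Inf {bergman_num f | f. f holomorphic_on ball 0 1 \<and> f ` ball 0 1 \<subseteq> D}"

definition bergman_alpha_dom :: "real \<Rightarrow> complex set \<Rightarrow> ereal" where
  "bergman_alpha_dom \<alpha> D = Inf {bergman_alpha_num \<alpha> f | f. f holomorphic_on ball 0 1 \<and> f ` ball 0 1 \<subseteq> D}"

definition filled_holes :: "complex set \<Rightarrow> complex set" where
  "filled_holes D = \<Union> {C. C \<in> components (- D) \<and> bounded C}"

end

theory Submission
  imports Defs "HOL-Complex_Analysis.Complex_Analysis" "HOL-Real_Asymp.Real_Asymp"
begin

text \<open>If \<open>f\<close> omits a value, powers of \<open>f - a\<close> are holomorphic, and Cauchy estimates give
  \<open>h(f) \<le> b\<^sub>\<alpha>(f) / (\<alpha> + 2) \<le> b(f) \<le> 1 / s(f)\<close>, where \<open>s(f)\<close> is the order of growth of \<open>f\<close> at the unit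
  circle. So it is enough to bound \<open>h(\<Omega>)\<close> from below by the growth orders of maps into \<open>D\<close>.
  By Littlewood subordination and Prawitz' theorem, \<open>h(\<Omega>) \<ge> 1 / s(g)\<close> for a Riemann map \<open>g\<close> of \<open>\<Omega>\<close>.
  If \<open>g\<close> grows fast along a sequence tending to a boundary point \<open>\<zeta>\<close>, then a length-area argument
  and the connectedness of the circular slices of \<open>\<Omega>\<close> show that \<open>g\<close> stays away from the holes of \<open>D\<close>
  near \<open>\<zeta>\<close>. Restricting \<open>g\<close> to a conformal cap at \<open>\<zeta>\<close> therefore gives a map into \<open>D\<close> that grows as
  fast as \<open>g\<close>. Maps into \<open>D\<close> lift through a universal covering, and by the Schwarz-Pick lemma the lift does not
  affect growth orders.\<close>

section \<open>Change of variables and polar coordinates in the plane\<close>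

unbundle no fps_syntax

text \<open>Enlarging the target lowers the infimum, so h and b of \<Omega> are at most those of D,
  and all quantities of the two domains agree once b(D) \<le> h(\<Omega>) is known. For a covering
  map f the closing chain is b(f) \<le> h(\<Omega>) \<le> h(D) \<le> h(f). The obstacle is that a
  Riemann map g of \<Omega> takes values in the holes, so a growth bound for maps into D says
  nothing about g itself. It must be restricted to a part of the disc that avoids the holes and yet
  is so large near \<zeta> that distances to the unit circle change only by a bounded factor: a
  half-plane minus a large disc, in half-plane coordinates. In logarithmic coordinates this is the
  end of a strip, and connected slices make every far vertical segment meet each circle that is met
  arbitrarily far out. This prevents g from returning to small values near \<zeta>. Omitted values
  enter because |f - a|^p is the modulus of a holomorphic function when f - a has no zeros. For the
  whole plane no value is omitted; there c exp((1+z)/(1-z)) outgrows every power of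
  1/(1-|z|).\<close>

definition complex_of_vec :: "real^2 \<Rightarrow> complex" where
  "complex_of_vec v = Complex (v $ 1) (v $ 2)"

definition vec_of_complex :: "complex \<Rightarrow> real^2" where
  "vec_of_complex z = vector [Re z, Im z]"

lemma complex_of_vec_inverse [simp]: "complex_of_vec (vec_of_complex z) = z"
  by (simp add: complex_of_vec_def vec_of_complex_def)

lemma vec_of_complex_inverse [simp]: "vec_of_complex (complex_of_vec v) = v"
  by (simp add: complex_of_vec_def vec_of_complex_def vec_eq_iff forall_2)

lemma linear_complex_of_vec: "linear complex_of_vec"
  by (auto simp: linear_iff complex_of_vec_def complex_eq_iff)

lemma linear_vec_of_complex: "linear vec_of_complex"
  by (auto simp: linear_iff vec_of_complex_def vec_eq_iff forall_2)

lemma borel_measurable_complex_of_vec [measurable]: "complex_of_vec \<in> borel_measurable borel"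
  by (intro borel_measurable_continuous_onI linear_continuous_on linear_conv_bounded_linear[THEN iffD1] linear_complex_of_vec)

lemma lborel_complex_of_vec: "distr lborel borel complex_of_vec = lborel"
proof (rule lborel_eqI[symmetric])
  fix l u :: complex assume lu: "\<And>b. b \<in> Basis \<Longrightarrow> l \<bullet> b \<le> u \<bullet> b"
  have "complex_of_vec -` box l u = box (vec_of_complex l) (vec_of_complex u)"
    by (auto simp: box_def Basis_complex_def complex_of_vec_def vec_of_complex_def
        mem_box_cart forall_2 Basis_vec_def inner_axis)
  moreover have "emeasure lborel (box (vec_of_complex l) (vec_of_complex u)) = (Re u - Re l) * (Im u - Im l)"
  proof -
    have B: "(Basis::(real^2) set) = {axis 1 1, axis 2 1}"
      by (auto simp: Basis_vec_def UNIV_2)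
    have ne: "axis 1 1 \<noteq> (axis 2 1::real^2)" by (simp add: axis_eq_axis)
    show ?thesis
      using lu[of 1] lu[of \<i>]
      by (subst emeasure_lborel_box)
         (auto simp: Basis_complex_def vec_of_complex_def inner_axis B ne)
  qed
  ultimately show "emeasure (distr lborel borel complex_of_vec) (box l u) = (\<Prod>b\<in>Basis. (u - l) \<bullet> b)"
    by (subst emeasure_distr) (auto simp: Basis_complex_def)
qed simp

lemma lborel_Complex: "distr (lborel \<Otimes>\<^sub>M lborel) borel (\<lambda>(x, y). Complex x y) = lborel"
proof (rule lborel_eqI[symmetric])
  have [measurable]: "(\<lambda>(x, y). Complex x y) \<in> borel_measurable (lborel \<Otimes>\<^sub>M lborel)"
    unfolding lborel_prod split_beta
    by (auto intro!: borel_measurable_continuous_onI continuous_intros)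
  fix l u :: complex assume lu: "\<And>b. b \<in> Basis \<Longrightarrow> l \<bullet> b \<le> u \<bullet> b"
  have "(\<lambda>(x, y). Complex x y) -` box l u \<inter> space (lborel \<Otimes>\<^sub>M lborel) = {Re l<..<Re u} \<times> {Im l<..<Im u}"
    by (auto simp: box_def Basis_complex_def space_pair_measure)
  then show "emeasure (distr (lborel \<Otimes>\<^sub>M lborel) borel (\<lambda>(x, y). Complex x y)) (box l u) = (\<Prod>b\<in>Basis. (u - l) \<bullet> b)"
    using lu[of 1] lu[of \<i>]
    by (subst emeasure_distr) (auto simp: Basis_complex_def lborel.emeasure_pair_measure_Times ennreal_mult)
qed simp

lemma nn_integral_complex_Fubini:
  fixes f :: "complex \<Rightarrow> ennreal"
  assumes [measurable]: "f \<in> borel_measurable borel"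
  shows "(\<integral>\<^sup>+ z. f z \<partial>lborel) = (\<integral>\<^sup>+ x. \<integral>\<^sup>+ y. f (Complex x y) \<partial>lborel \<partial>lborel)"
proof -
  have [measurable]: "(\<lambda>(x, y). Complex x y) \<in> borel_measurable (lborel \<Otimes>\<^sub>M lborel)"
    unfolding lborel_prod split_beta
    by (auto intro!: borel_measurable_continuous_onI continuous_intros)
  have "(\<integral>\<^sup>+ z. f z \<partial>lborel) = (\<integral>\<^sup>+ p. f (case p of (x, y) \<Rightarrow> Complex x y) \<partial>(lborel \<Otimes>\<^sub>M lborel))"
    by (subst lborel_Complex[symmetric], subst nn_integral_distr) auto
  also have "\<dots> = (\<integral>\<^sup>+ x. \<integral>\<^sup>+ y. f (Complex x y) \<partial>lborel \<partial>lborel)"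
    by (subst lborel.nn_integral_fst[symmetric]) auto
  finally show ?thesis .
qed

text \<open>The real-linear map of the plane that sends 1 to \<open>a\<close> and \<i> to
  \<open>b\<close> has these two vectors as columns; its determinant is their cross product.\<close>

lemma det_vec_conjugate:
  fixes a b :: complex
  shows "det (matrix (\<lambda>v. vec_of_complex (complex_of_real (Re (complex_of_vec v)) * a + complex_of_real (Im (complex_of_vec v)) * b)))
    = Im (cnj a * b)"
  by (simp add: det_2 matrix_def vec_of_complex_def complex_of_vec_def axis_def)

text \<open>The change of variables formula is a theorem about \<open>real^2\<close>. The
  isomorphism \<open>complex_of_vec\<close> carries it over because it preserves Lebesgue
  measure.\<close>

lemma emeasure_complex_image:
  fixes g a b :: "complex \<Rightarrow> complex"
  assumes T: "T \<in> sets borel" and gT: "g ` T \<in> sets borel" and inj: "inj_on g T"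
    and der: "\<And>z. z \<in> T \<Longrightarrow>
      (g has_derivative (\<lambda>v. complex_of_real (Re v) * a z + complex_of_real (Im v) * b z)) (at z within T)"
    and meas: "(\<lambda>z. indicator T z * \<bar>Im (cnj (a z) * b z)\<bar>) \<in> borel_measurable borel"
  shows "emeasure lborel (g ` T) = (\<integral>\<^sup>+ z. ennreal (indicator T z * \<bar>Im (cnj (a z) * b z)\<bar>) \<partial>lborel)"
proof -
  define T' where "T' = complex_of_vec -` T"
  define h where "h v = vec_of_complex (g (complex_of_vec v))" for v
  define h' where "h' w v = vec_of_complex (complex_of_real (Re (complex_of_vec v)) * a (complex_of_vec w)
       + complex_of_real (Im (complex_of_vec v)) * b (complex_of_vec w))" for w v
  have inv_image: "complex_of_vec -` X = vec_of_complex ` X" for X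
    by (force simp: image_iff intro: vec_of_complex_inverse[symmetric])
  have T'_borel [measurable]: "T' \<in> sets borel"
    unfolding T'_def using measurable_sets[OF borel_measurable_complex_of_vec T] by simp
  have hT': "h ` T' = complex_of_vec -` (g ` T)"
    by (auto simp: inv_image T'_def h_def image_image)
  have blV: "bounded_linear complex_of_vec" "bounded_linear vec_of_complex"
    using linear_complex_of_vec linear_vec_of_complex linear_conv_bounded_linear by auto
  have derV: "(complex_of_vec has_derivative complex_of_vec) F" for F
    using blV(1) by (rule bounded_linear_imp_has_derivative)
  have derh: "(h has_derivative h' w) (at w within T')" if "w \<in> T'" for w
  proof -
    have *: "complex_of_vec w \<in> T" using that by (simp add: T'_def)
    have eq: "complex_of_vec ` T' = T"
      by (auto simp: T'_def inv_image image_image)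
    have "(g \<circ> complex_of_vec has_derivative
        (\<lambda>v. complex_of_real (Re v) * a (complex_of_vec w) + complex_of_real (Im v) * b (complex_of_vec w)) \<circ> complex_of_vec)
        (at w within T')"
      by (rule diff_chain_within[OF derV]) (use der[OF *] eq in simp)
    from bounded_linear.has_derivative[OF blV(2) this]
    show ?thesis unfolding h_def h'_def o_def .
  qed
  have injh: "inj_on h T'"
  proof (rule inj_onI)
    fix v w assume "v \<in> T'" "w \<in> T'" "h v = h w"
    then have "g (complex_of_vec v) = g (complex_of_vec w)"
      unfolding h_def by (metis complex_of_vec_inverse)
    then show "v = w" using inj \<open>v \<in> T'\<close> \<open>w \<in> T'\<close> unfolding T'_def
      by (metis inj_onD vec_of_complex_inverse vimageE)
  qed
  have T'_leb: "T' \<in> sets lebesgue" by simp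
  have hT'_borel: "h ` T' \<in> sets borel"
    unfolding hT' using measurable_sets[OF borel_measurable_complex_of_vec gT] by simp
  have det: "\<bar>det (matrix (h' w))\<bar> = \<bar>Im (cnj (a (complex_of_vec w)) * b (complex_of_vec w))\<bar>" for w
    unfolding h'_def det_vec_conjugate ..
  define J where "J z = indicator T z * \<bar>Im (cnj (a z) * b z)\<bar>" for z
  have [measurable]: "J \<in> borel_measurable borel" unfolding J_def by (rule meas)
  have J_nonneg: "0 \<le> J z" for z by (simp add: J_def)
  have iff: "h ` T' \<in> lmeasurable \<and> measure lebesgue (h ` T') = m \<longleftrightarrow>
      ((\<lambda>v. J (complex_of_vec v)) has_integral m) UNIV" for m
  proof -
    have "(\<lambda>v. J (complex_of_vec v)) = (\<lambda>v. if v \<in> T' then \<bar>det (matrix (h' v))\<bar> else 0)"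
      by (auto simp: J_def det T'_def)
    then show ?thesis
      using has_measure_differentiable_image[OF T'_leb derh injh, of m]
      by (simp add: has_integral_restrict_UNIV)
  qed
  have em: "emeasure lborel (g ` T) = emeasure lebesgue (h ` T')"
  proof -
    have "emeasure lborel (g ` T) = emeasure lborel (complex_of_vec -` (g ` T))"
      by (subst lborel_complex_of_vec[symmetric], subst emeasure_distr) (use gT in auto)
    then show ?thesis using hT' hT'_borel by simp
  qed
  have nn: "(\<integral>\<^sup>+ z. ennreal (J z) \<partial>lborel) = (\<integral>\<^sup>+ v. ennreal (J (complex_of_vec v)) \<partial>lborel)"
    by (subst lborel_complex_of_vec[symmetric], subst nn_integral_distr) auto
  have "emeasure lebesgue (h ` T') = (\<integral>\<^sup>+ v. ennreal (J (complex_of_vec v)) \<partial>lborel)"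
  proof (cases "(\<integral>\<^sup>+ v. ennreal (J (complex_of_vec v)) \<partial>lborel) = \<infinity>")
    case False
    then obtain m where m: "(\<integral>\<^sup>+ v. ennreal (J (complex_of_vec v)) \<partial>lborel) = ennreal m" "m \<ge> 0"
      by (cases "(\<integral>\<^sup>+ v. ennreal (J (complex_of_vec v)) \<partial>lborel)" rule: ennreal_cases) auto
    have "((\<lambda>v. J (complex_of_vec v)) has_integral m) UNIV"
      by (rule nn_integral_has_integral) (use m J_nonneg in auto)
    then have "h ` T' \<in> lmeasurable" "measure lebesgue (h ` T') = m" using iff by auto
    then show ?thesis using m emeasure_eq_measure2[of "h ` T'" lebesgue] by simp
  next
    case True
    \<comment> \<open>\<open>iff\<close> read in the other direction: an image of finite measure
      would make the Jacobian integrable.\<close>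
    have "emeasure lebesgue (h ` T') = \<infinity>"
    proof (rule ccontr)
      assume "\<not> ?thesis"
      then have "h ` T' \<in> lmeasurable"
        using hT'_borel by (simp add: fmeasurable_def less_top)
      then have "((\<lambda>v. J (complex_of_vec v)) has_integral measure lebesgue (h ` T')) UNIV"
        using iff by blast
      then have "(\<integral>\<^sup>+ v. ennreal (J (complex_of_vec v)) \<partial>lborel) = ennreal (measure lebesgue (h ` T'))"
        by (intro nn_integral_has_integral_lborel) (use J_nonneg in auto)
      then show False using True by simp
    qed
    then show ?thesis using True by simp
  qed
  then show ?thesis using em nn by (simp add: J_def)
qed

text \<open>Both sides integrate \<open>f\<close> against a measure on the plane: Lebesgue measure
  restricted to the image of \<open>S\<close>, and the push-forward of the Jacobian density. The two
  measures agree on Borel sets by the formula for areas of images of subsets of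
  \<open>S\<close>.\<close>

lemma nn_integral_complex_change_of_variables:
  fixes g a b :: "complex \<Rightarrow> complex" and f :: "complex \<Rightarrow> ennreal"
  assumes S: "S \<in> sets borel" and gS: "g ` S \<in> sets borel" and inj: "inj_on g S"
    and der: "\<And>z. z \<in> S \<Longrightarrow>
      (g has_derivative (\<lambda>v. complex_of_real (Re v) * a z + complex_of_real (Im v) * b z)) (at z within S)"
    and meas: "(\<lambda>z. indicator S z * \<bar>Im (cnj (a z) * b z)\<bar>) \<in> borel_measurable borel"
    and f [measurable]: "f \<in> borel_measurable borel"
  shows "(\<integral>\<^sup>+ w\<in>g ` S. f w \<partial>lborel) = (\<integral>\<^sup>+ z\<in>S. ennreal \<bar>Im (cnj (a z) * b z)\<bar> * f (g z) \<partial>lborel)"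
proof -
  have contg: "continuous_on S g"
    using der by (meson continuous_on_eq_continuous_within has_derivative_continuous)
  \<comment> \<open>Extension by 0 makes \<open>g\<close> Borel on the whole plane; the values
    outside \<open>S\<close> do no harm since the density vanishes there.\<close>
  define G where "G z = (if z \<in> S then g z else 0)" for z
  have [measurable]: "G \<in> borel_measurable borel"
    unfolding G_def by (rule borel_measurable_continuous_on_if[OF S contg]) auto
  define J where "J z = ennreal (indicator S z * \<bar>Im (cnj (a z) * b z)\<bar>)" for z
  have [measurable]: "J \<in> borel_measurable borel" unfolding J_def using meas by measurable
  have eq: "density lborel (indicator (g ` S)) = distr (density lborel J) borel G"
  proof (rule measure_eqI)
    fix A assume "A \<in> sets (density lborel (indicator (g ` S) :: complex \<Rightarrow> ennreal))"
    then have A [measurable]: "A \<in> sets borel" by simp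
    define T where "T = S \<inter> G -` A"
    have [measurable]: "T \<in> sets borel" unfolding T_def using S measurable_sets[of G borel borel A] by auto
    have TS: "T \<subseteq> S" and gT: "g ` T = g ` S \<inter> A" by (auto simp: T_def G_def)
    have *: "(\<lambda>z. indicator T z * \<bar>Im (cnj (a z) * b z)\<bar>) = (\<lambda>z. indicator T z * (indicator S z * \<bar>Im (cnj (a z) * b z)\<bar>))"
      using TS by (auto simp: fun_eq_iff split: split_indicator)
    have "emeasure (density lborel (indicator (g ` S))) A = emeasure lborel (g ` S \<inter> A)"
      by (subst emeasure_density) (use gS in \<open>auto simp: nn_integral_indicator[symmetric] indicator_inter_arith\<close>)
    also have "\<dots> = (\<integral>\<^sup>+ z. ennreal (indicator T z * \<bar>Im (cnj (a z) * b z)\<bar>) \<partial>lborel)"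
      unfolding gT[symmetric]
    proof (rule emeasure_complex_image)
      show "g ` T \<in> sets borel" using gS A gT by simp
      show "inj_on g T" using inj TS by (rule inj_on_subset)
      show "(\<lambda>z. indicator T z * \<bar>Im (cnj (a z) * b z)\<bar>) \<in> borel_measurable borel"
        unfolding * using meas by measurable
      fix z assume "z \<in> T"
      then show "(g has_derivative (\<lambda>v. complex_of_real (Re v) * a z + complex_of_real (Im v) * b z)) (at z within T)"
        using has_derivative_subset[OF der TS] TS by auto
    qed simp
    also have "\<dots> = (\<integral>\<^sup>+ z. J z * indicator (G -` A) z \<partial>lborel)"
      by (intro nn_integral_cong) (auto simp: J_def T_def split: split_indicator)
    also have "\<dots> = emeasure (distr (density lborel J) borel G) A"
      by (subst emeasure_distr, simp, simp, subst emeasure_density) 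
         (use measurable_sets[of G borel borel A] in auto)
    finally show "emeasure (density lborel (indicator (g ` S))) A = emeasure (distr (density lborel J) borel G) A" .
  qed auto
  have "(\<integral>\<^sup>+ w\<in>g ` S. f w \<partial>lborel) = (\<integral>\<^sup>+ w. f w \<partial>density lborel (indicator (g ` S)))"
    by (subst nn_integral_density) (use gS in \<open>auto simp: mult.commute\<close>)
  also have "\<dots> = (\<integral>\<^sup>+ z. J z * f (G z) \<partial>lborel)"
    unfolding eq by (subst nn_integral_distr, simp, simp, subst nn_integral_density) auto
  also have "\<dots> = (\<integral>\<^sup>+ z\<in>S. ennreal \<bar>Im (cnj (a z) * b z)\<bar> * f (g z) \<partial>lborel)"
    by (intro nn_integral_cong) (auto simp: J_def G_def split: split_indicator)
  finally show ?thesis .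
qed

text \<open>By the Cauchy-Riemann equations the columns are g' and \<i> g', and their cross product
  is |g'|^2.\<close>

lemma nn_integral_holomorphic_image:
  fixes g :: "complex \<Rightarrow> complex" and f :: "complex \<Rightarrow> ennreal"
  assumes S: "open S" and hol: "g holomorphic_on S" and inj: "inj_on g S"
    and f: "f \<in> borel_measurable borel"
  shows "(\<integral>\<^sup>+ w\<in>g ` S. f w \<partial>lborel) = (\<integral>\<^sup>+ z\<in>S. ennreal ((norm (deriv g z))\<^sup>2) * f (g z) \<partial>lborel)"
proof -
  have J: "\<bar>Im (cnj (deriv g z) * (\<i> * deriv g z))\<bar> = (norm (deriv g z))\<^sup>2" for z
    by (simp add: cmod_power2) (simp add: power2_eq_square)
  have "(\<integral>\<^sup>+ w\<in>g ` S. f w \<partial>lborel) = (\<integral>\<^sup>+ z\<in>S. ennreal \<bar>Im (cnj (deriv g z) * (\<i> * deriv g z))\<bar> * f (g z) \<partial>lborel)"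
  proof (rule nn_integral_complex_change_of_variables)
    show "g ` S \<in> sets borel" using open_mapping_thm3[OF hol S inj] by simp
    have "continuous_on S (\<lambda>z. (norm (deriv g z))\<^sup>2)"
      using holomorphic_on_imp_continuous_on[OF holomorphic_deriv[OF hol S]] by (intro continuous_intros)
    from borel_measurable_continuous_on_indicator[OF _ this] S
    show "(\<lambda>z. indicator S z * \<bar>Im (cnj (deriv g z) * (\<i> * deriv g z))\<bar>) \<in> borel_measurable borel"
      unfolding J by simp
    fix z assume "z \<in> S"
    then have "(g has_derivative (\<lambda>v. deriv g z * v)) (at z within S)"
      using holomorphic_derivI[OF hol S] by (simp add: has_field_derivative_def)
    moreover have "(\<lambda>v. deriv g z * v) = (\<lambda>v. complex_of_real (Re v) * deriv g z + complex_of_real (Im v) * (\<i> * deriv g z))"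
      by (auto simp: fun_eq_iff complex_eq_iff algebra_simps)
    ultimately show "(g has_derivative (\<lambda>v. complex_of_real (Re v) * deriv g z + complex_of_real (Im v) * (\<i> * deriv g z))) (at z within S)"
      by simp
  qed (use S inj f in auto)
  then show ?thesis unfolding J .
qed

lemma nn_integral_polar:
  fixes f :: "complex \<Rightarrow> ennreal"
  assumes f [measurable]: "f \<in> borel_measurable borel"
  shows "(\<integral>\<^sup>+ z\<in>ball c \<delta>. f z \<partial>lborel) =
    (\<integral>\<^sup>+ r\<in>{0..\<delta>}. ennreal r * (\<integral>\<^sup>+ t\<in>{0..2*pi}. f (c + complex_of_real r * cis t) \<partial>lborel) \<partial>lborel)"
proof -
  \<comment> \<open>Radius and angle are packed into one complex variable as real and imaginary
    part. Positive radii and a half-open range of angles make the map injective; only the centre is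
    lost, which is a null set.\<close>
  define g where "g z = c + complex_of_real (Re z) * cis (Im z)" for z
  define S where "S = {z. 0 < Re z \<and> Re z < \<delta> \<and> 0 \<le> Im z \<and> Im z < 2 * pi}"
  have cis_exp: "cis t = exp (\<i> * complex_of_real t)" for t by (simp add: cis_conv_exp)
  have [measurable]: "S \<in> sets borel" unfolding S_def by measurable
  have gS: "g ` S = ball c \<delta> - {c}"
  proof (intro set_eqI iffI)
    fix w assume "w \<in> g ` S"
    then show "w \<in> ball c \<delta> - {c}" by (auto simp: g_def S_def dist_norm norm_mult)
  next
    fix w assume w: "w \<in> ball c \<delta> - {c}"
    have "w = g (Complex (norm (w - c)) (Arg2pi (w - c)))"
      using Arg2pi_eq[of "w - c"] by (simp add: g_def cis_exp algebra_simps)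
    moreover have "Complex (norm (w - c)) (Arg2pi (w - c)) \<in> S"
      using w Arg2pi_ge_0 Arg2pi_lt_2pi by (auto simp: S_def dist_norm norm_minus_commute)
    ultimately show "w \<in> g ` S" by blast
  qed
  have inj: "inj_on g S"
  proof (rule inj_onI)
    fix z w assume z: "z \<in> S" and w: "w \<in> S" and eq: "g z = g w"
    have "norm (g z - c) = Re z" "norm (g w - c) = Re w"
      using z w by (auto simp: g_def S_def norm_mult)
    moreover have "Arg2pi (g z - c) = Im z" "Arg2pi (g w - c) = Im w"
      using z w by (auto simp: g_def S_def cis_exp intro!: Arg2pi_unique)
    ultimately show "z = w" using eq by (simp add: complex_eq_iff)
  qed
  \<comment> \<open>The partial derivatives in radius and angle are cis t and \<i> r cis t, which
    gives the Jacobian r.\<close>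
  have J: "\<bar>Im (cnj (cis (Im z)) * (\<i> * complex_of_real (Re z) * cis (Im z)))\<bar> = \<bar>Re z\<bar>" for z
  proof -
    have "cnj (cis (Im z)) * (\<i> * complex_of_real (Re z) * cis (Im z)) = \<i> * complex_of_real (Re z) * (cis (Im z) * cnj (cis (Im z)))"
      by (simp add: algebra_simps)
    also have "\<dots> = \<i> * complex_of_real (Re z)" by (simp add: cis_cnj cis_mult)
    finally show ?thesis by (simp only:) simp
  qed
  have "(\<integral>\<^sup>+ z\<in>ball c \<delta>. f z \<partial>lborel) = (\<integral>\<^sup>+ z\<in>g ` S. f z \<partial>lborel)"
  proof (rule nn_integral_cong_AE)
    show "AE z in lborel. f z * indicator (ball c \<delta>) z = f z * indicator (g ` S) z"
      using AE_lborel_singleton[of c] by eventually_elim (auto simp: gS split: split_indicator)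
  qed
  also have "\<dots> = (\<integral>\<^sup>+ z\<in>S. ennreal \<bar>Im (cnj (cis (Im z)) * (\<i> * complex_of_real (Re z) * cis (Im z)))\<bar> * f (g z) \<partial>lborel)"
  proof (rule nn_integral_complex_change_of_variables)
    show "S \<in> sets borel" by simp
    show "g ` S \<in> sets borel" unfolding gS by simp
    show "inj_on g S" by (rule inj)
    show "(\<lambda>z. indicator S z * \<bar>Im (cnj (cis (Im z)) * (\<i> * complex_of_real (Re z) * cis (Im z)))\<bar>) \<in> borel_measurable borel"
      unfolding J by measurable
    fix z
    show "(g has_derivative (\<lambda>v. complex_of_real (Re v) * cis (Im z) + complex_of_real (Im v) * (\<i> * complex_of_real (Re z) * cis (Im z)))) (at z within S)"
    proof -
      have 1: "((\<lambda>z. \<i> * complex_of_real (Im z)) has_derivative (\<lambda>v. \<i> * complex_of_real (Im v))) (at z within S)"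
        by (intro has_derivative_mult_right has_derivative_of_real has_derivative_Im has_derivative_ident)
      have 2: "((\<lambda>z. complex_of_real (Re z)) has_derivative (\<lambda>v. complex_of_real (Re v))) (at z within S)"
        by (intro has_derivative_of_real has_derivative_Re has_derivative_ident)
      show ?thesis unfolding g_def[abs_def] cis_exp
        by (rule has_derivative_eq_rhs[OF has_derivative_add[OF has_derivative_const
              has_derivative_mult[OF 2 has_derivative_compose[OF 1 DERIV_exp[unfolded has_field_derivative_def]]]]])
           (auto simp: fun_eq_iff algebra_simps)
    qed
  qed simp
  also have "\<dots> = (\<integral>\<^sup>+ z. ennreal \<bar>Re z\<bar> * f (g z) * indicator S z \<partial>lborel)" unfolding J ..
  also have "\<dots> = (\<integral>\<^sup>+ x. \<integral>\<^sup>+ y. ennreal \<bar>x\<bar> * f (g (Complex x y)) * indicator S (Complex x y) \<partial>lborel \<partial>lborel)"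
  proof (subst nn_integral_complex_Fubini)
    have [measurable]: "g \<in> borel_measurable borel"
      unfolding g_def[abs_def] cis_exp by (auto intro!: borel_measurable_continuous_onI continuous_intros)
    show "(\<lambda>z. ennreal \<bar>Re z\<bar> * f (g z) * indicator S z) \<in> borel_measurable borel" by measurable
  qed simp
  also have "\<dots> = (\<integral>\<^sup>+ r\<in>{0..\<delta>}. ennreal r * (\<integral>\<^sup>+ t\<in>{0..2*pi}. f (c + complex_of_real r * cis t) \<partial>lborel) \<partial>lborel)"
  proof (rule nn_integral_cong_AE)
    have [measurable]: "(\<lambda>t. f (c + complex_of_real x * cis t)) \<in> borel_measurable borel" for x
      unfolding cis_exp
      by (rule measurable_compose[OF _ f], rule borel_measurable_continuous_onI) (auto intro!: continuous_intros)
    have *: "(\<integral>\<^sup>+ y. ennreal \<bar>x\<bar> * f (g (Complex x y)) * indicator S (Complex x y) \<partial>lborel) =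
       ennreal x * (\<integral>\<^sup>+ t\<in>{0..2*pi}. f (c + complex_of_real x * cis t) \<partial>lborel) * indicator {0..\<delta>} x"
      if "x \<noteq> 0" "x \<noteq> \<delta>" for x
    proof (cases "x \<in> {0..\<delta>}")
      case True
      have "(\<integral>\<^sup>+ y. ennreal \<bar>x\<bar> * f (g (Complex x y)) * indicator S (Complex x y) \<partial>lborel) =
          (\<integral>\<^sup>+ t. ennreal x * (f (c + complex_of_real x * cis t) * indicator {0..2*pi} t) \<partial>lborel)"
      proof (rule nn_integral_cong_AE)
        show "AE y in lborel. ennreal \<bar>x\<bar> * f (g (Complex x y)) * indicator S (Complex x y) =
          ennreal x * (f (c + complex_of_real x * cis y) * indicator {0..2*pi} y)"
          using AE_lborel_singleton[of "2*pi"]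
          by eventually_elim (use that True in \<open>auto simp: S_def g_def split: split_indicator\<close>)
      qed
      then show ?thesis using True by (subst (asm) nn_integral_cmult) auto
    next
      case False
      then have "indicator S (Complex x y) = (0::ennreal)" for y by (auto simp: S_def)
      then show ?thesis using False by simp
    qed
    show "AE x in lborel. (\<integral>\<^sup>+ y. ennreal \<bar>x\<bar> * f (g (Complex x y)) * indicator S (Complex x y) \<partial>lborel) =
       ennreal x * (\<integral>\<^sup>+ t\<in>{0..2*pi}. f (c + complex_of_real x * cis t) \<partial>lborel) * indicator {0..\<delta>} x"
      using AE_lborel_singleton[of 0] AE_lborel_singleton[of \<delta>] by eventually_elim (use * in auto)
  qed
  finally show ?thesis .
qed

section \<open>One-dimensional integrals as nonnegative Lebesgue integrals\<close>

lemma nn_integral_interval_has_integral: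
  fixes f :: "real \<Rightarrow> real"
  assumes int: "(f has_integral I) {a..b}"
    and meas: "(\<lambda>t. indicator {a..b} t *\<^sub>R f t) \<in> borel_measurable borel"
    and nonneg: "\<And>t. t \<in> {a..b} \<Longrightarrow> 0 \<le> f t"
  shows "(\<integral>\<^sup>+ t\<in>{a..b}. ennreal (f t) \<partial>lborel) = ennreal I"
proof -
  have "(\<integral>\<^sup>+ t. ennreal (indicator {a..b} t *\<^sub>R f t) \<partial>lborel) = ennreal I"
  proof (rule nn_integral_has_integral_lborel[OF meas])
    have "(\<lambda>t. indicator {a..b} t *\<^sub>R f t) = (\<lambda>t. if t \<in> {a..b} then f t else 0)" by auto
    then show "((\<lambda>t. indicator {a..b} t *\<^sub>R f t) has_integral I) UNIV"
      using int by (simp only: has_integral_restrict_UNIV)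
  qed (use nonneg in \<open>auto split: split_indicator\<close>)
  then show ?thesis
    by (simp add: ennreal_mult'' mult.commute flip: ennreal_indicator)
qed

lemma nn_integral_powr_from_0:
  assumes "-1 < (\<beta>::real)" "0 \<le> M"
  shows "(\<integral>\<^sup>+ t\<in>{0..M}. ennreal (t powr \<beta>) \<partial>lborel) = ennreal (M powr (\<beta> + 1) / (\<beta> + 1))"
  using assms by (intro nn_integral_interval_has_integral has_integral_powr_from_0) auto

lemma nn_integral_one_minus_powr:
  assumes "-1 < (\<beta>::real)"
  shows "(\<integral>\<^sup>+ t\<in>{0..1}. ennreal ((1 - t) powr \<beta>) \<partial>lborel) = ennreal (1 / (\<beta> + 1))"
proof (rule nn_integral_interval_has_integral)
  have "((\<lambda>t. t powr \<beta>) has_integral 1 / (\<beta> + 1)) (cbox 0 1)"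
    using has_integral_powr_from_0[OF assms, of 1] by simp
  from has_integral_affinity[OF this, of "-1" 1]
  show "((\<lambda>t. (1 - t) powr \<beta>) has_integral 1 / (\<beta> + 1)) {0..1}"
    by simp
qed auto

lemma nn_integral_interval_continuous:
  fixes f :: "real \<Rightarrow> real"
  assumes "continuous_on {a..b} f" "\<And>t. t \<in> {a..b} \<Longrightarrow> 0 \<le> f t"
  shows "(\<integral>\<^sup>+ t\<in>{a..b}. ennreal (f t) \<partial>lborel) = ennreal (integral {a..b} f)"
  using assms by (intro nn_integral_interval_has_integral integrable_integral integrable_continuous_real
      borel_measurable_continuous_on_indicator) auto

section \<open>Cauchy's formula on circles and mean value inequalities\<close>

lemma Cauchy_integral_circle:
  fixes f :: "complex \<Rightarrow> complex"
  assumes hol: "f holomorphic_on cball z r" and w: "norm (w - z) < r"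
  shows "((\<lambda>t. f (z + complex_of_real r * cis t) * (complex_of_real r * cis t / (z + complex_of_real r * cis t - w)))
      has_integral 2 * pi * f w) {0..2*pi}"
proof -
  have "((\<lambda>u. f u / (u - w)) has_contour_integral (2 * of_real pi * \<i> * f w)) (circlepath z r)"
    by (rule Cauchy_integral_circlepath_simple[OF hol w])
  then have "((\<lambda>t. f (z + r * cis t) / (z + r * cis t - w) * r * \<i> * cis t) has_integral 2 * of_real pi * \<i> * f w) {0..2*pi}"
    unfolding circlepath_def by (subst (asm) has_contour_integral_part_circlepath_iff) auto
  from has_integral_mult_right[OF this, of "-\<i>"] show ?thesis
    by (simp add: field_simps)
qed

lemma mean_value_circle:
  fixes f :: "complex \<Rightarrow> complex"
  assumes hol: "f holomorphic_on cball z r" and r: "0 < r"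
  shows "((\<lambda>t. f (z + complex_of_real r * cis t)) has_integral 2 * pi * f z) {0..2*pi}"
  using Cauchy_integral_circle[OF hol, of z] r by simp

lemma continuous_on_circle:
  fixes f :: "complex \<Rightarrow> 'a::topological_space"
  assumes "continuous_on (cball z r) f" "0 \<le> r"
  shows "continuous_on A (\<lambda>t. f (z + complex_of_real r * cis t))"
  by (rule continuous_on_compose2[OF assms(1)])
     (auto intro!: continuous_intros simp: cis_conv_exp[abs_def] dist_norm norm_mult assms(2))

text \<open>On the circle the Cauchy kernel r / |z + r cis t - w| is at most r / (r - |w - z|).
  Off-centre points are needed for bounds by means over circles about the origin; at the centre the
  factor is 1.\<close>

lemma norm_le_circle_integral:
  fixes f :: "complex \<Rightarrow> complex"
  assumes hol: "f holomorphic_on cball z r" and w: "norm (w - z) < r"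
  shows "2 * pi * norm (f w) \<le> r / (r - norm (w - z)) * integral {0..2*pi} (\<lambda>t. norm (f (z + complex_of_real r * cis t)))"
proof -
  have r: "0 < r" using w norm_ge_zero[of "w - z"] by linarith
  have cont: "continuous_on {0..2*pi} (\<lambda>t. norm (f (z + complex_of_real r * cis t)))"
    using continuous_on_circle[OF holomorphic_on_imp_continuous_on[OF hol]] r by (intro continuous_intros) auto
  define F where "F t = f (z + complex_of_real r * cis t) * (complex_of_real r * cis t / (z + complex_of_real r * cis t - w))" for t
  have F: "(F has_integral 2 * pi * f w) {0..2*pi}"
    unfolding F_def[abs_def] by (rule Cauchy_integral_circle[OF hol w])
  have "norm (integral {0..2*pi} F) \<le> integral {0..2*pi} (\<lambda>t. r / (r - norm (w - z)) * norm (f (z + complex_of_real r * cis t)))"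
  proof (rule integral_norm_bound_integral)
    show "F integrable_on {0..2*pi}" using F by blast
    show "(\<lambda>t. r / (r - norm (w - z)) * norm (f (z + complex_of_real r * cis t))) integrable_on {0..2*pi}"
      by (intro integrable_continuous_real continuous_intros cont)
    fix t
    have "z + complex_of_real r * cis t - w = complex_of_real r * cis t - (w - z)" by simp
    then have *: "r - norm (w - z) \<le> norm (z + complex_of_real r * cis t - w)"
      using norm_triangle_ineq2[of "complex_of_real r * cis t" "w - z"] r by (simp only: norm_mult norm_cis) simp
    have "norm (f (z + complex_of_real r * cis t) * (complex_of_real r * cis t / (z + complex_of_real r * cis t - w)))
      = norm (f (z + complex_of_real r * cis t)) * (r / norm (z + complex_of_real r * cis t - w))"
      using r by (simp add: norm_mult norm_divide)
    also have "\<dots> \<le> norm (f (z + complex_of_real r * cis t)) * (r / (r - norm (w - z)))"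
      using * w r by (intro mult_left_mono divide_left_mono mult_pos_pos) auto
    finally show "norm (F t) \<le> r / (r - norm (w - z)) * norm (f (z + complex_of_real r * cis t))"
      by (simp add: mult.commute F_def)
  qed
  then show ?thesis using integral_unique[OF F] by (simp add: norm_mult)
qed

text \<open>The mean value inequality on the circle of radius r is multiplied by r and integrated
  over r from 0 to \<delta>.\<close>

lemma norm_le_disc_integral:
  fixes f :: "complex \<Rightarrow> complex"
  assumes hol: "f holomorphic_on ball z \<delta>" and \<delta>: "0 < \<delta>"
  shows "ennreal (pi * \<delta>\<^sup>2 * norm (f z)) \<le> (\<integral>\<^sup>+ w\<in>ball z \<delta>. ennreal (norm (f w)) \<partial>lborel)"
proof -
  define F where "F w = indicator (ball z \<delta>) w *\<^sub>R norm (f w)" for w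
  have [measurable]: "F \<in> borel_measurable borel"
    unfolding F_def using holomorphic_on_imp_continuous_on[OF hol]
    by (intro borel_measurable_continuous_on_indicator continuous_intros) auto
  have inner: "ennreal (2 * pi * norm (f z)) \<le> (\<integral>\<^sup>+ t\<in>{0..2*pi}. ennreal (F (z + complex_of_real r * cis t)) \<partial>lborel)"
    if r: "0 < r" "r < \<delta>" for r
  proof -
    have sub: "cball z r \<subseteq> ball z \<delta>" using r by auto
    have hol': "f holomorphic_on cball z r" using hol sub by (rule holomorphic_on_subset)
    have "2 * pi * norm (f z) \<le> integral {0..2*pi} (\<lambda>t. norm (f (z + complex_of_real r * cis t)))"
      using norm_le_circle_integral[OF hol', of z] r by simp
    then have "ennreal (2 * pi * norm (f z)) \<le> ennreal (integral {0..2*pi} (\<lambda>t. norm (f (z + complex_of_real r * cis t))))"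
      by (rule ennreal_leI)
    also have "\<dots> = (\<integral>\<^sup>+ t\<in>{0..2*pi}. ennreal (norm (f (z + complex_of_real r * cis t))) \<partial>lborel)"
      using continuous_on_circle[OF holomorphic_on_imp_continuous_on[OF hol']] r
      by (intro nn_integral_interval_continuous[symmetric] continuous_intros) auto
    also have "\<dots> = (\<integral>\<^sup>+ t\<in>{0..2*pi}. ennreal (F (z + complex_of_real r * cis t)) \<partial>lborel)"
      using r by (intro nn_integral_cong) (simp add: F_def dist_norm norm_mult)
    finally show ?thesis .
  qed
  have "ennreal (pi * \<delta>\<^sup>2 * norm (f z)) = (\<integral>\<^sup>+ r\<in>{0..\<delta>}. ennreal (2 * pi * norm (f z) * r) \<partial>lborel)"
  proof (rule nn_integral_interval_has_integral[symmetric])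
    have "((\<lambda>r. 2 * pi * norm (f z) * r) has_integral 2 * pi * norm (f z) * ((\<delta>\<^sup>2 - 0\<^sup>2) / 2)) {0..\<delta>}"
      using \<delta> by (intro has_integral_mult_right ident_has_integral) auto
    then show "((\<lambda>r. 2 * pi * norm (f z) * r) has_integral pi * \<delta>\<^sup>2 * norm (f z)) {0..\<delta>}" by (simp add: field_simps)
  qed auto
  also have "\<dots> \<le> (\<integral>\<^sup>+ r\<in>{0..\<delta>}. ennreal r * (\<integral>\<^sup>+ t\<in>{0..2*pi}. ennreal (F (z + complex_of_real r * cis t)) \<partial>lborel) \<partial>lborel)"
  proof (rule nn_integral_mono_AE)
    show "AE r in lborel. ennreal (2 * pi * norm (f z) * r) * indicator {0..\<delta>} r \<le>
      ennreal r * (\<integral>\<^sup>+ t\<in>{0..2*pi}. ennreal (F (z + complex_of_real r * cis t)) \<partial>lborel) * indicator {0..\<delta>} r"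
      using AE_lborel_singleton[of 0] AE_lborel_singleton[of \<delta>]
    proof eventually_elim
      fix r assume "r \<noteq> 0" "r \<noteq> \<delta>"
      then show "ennreal (2 * pi * norm (f z) * r) * indicator {0..\<delta>} r \<le>
        ennreal r * (\<integral>\<^sup>+ t\<in>{0..2*pi}. ennreal (F (z + complex_of_real r * cis t)) \<partial>lborel) * indicator {0..\<delta>} r"
        using inner[of r] by (auto split: split_indicator simp: mult.commute[of _ r] ennreal_mult intro!: mult_left_mono)
    qed
  qed
  also have "\<dots> = (\<integral>\<^sup>+ w\<in>ball z \<delta>. ennreal (F w) \<partial>lborel)"
    by (rule nn_integral_polar[symmetric]) simp
  also have "\<dots> = (\<integral>\<^sup>+ w\<in>ball z \<delta>. ennreal (norm (f w)) \<partial>lborel)"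
    by (intro nn_integral_cong) (auto simp: F_def split: split_indicator)
  finally show ?thesis .
qed

section \<open>Growth of Hardy and Bergman functions\<close>

text \<open>The order of growth is the infimum of the admissible \<tau>. Working with the predicate
  avoids the question whether the infimum is attained; strict inequalities between exponents absorb
  the difference.\<close>

definition growth :: "real \<Rightarrow> (complex \<Rightarrow> complex) \<Rightarrow> bool" where
  "growth \<tau> f \<longleftrightarrow> (\<exists>C. \<forall>z\<in>ball 0 1. norm (f z) \<le> C * (1 - norm z) powr (-\<tau>))"

lemma growthI:
  assumes "\<And>z. norm z < 1 \<Longrightarrow> norm (f z) \<le> C * (1 - norm z) powr (-\<tau>)"
  shows "growth \<tau> f"
  unfolding growth_def by (rule exI[of _ C]) (use assms in simp)

lemma growthE:
  assumes "growth \<tau> f"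
  obtains C where "C > 0" "\<And>z. norm z < 1 \<Longrightarrow> norm (f z) \<le> C * (1 - norm z) powr (-\<tau>)"
proof -
  from assms obtain C where "\<forall>z\<in>ball 0 1. norm (f z) \<le> C * (1 - norm z) powr (-\<tau>)"
    unfolding growth_def by blast
  then have C: "norm (f z) \<le> C * (1 - norm z) powr (-\<tau>)" if "norm z < 1" for z
    using that by simp
  have "norm (f z) \<le> (\<bar>C\<bar> + 1) * (1 - norm z) powr (-\<tau>)" if "norm z < 1" for z
    by (rule order_trans[OF C[OF that] mult_right_mono]) auto
  then show ?thesis by (intro that[of "\<bar>C\<bar> + 1"]) auto
qed

lemma one_minus_powr_mono:
  fixes r :: real
  assumes "0 \<le> r" "r < 1" "a \<le> b"
  shows "(1 - r) powr (-a) \<le> (1 - r) powr (-b)"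
  using assms powr_mono'[of "-b" "-a" "1 - r"] by auto

lemma growth_mono:
  assumes "growth \<sigma> f" "\<sigma> \<le> \<tau>"
  shows "growth \<tau> f"
proof -
  from growthE[OF assms(1)] obtain C where C: "C > 0" "\<And>z. norm z < 1 \<Longrightarrow> norm (f z) \<le> C * (1 - norm z) powr (-\<sigma>)" by blast
  have "norm (f z) \<le> C * (1 - norm z) powr (-\<tau>)" if "norm z < 1" for z
  proof -
    have "norm (f z) \<le> C * (1 - norm z) powr (-\<sigma>)" using C(2)[OF that] .
    also have "\<dots> \<le> C * (1 - norm z) powr (-\<tau>)"
      using that assms(2) C(1) by (intro mult_left_mono one_minus_powr_mono) auto
    finally show ?thesis .
  qed
  then show ?thesis by (rule growthI)
qed

text \<open>A p-th root of the bound. The constant \<open>a\<close> is absorbed because (1 -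
  |z|)^(-s/p) is at least 1, which is where 0 \<le> s enters.\<close>

lemma growth_if_powr_bound:
  assumes p: "0 < p" and s: "0 \<le> s"
    and bound: "\<And>z. norm z < 1 \<Longrightarrow> norm (f z - a) powr p \<le> C * (1 - norm z) powr (-s)"
  shows "growth (s / p) f"
proof -
  have "norm (f z) \<le> (\<bar>C\<bar> powr (1/p) + norm a) * (1 - norm z) powr (-(s/p))" if z: "norm z < 1" for z
  proof -
    have "norm (f z - a) = (norm (f z - a) powr p) powr (1/p)"
      using p by (simp add: powr_powr)
    also have "\<dots> \<le> (\<bar>C\<bar> * (1 - norm z) powr (-s)) powr (1/p)"
      using p by (intro powr_mono2 order_trans[OF bound[OF z]] mult_right_mono) auto
    also have "\<dots> = \<bar>C\<bar> powr (1/p) * (1 - norm z) powr (-(s/p))"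
      using z by (simp add: powr_mult powr_powr)
    finally have 1: "norm (f z - a) \<le> \<bar>C\<bar> powr (1/p) * (1 - norm z) powr (-(s/p))" .
    have "1 \<le> (1 - norm z) powr (-(s/p))"
      using one_minus_powr_mono[of "norm z" 0 "s/p"] z p s by auto
    then have "norm a \<le> norm a * (1 - norm z) powr (-(s/p))"
      using mult_left_mono[of 1 _ "norm a"] by fastforce
    moreover have "norm (f z) \<le> norm (f z - a) + norm a"
      using norm_triangle_ineq[of "f z - a" a] by simp
    ultimately show ?thesis using 1 by (simp add: algebra_simps)
  qed
  then show ?thesis by (rule growthI)
qed

text \<open>A zero-free function on the disc has a logarithm L, and E = exp(q L). Only moduli are
  recorded, so the choice of the branch is invisible; E' = q L' E and F' = L' F give the
  derivative.\<close>

lemma holomorphic_power: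
  assumes hol: "F holomorphic_on ball 0 1" and nz: "\<And>z. norm z < 1 \<Longrightarrow> F z \<noteq> 0" and q: "0 < q"
  obtains E where "E holomorphic_on ball 0 1" "\<And>z. norm z < 1 \<Longrightarrow> norm (E z) = norm (F z) powr q"
    "\<And>z. norm z < 1 \<Longrightarrow> norm (deriv E z) = q * norm (F z) powr (q - 1) * norm (deriv F z)"
proof -
  obtain L where L: "L holomorphic_on ball 0 1" "\<And>z. z \<in> ball 0 1 \<Longrightarrow> F z = exp (L z)"
    using contractible_imp_holomorphic_log[OF hol convex_imp_contractible[OF convex_ball]] nz by auto
  define E where "E z = exp (complex_of_real q * L z)" for z
  have holE: "E holomorphic_on ball 0 1" unfolding E_def[abs_def] by (intro holomorphic_intros L(1))
  have normE: "norm (E z) = norm (F z) powr q" if "norm z < 1" for z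
    using L(2)[of z] that by (simp add: E_def powr_def)
  have "norm (deriv E z) = q * norm (F z) powr (q - 1) * norm (deriv F z)" if z: "norm z < 1" for z
  proof -
    have zb: "z \<in> ball 0 1" using z by simp
    have dL: "(L has_field_derivative deriv L z) (at z)"
      by (rule holomorphic_derivI[OF L(1) open_ball zb])
    have "(E has_field_derivative (complex_of_real q * deriv L z * E z)) (at z)"
      unfolding E_def[abs_def] by (auto intro!: derivative_eq_intros dL)
    then have dE: "deriv E z = complex_of_real q * deriv L z * E z" by (rule DERIV_imp_deriv)
    have "((\<lambda>z. exp (L z)) has_field_derivative (deriv L z * exp (L z))) (at z)"
      by (auto intro!: derivative_eq_intros dL)
    then have "(F has_field_derivative (deriv L z * exp (L z))) (at z)"
      by (rule has_field_derivative_transform_within_open[OF _ open_ball zb]) (simp add: L(2))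
    then have dF: "deriv F z = deriv L z * F z" using L(2)[OF zb] by (simp add: DERIV_imp_deriv)
    have "norm (F z) powr q = norm (F z) powr (q - 1) * norm (F z)"
      using nz[OF z] powr_add[of "norm (F z)" "q - 1" 1] by simp
    then show ?thesis
      unfolding dE dF norm_mult normE[OF z] using q by simp
  qed
  then show ?thesis using that holE normE by blast
qed

text \<open>Bounding the sum by twice the larger term works for every exponent, also below 1, where
  Minkowski's inequality fails.\<close>

lemma add_powr_le:
  fixes x y p :: real
  assumes "0 \<le> x" "0 \<le> y" "0 \<le> p"
  shows "(x + y) powr p \<le> 2 powr p * (x powr p + y powr p)"
proof -
  have "(x + y) powr p \<le> (2 * max x y) powr p" using assms by (intro powr_mono2) auto
  also have "\<dots> = 2 powr p * max x y powr p" using assms by (simp add: powr_mult)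
  also have "\<dots> \<le> 2 powr p * (x powr p + y powr p)" by (intro mult_left_mono) (auto simp: max_def)
  finally show ?thesis .
qed

lemma norm_diff_powr_le:
  fixes x a :: "'a::real_normed_vector"
  assumes "0 \<le> p"
  shows "norm (x - a) powr p \<le> 2 powr p * (norm x powr p + norm a powr p)"
  using powr_mono2[OF assms _ norm_triangle_ineq4[of x a]] add_powr_le[of "norm x" "norm a" p] assms by force

text \<open>Makes and undoes the shift by an omitted value in p-th means: it is used both with
  \<open>a\<close> and with \<open>-a\<close>.\<close>

lemma nn_integral_diff_powr_le:
  fixes u :: "'a \<Rightarrow> complex"
  assumes A: "A \<in> sets M" and p: "0 \<le> p"
    and meas: "(\<lambda>x. ennreal (norm (u x) powr p) * indicator A x) \<in> borel_measurable M"
  shows "(\<integral>\<^sup>+ x\<in>A. ennreal (norm (u x - a) powr p) \<partial>M) \<le>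
    ennreal (2 powr p) * ((\<integral>\<^sup>+ x\<in>A. ennreal (norm (u x) powr p) \<partial>M) + ennreal (norm a powr p) * emeasure M A)"
proof -
  have "(\<integral>\<^sup>+ x\<in>A. ennreal (norm (u x - a) powr p) \<partial>M) \<le>
    (\<integral>\<^sup>+ x. ennreal (2 powr p) * (ennreal (norm (u x) powr p) * indicator A x + ennreal (norm a powr p) * indicator A x) \<partial>M)"
  proof (rule nn_integral_mono)
    fix x
    have "ennreal (norm (u x - a) powr p) \<le> ennreal (2 powr p) * (ennreal (norm (u x) powr p) + ennreal (norm a powr p))"
      using norm_diff_powr_le[OF p, of "u x" a] by (simp flip: ennreal_plus ennreal_mult add: ennreal_leI)
    then show "ennreal (norm (u x - a) powr p) * indicator A x \<le>
      ennreal (2 powr p) * (ennreal (norm (u x) powr p) * indicator A x + ennreal (norm a powr p) * indicator A x)"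
      by (auto split: split_indicator)
  qed
  also have "\<dots> = ennreal (2 powr p) * ((\<integral>\<^sup>+ x\<in>A. ennreal (norm (u x) powr p) \<partial>M) + ennreal (norm a powr p) * emeasure M A)"
    using meas A by (subst nn_integral_cmult, simp, subst nn_integral_add) (auto simp: nn_integral_cmult)
  finally show ?thesis .
qed

section \<open>Integral means and growth\<close>

lemma hardy_boundE:
  assumes "hardy p f"
  obtains B where "B \<ge> 0" "\<And>r. \<lbrakk>0 < r; r < 1\<rbrakk> \<Longrightarrow>
    (\<integral>\<^sup>+ t\<in>{0..2*pi}. ennreal (norm (f (complex_of_real r * cis t)) powr p) \<partial>lborel) \<le> ennreal B"
proof -
  define S where "S = (SUP r\<in>{0<..<1::real}.
        (\<integral>\<^sup>+ t\<in>{0..2*pi}. ennreal (norm (f (complex_of_real r * cis t)) powr p) \<partial>lborel))"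
  have "S < \<infinity>" using assms by (simp add: hardy_def S_def)
  then obtain B where "S = ennreal B" "B \<ge> 0" by (cases S rule: ennreal_cases) auto
  moreover have "(\<integral>\<^sup>+ t\<in>{0..2*pi}. ennreal (norm (f (complex_of_real r * cis t)) powr p) \<partial>lborel) \<le> S"
    if "0 < r" "r < 1" for r
    unfolding S_def using that by (intro SUP_upper) auto
  ultimately show ?thesis using that by auto
qed

lemma hardyI:
  assumes "f holomorphic_on ball 0 1" "\<And>r. \<lbrakk>0 < r; r < 1\<rbrakk> \<Longrightarrow>
    (\<integral>\<^sup>+ t\<in>{0..2*pi}. ennreal (norm (f (complex_of_real r * cis t)) powr p) \<partial>lborel) \<le> ennreal B"
  shows "hardy p f"
proof -
  have "(SUP r\<in>{0<..<1::real}.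
        (\<integral>\<^sup>+ t\<in>{0..2*pi}. ennreal (norm (f (complex_of_real r * cis t)) powr p) \<partial>lborel)) \<le> ennreal B"
    by (rule SUP_least) (use assms(2) in auto)
  also have "\<dots> < \<infinity>" by simp
  finally show ?thesis using assms(1) by (simp add: hardy_def)
qed

lemma continuous_on_unit_circle:
  fixes f :: "complex \<Rightarrow> complex"
  assumes "f holomorphic_on ball 0 1" "0 \<le> r" "r < 1"
  shows "continuous_on A (\<lambda>t. f (complex_of_real r * cis t))"
proof -
  have "continuous_on (cball 0 r) f"
    using assms by (intro holomorphic_on_imp_continuous_on holomorphic_on_subset[OF assms(1)]) auto
  from continuous_on_circle[OF this assms(2), of A] show ?thesis by simp
qed

lemma measurable_circle_powr:
  assumes "f holomorphic_on ball 0 1" "0 \<le> r" "r < 1"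
  shows "(\<lambda>t. norm (f (complex_of_real r * cis t)) powr p) \<in> borel_measurable borel"
  using borel_measurable_continuous_onI[OF continuous_on_unit_circle[OF assms]]
  by measurable

text \<open>|f - a|^p is the modulus of a holomorphic \<open>E\<close> whose means over circles are
  bounded. Cauchy's formula on the circle halfway between z and the boundary then gives |E(z)| =
  O(1/(1 - |z|)).\<close>

lemma hardy_imp_growth:
  assumes H: "hardy p f" and p: "0 < p" and om: "\<And>z. norm z < 1 \<Longrightarrow> f z \<noteq> a"
  shows "growth (1 / p) f"
proof -
  have hol: "f holomorphic_on ball 0 1" using H by (simp add: hardy_def)
  obtain B where B: "B \<ge> 0" "\<And>r. \<lbrakk>0 < r; r < 1\<rbrakk> \<Longrightarrow>
    (\<integral>\<^sup>+ t\<in>{0..2*pi}. ennreal (norm (f (complex_of_real r * cis t)) powr p) \<partial>lborel) \<le> ennreal B"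
    using hardy_boundE[OF H] by blast
  have holF: "(\<lambda>z. f z - a) holomorphic_on ball 0 1" by (intro holomorphic_intros hol)
  obtain E where E: "E holomorphic_on ball 0 1" "\<And>z. norm z < 1 \<Longrightarrow> norm (E z) = norm (f z - a) powr p"
    using holomorphic_power[OF holF _ p] om by (metis eq_iff_diff_eq_0)
  define B' where "B' = 2 powr p * (B + norm a powr p * (2 * pi))"
  have B'0: "B' \<ge> 0" using B by (simp add: B'_def)
  have circ: "integral {0..2*pi} (\<lambda>t. norm (E (complex_of_real r * cis t))) \<le> B'" if r: "0 < r" "r < 1" for r
  proof -
    have "ennreal (integral {0..2*pi} (\<lambda>t. norm (E (complex_of_real r * cis t)))) =
      (\<integral>\<^sup>+ t\<in>{0..2*pi}. ennreal (norm (E (complex_of_real r * cis t))) \<partial>lborel)"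
      using r by (intro nn_integral_interval_continuous[symmetric] continuous_intros continuous_on_unit_circle E(1)) auto
    also have "\<dots> = (\<integral>\<^sup>+ t\<in>{0..2*pi}. ennreal (norm (f (complex_of_real r * cis t) - a) powr p) \<partial>lborel)"
      using r by (intro nn_integral_cong) (simp add: E(2) norm_mult)
    also have "\<dots> \<le> ennreal (2 powr p) * ((\<integral>\<^sup>+ t\<in>{0..2*pi}. ennreal (norm (f (complex_of_real r * cis t)) powr p) \<partial>lborel)
       + ennreal (norm a powr p) * emeasure lborel {0..2*pi})"
      using measurable_circle_powr[OF hol, of r p] r p by (intro nn_integral_diff_powr_le) auto
    also have "\<dots> \<le> ennreal (2 powr p) * (ennreal B + ennreal (norm a powr p) * emeasure lborel {0..2*pi})"
      by (intro mult_left_mono add_right_mono B(2) r) auto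
    also have "\<dots> = ennreal B'"
      using B(1) by (simp add: B'_def ennreal_mult ennreal_plus)
    finally show ?thesis using B'0 by simp
  qed
  have "norm (f z - a) powr p \<le> (B' / pi) * (1 - norm z) powr (-1)" if z: "norm z < 1" for z
  proof -
    define r where "r = (1 + norm z) / 2"
    have r: "0 < r" "r < 1" "norm z < r" using z norm_ge_zero[of z] by (auto simp: r_def simp del: norm_ge_zero)
    have "E holomorphic_on cball 0 r" using r by (intro holomorphic_on_subset[OF E(1)]) auto
    from norm_le_circle_integral[OF this, of z] r
    have "2 * pi * norm (E z) \<le> r / (r - norm z) * integral {0..2*pi} (\<lambda>t. norm (E (complex_of_real r * cis t)))"
      by simp
    also have "\<dots> \<le> 1 / (r - norm z) * B'"
      using circ[OF r(1,2)] r B'0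
      by (intro mult_mono divide_right_mono integral_nonneg integrable_continuous_real continuous_intros
          continuous_on_unit_circle E(1)) auto
    also have "r - norm z = (1 - norm z) / 2" by (simp add: r_def field_simps)
    finally have "norm (E z) \<le> B' / (pi * (1 - norm z))" using z by (simp add: field_simps)
    then show ?thesis using z E(2)[OF z] by (simp add: powr_minus field_simps)
  qed
  from growth_if_powr_bound[OF p _ this] show ?thesis by simp
qed

text \<open>In |f|^q = |f|^p |f|^(q-p) the second factor is bounded by the growth exponent 1/p and
  joins the weight; the first one is integrated over circles by the Hardy condition.\<close>

lemma hardy_imp_bergman:
  assumes H: "hardy p f" and p: "0 < p" and om: "\<And>z. norm z < 1 \<Longrightarrow> f z \<noteq> a"
    and q: "p < q" "q < p * (\<alpha> + 2)"
  shows "bergman q \<alpha> f"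
proof -
  have hol: "f holomorphic_on ball 0 1" using H by (simp add: hardy_def)
  obtain B where B: "B \<ge> 0" "\<And>r. \<lbrakk>0 < r; r < 1\<rbrakk> \<Longrightarrow>
    (\<integral>\<^sup>+ t\<in>{0..2*pi}. ennreal (norm (f (complex_of_real r * cis t)) powr p) \<partial>lborel) \<le> ennreal B"
    using hardy_boundE[OF H] by blast
  obtain C where C: "C > 0" "\<And>z. norm z < 1 \<Longrightarrow> norm (f z) \<le> C * (1 - norm z) powr (-(1/p))"
    using growthE[OF hardy_imp_growth[OF H p om]] by auto
  \<comment> \<open>The weight exponent that is left over. Its integrability, \<beta> > -1, is
    equivalent to q < p (\<alpha> + 2).\<close>
  define \<beta> where "\<beta> = \<alpha> - (q - p) / p"
  have \<beta>: "-1 < \<beta>" using q p by (simp add: \<beta>_def field_simps)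
  define K where "K = C powr (q - p)"
  define F where "F z = indicator (ball 0 1) z *\<^sub>R (norm (f z) powr q * (1 - norm z) powr \<alpha>)" for z
  have [measurable]: "F \<in> borel_measurable borel"
  proof -
    define u where "u z = indicator (ball 0 1) z *\<^sub>R norm (f z)" for z
    have [measurable]: "u \<in> borel_measurable borel" unfolding u_def
      by (intro borel_measurable_continuous_on_indicator continuous_intros holomorphic_on_imp_continuous_on hol) auto
    have eq: "F = (\<lambda>z. indicator (ball 0 1) z * (u z powr q * (1 - norm z) powr \<alpha>))"
      by (auto simp: F_def u_def split: split_indicator)
    have [measurable]: "ball (0::complex) 1 \<in> sets borel" by simp
    have [measurable]: "(\<lambda>z::complex. norm z) \<in> borel_measurable borel" by simp
    show ?thesis unfolding eq by measurable
  qed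
  have pointwise: "F z \<le> K * (1 - norm z) powr \<beta> * norm (f z) powr p" if z: "norm z < 1" for z
  proof -
    have "norm (f z) powr q = norm (f z) powr p * norm (f z) powr (q - p)"
      by (simp flip: powr_add)
    also have "\<dots> \<le> norm (f z) powr p * (C * (1 - norm z) powr (-(1/p))) powr (q - p)"
      using C(2)[OF z] q by (intro mult_left_mono powr_mono2) auto
    also have "(C * (1 - norm z) powr (-(1/p))) powr (q - p) = K * (1 - norm z) powr (-((q-p)/p))"
      using C z by (simp add: powr_mult powr_powr K_def)
    finally have "norm (f z) powr q * (1 - norm z) powr \<alpha> \<le> norm (f z) powr p * (K * (1 - norm z) powr (-((q-p)/p))) * (1 - norm z) powr \<alpha>"
      by (rule mult_right_mono) simp
    also have "\<dots> = K * ((1 - norm z) powr (-((q-p)/p)) * (1 - norm z) powr \<alpha>) * norm (f z) powr p" by simp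
    also have "(1 - norm z) powr (-((q-p)/p)) * (1 - norm z) powr \<alpha> = (1 - norm z) powr \<beta>"
      unfolding powr_add[symmetric] \<beta>_def by simp
    finally show ?thesis using z by (simp add: F_def)
  qed
  have inner: "ennreal r * (\<integral>\<^sup>+ t\<in>{0..2*pi}. ennreal (F (0 + complex_of_real r * cis t)) \<partial>lborel) \<le>
     ennreal (K * B) * ennreal ((1 - r) powr \<beta>)"
    if r: "0 < r" "r < 1" for r
  proof -
    have "(\<integral>\<^sup>+ t\<in>{0..2*pi}. ennreal (F (0 + complex_of_real r * cis t)) \<partial>lborel) \<le>
       (\<integral>\<^sup>+ t. ennreal (K * (1 - r) powr \<beta>) * (ennreal (norm (f (complex_of_real r * cis t)) powr p) * indicator {0..2*pi} t) \<partial>lborel)"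
    proof (rule nn_integral_mono)
      fix t
      have "ennreal (F (0 + complex_of_real r * cis t)) \<le> ennreal (K * (1 - r) powr \<beta> * norm (f (complex_of_real r * cis t)) powr p)"
        using pointwise[of "complex_of_real r * cis t"] r by (intro ennreal_leI) (simp add: norm_mult)
      also have "\<dots> = ennreal (K * (1 - r) powr \<beta>) * ennreal (norm (f (complex_of_real r * cis t)) powr p)"
        by (intro ennreal_mult) (auto simp: K_def)
      finally show "ennreal (F (0 + complex_of_real r * cis t)) * indicator {0..2*pi} t \<le>
        ennreal (K * (1 - r) powr \<beta>) * (ennreal (norm (f (complex_of_real r * cis t)) powr p) * indicator {0..2*pi} t)"
        by (auto split: split_indicator)
    qed
    also have "\<dots> = ennreal (K * (1 - r) powr \<beta>) * (\<integral>\<^sup>+ t\<in>{0..2*pi}. ennreal (norm (f (complex_of_real r * cis t)) powr p) \<partial>lborel)"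
      using measurable_circle_powr[OF hol, of r p] r by (intro nn_integral_cmult) auto
    also have "\<dots> \<le> ennreal (K * (1 - r) powr \<beta>) * ennreal B"
      by (intro mult_left_mono B r) auto
    finally have "(\<integral>\<^sup>+ t\<in>{0..2*pi}. ennreal (F (0 + complex_of_real r * cis t)) \<partial>lborel) \<le> ennreal (K * (1 - r) powr \<beta>) * ennreal B" .
    then have "ennreal r * (\<integral>\<^sup>+ t\<in>{0..2*pi}. ennreal (F (0 + complex_of_real r * cis t)) \<partial>lborel) \<le>
       ennreal 1 * (ennreal (K * (1 - r) powr \<beta>) * ennreal B)"
      using r by (intro mult_mono ennreal_leI) auto
    also have "\<dots> = ennreal (K * B) * ennreal ((1 - r) powr \<beta>)"
      using B by (simp add: K_def mult_ac flip: ennreal_mult)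
    finally show ?thesis .
  qed
  have "(\<integral>\<^sup>+ z\<in>ball 0 1. ennreal (norm (f z) powr q * (1 - norm z) powr \<alpha>) \<partial>lborel) =
    (\<integral>\<^sup>+ z\<in>ball 0 1. ennreal (F z) \<partial>lborel)"
    by (intro nn_integral_cong) (auto simp: F_def split: split_indicator)
  also have "\<dots> = (\<integral>\<^sup>+ r\<in>{0..1}. ennreal r * (\<integral>\<^sup>+ t\<in>{0..2*pi}. ennreal (F (0 + complex_of_real r * cis t)) \<partial>lborel) \<partial>lborel)"
    by (rule nn_integral_polar) simp
  also have "\<dots> \<le> (\<integral>\<^sup>+ r. ennreal (K * B) * (ennreal ((1 - r) powr \<beta>) * indicator {0..1} r) \<partial>lborel)"
  proof (rule nn_integral_mono_AE)
    show "AE r in lborel. ennreal r * (\<integral>\<^sup>+ t\<in>{0..2*pi}. ennreal (F (0 + complex_of_real r * cis t)) \<partial>lborel) * indicator {0..1} r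
      \<le> ennreal (K * B) * (ennreal ((1 - r) powr \<beta>) * indicator {0..1} r)"
      using AE_lborel_singleton[of 0] AE_lborel_singleton[of 1]
      by eventually_elim (use inner in \<open>auto split: split_indicator simp: less_le\<close>)
  qed
  also have "\<dots> = ennreal (K * B) * ennreal (1 / (\<beta> + 1))"
    by (subst nn_integral_cmult) (auto simp: nn_integral_one_minus_powr[OF \<beta>])
  also have "\<dots> < \<infinity>" by (simp add: ennreal_mult_less_top)
  finally show ?thesis using hol by (simp add: bergman_def)
qed

text \<open>The mean value inequality for |f - a|^p is applied on a disc whose radius is half the
  distance of z to the circle. The weight is comparable to \<delta>^\<alpha> there and the area is
  of order \<delta>^2, which together give the exponent \<alpha> + 2.\<close>

lemma bergman_imp_growth:
  assumes H: "bergman p \<alpha> f" and p: "0 < p" and \<alpha>: "-1 < \<alpha>" and om: "\<And>z. norm z < 1 \<Longrightarrow> f z \<noteq> a"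
  shows "growth ((\<alpha> + 2) / p) f"
proof -
  have hol: "f holomorphic_on ball 0 1" using H by (simp add: bergman_def)
  have "(\<integral>\<^sup>+ z\<in>ball 0 1. ennreal (norm (f z) powr p * (1 - norm z) powr \<alpha>) \<partial>lborel) < \<infinity>"
    using H by (simp add: bergman_def)
  then obtain I where I: "(\<integral>\<^sup>+ z\<in>ball 0 1. ennreal (norm (f z) powr p * (1 - norm z) powr \<alpha>) \<partial>lborel) = ennreal I" "0 \<le> I"
    by (cases "(\<integral>\<^sup>+ z\<in>ball 0 1. ennreal (norm (f z) powr p * (1 - norm z) powr \<alpha>) \<partial>lborel)" rule: ennreal_cases) auto
  have holF: "(\<lambda>z. f z - a) holomorphic_on ball 0 1" by (intro holomorphic_intros hol)
  obtain E where E: "E holomorphic_on ball 0 1" "\<And>z. norm z < 1 \<Longrightarrow> norm (E z) = norm (f z - a) powr p"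
    using holomorphic_power[OF holF _ p] om by (metis eq_iff_diff_eq_0)
  \<comment> \<open>On the small disc 1 - |w| lies between \<delta> and 3 \<delta>. The weight is
    smallest at the lower end if \<alpha> \<ge> 0 and at the upper end if \<alpha> < 0;
    \<open>c\<close> serves both cases.\<close>
  define c where "c = min 1 (3 powr \<alpha>)"
  have c: "c > 0" by (simp add: c_def)
  define C where "C = 2 powr p * (I / c / pi + norm a powr p) * 2 powr (\<alpha> + 2)"
  have "norm (f z - a) powr p \<le> C * (1 - norm z) powr (-(\<alpha> + 2))" if z: "norm z < 1" for z
  proof -
    define \<delta> where "\<delta> = (1 - norm z) / 2"
    have \<delta>: "0 < \<delta>" "\<delta> < 1" using z norm_ge_zero[of z] by (auto simp: \<delta>_def simp del: norm_ge_zero)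
    have near: "\<delta> \<le> 1 - norm w \<and> 1 - norm w \<le> 3 * \<delta>" if "w \<in> ball z \<delta>" for w
      using that norm_triangle_ineq2[of z w] norm_triangle_ineq2[of w z]
      by (auto simp: dist_norm norm_minus_commute \<delta>_def field_simps)
    have sub: "ball z \<delta> \<subseteq> ball 0 1" using near \<delta> by fastforce
    have weight: "c * \<delta> powr \<alpha> \<le> (1 - norm w) powr \<alpha>" if w: "w \<in> ball z \<delta>" for w
    proof (cases "\<alpha> \<ge> 0")
      case True
      then have "\<delta> powr \<alpha> \<le> (1 - norm w) powr \<alpha>" using near[OF w] \<delta> by (intro powr_mono2) auto
      moreover have "c * \<delta> powr \<alpha> \<le> 1 * \<delta> powr \<alpha>" by (intro mult_right_mono) (auto simp: c_def)
      ultimately show ?thesis by simp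
    next
      case False
      then have "(3 * \<delta>) powr \<alpha> \<le> (1 - norm w) powr \<alpha>" using near[OF w] \<delta> by (intro powr_mono2') auto
      moreover have "c * \<delta> powr \<alpha> \<le> 3 powr \<alpha> * \<delta> powr \<alpha>" by (intro mult_right_mono) (auto simp: c_def)
      moreover have "3 powr \<alpha> * \<delta> powr \<alpha> = (3 * \<delta>) powr \<alpha>" using \<delta> by (simp add: powr_mult)
      ultimately show ?thesis by linarith
    qed
    have meas: "(\<lambda>w. ennreal (norm (f w) powr p) * indicator (ball z \<delta>) w) \<in> borel_measurable lborel"
    proof -
      define u where "u w = indicator (ball z \<delta>) w *\<^sub>R norm (f w)" for w
      have [measurable]: "u \<in> borel_measurable borel" unfolding u_def
        by (intro borel_measurable_continuous_on_indicator continuous_intros holomorphic_on_imp_continuous_on holomorphic_on_subset[OF hol sub]) auto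
      have eq: "(\<lambda>w. ennreal (norm (f w) powr p) * indicator (ball z \<delta>) w) = (\<lambda>w. ennreal (u w powr p) * indicator (ball z \<delta>) w)"
        by (auto simp: u_def split: split_indicator)
      have [measurable]: "ball z \<delta> \<in> sets borel" by simp
    have [measurable]: "(\<lambda>z::complex. norm z) \<in> borel_measurable borel" by simp
    show ?thesis unfolding eq by measurable
    qed
    have "ennreal (c * \<delta> powr \<alpha>) * (\<integral>\<^sup>+ w\<in>ball z \<delta>. ennreal (norm (f w) powr p) \<partial>lborel)
      = (\<integral>\<^sup>+ w. ennreal (c * \<delta> powr \<alpha>) * (ennreal (norm (f w) powr p) * indicator (ball z \<delta>) w) \<partial>lborel)"
      by (rule nn_integral_cmult[symmetric, OF meas])
    also have "\<dots> \<le> (\<integral>\<^sup>+ w\<in>ball 0 1. ennreal (norm (f w) powr p * (1 - norm w) powr \<alpha>) \<partial>lborel)"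
    proof (rule nn_integral_mono)
      fix w
      show "ennreal (c * \<delta> powr \<alpha>) * (ennreal (norm (f w) powr p) * indicator (ball z \<delta>) w) \<le>
        ennreal (norm (f w) powr p * (1 - norm w) powr \<alpha>) * indicator (ball 0 1) w"
      proof (cases "w \<in> ball z \<delta>")
        case True
        have "ennreal (c * \<delta> powr \<alpha>) * ennreal (norm (f w) powr p) = ennreal (norm (f w) powr p * (c * \<delta> powr \<alpha>))"
          using c by (simp add: mult.commute flip: ennreal_mult)
        also have "\<dots> \<le> ennreal (norm (f w) powr p * (1 - norm w) powr \<alpha>)"
          using weight[OF True] by (intro ennreal_leI mult_left_mono) auto
        finally show ?thesis using True sub by auto
      qed simp
    qed
    finally have loc: "ennreal (c * \<delta> powr \<alpha>) * (\<integral>\<^sup>+ w\<in>ball z \<delta>. ennreal (norm (f w) powr p) \<partial>lborel) \<le> ennreal I"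
      unfolding I(1) .
    have cd: "c * \<delta> powr \<alpha> > 0" using c \<delta> by simp
    obtain J where J: "(\<integral>\<^sup>+ w\<in>ball z \<delta>. ennreal (norm (f w) powr p) \<partial>lborel) = ennreal J" "0 \<le> J"
      using loc cd c \<delta> by (cases "(\<integral>\<^sup>+ w\<in>ball z \<delta>. ennreal (norm (f w) powr p) \<partial>lborel)" rule: ennreal_cases)
        (auto simp: ennreal_mult_top top_unique)
    have "c * \<delta> powr \<alpha> * J \<le> I"
      using loc cd J I(2) by (simp flip: ennreal_mult)
    then have JI: "J \<le> I / c * \<delta> powr (-\<alpha>)"
      using c \<delta> by (simp add: field_simps powr_minus)
    have "ennreal (pi * \<delta>\<^sup>2 * norm (E z)) \<le> (\<integral>\<^sup>+ w\<in>ball z \<delta>. ennreal (norm (E w)) \<partial>lborel)"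
      by (rule norm_le_disc_integral[OF holomorphic_on_subset[OF E(1) sub] \<delta>(1)])
    also have "\<dots> = (\<integral>\<^sup>+ w\<in>ball z \<delta>. ennreal (norm (f w - a) powr p) \<partial>lborel)"
      using sub by (intro nn_integral_cong) (auto simp: E(2) split: split_indicator)
    also have "\<dots> \<le> ennreal (2 powr p) * (ennreal J + ennreal (norm a powr p) * emeasure lborel (ball z \<delta>))"
      unfolding J(1)[symmetric] by (rule nn_integral_diff_powr_le[OF _ _ meas]) (use p in auto)
    also have "emeasure lborel (ball z \<delta>) = ennreal (pi * \<delta>\<^sup>2)"
      using \<delta> by (simp add: emeasure_ball unit_ball_vol_2)
    also have "ennreal (2 powr p) * (ennreal J + ennreal (norm a powr p) * ennreal (pi * \<delta>\<^sup>2)) = ennreal (2 powr p * (J + norm a powr p * (pi * \<delta>\<^sup>2)))"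
      using J \<delta> by (simp add: ennreal_mult ennreal_plus)
    finally have "pi * \<delta>\<^sup>2 * norm (E z) \<le> 2 powr p * (J + norm a powr p * (pi * \<delta>\<^sup>2))"
      using J \<delta> by (subst (asm) ennreal_le_iff) auto
    also have "\<dots> \<le> 2 powr p * (I / c * \<delta> powr (-\<alpha>) + norm a powr p * (pi * \<delta>\<^sup>2))"
      using JI by (intro mult_left_mono add_right_mono) auto
    finally have "norm (E z) \<le> 2 powr p * (I / c * \<delta> powr (-\<alpha>) + norm a powr p * (pi * \<delta>\<^sup>2)) / (pi * \<delta>\<^sup>2)"
      using \<delta> by (simp add: field_simps)
    also have "\<dots> = 2 powr p * (I / c / pi * (\<delta> powr (-\<alpha>) / \<delta>\<^sup>2) + norm a powr p)"
      using \<delta> by (simp add: field_simps)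
    also have "\<delta> powr (-\<alpha>) / \<delta>\<^sup>2 = \<delta> powr (-(\<alpha> + 2))"
      using \<delta> powr_diff[of \<delta> "-\<alpha>" 2] by (simp add: powr_numeral)
    also have "2 powr p * (I / c / pi * \<delta> powr (-(\<alpha> + 2)) + norm a powr p) \<le>
       2 powr p * (I / c / pi * \<delta> powr (-(\<alpha> + 2)) + norm a powr p * \<delta> powr (-(\<alpha> + 2)))"
    proof -
      have "1 \<le> \<delta> powr (-(\<alpha> + 2))" using \<delta> \<alpha> powr_mono'[of "-(\<alpha> + 2)" 0 \<delta>] by auto
      then have "norm a powr p * 1 \<le> norm a powr p * \<delta> powr (-(\<alpha> + 2))" by (intro mult_left_mono) auto
      then show ?thesis by simp
    qed
    also have "\<dots> = 2 powr p * (I / c / pi + norm a powr p) * \<delta> powr (-(\<alpha> + 2))"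
      by (simp add: algebra_simps)
    also have "\<delta> powr (-(\<alpha> + 2)) = 2 powr (\<alpha> + 2) * (1 - norm z) powr (-(\<alpha> + 2))"
      using z powr_add[of 2 "\<alpha> + 2" "-\<alpha> - 2"] by (simp add: \<delta>_def powr_divide powr_minus field_simps)
    finally show ?thesis using E(2)[OF z] by (simp add: C_def mult_ac)
  qed
  from growth_if_powr_bound[OF p _ this] \<alpha> show ?thesis by simp
qed

section \<open>Inequalities between the numbers of one function\<close>

lemma hardy_num_le_bergman_alpha_num:
  assumes \<alpha>: "-1 < \<alpha>" and om: "\<And>z. norm z < 1 \<Longrightarrow> f z \<noteq> a"
  shows "hardy_num f \<le> bergman_alpha_num \<alpha> f / ereal (\<alpha> + 2)"
  unfolding hardy_num_def
proof (rule Sup_least)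
  have nonneg: "0 \<le> bergman_alpha_num \<alpha> f" unfolding bergman_alpha_num_def by (rule Sup_upper) auto
  fix x assume "x \<in> {0} \<union> {ereal p |p. 0 < p \<and> hardy p f}"
  then consider "x = 0" | p where "x = ereal p" "0 < p" "hardy p f" by auto
  then show "x \<le> bergman_alpha_num \<alpha> f / ereal (\<alpha> + 2)"
  proof cases
    case 1
    then show ?thesis using nonneg \<alpha> by (simp add: ereal_le_divide_pos)
  next
    case 2
    have "ereal ((\<alpha> + 2) * p) \<le> bergman_alpha_num \<alpha> f"
    proof (rule dense_le)
      fix y assume y: "y < ereal ((\<alpha> + 2) * p)"
      \<comment> \<open>Since \<alpha> + 2 > 1 there are exponents q strictly between p and
        (\<alpha> + 2) p; the upper endpoint itself is only approached.\<close>
      have "p < (\<alpha> + 2) * p" using 2 \<alpha> by simp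
      then have "max y (ereal p) < ereal ((\<alpha> + 2) * p)" using y by simp
      then obtain q where q: "max y (ereal p) < ereal q" "ereal q < ereal ((\<alpha> + 2) * p)"
        using ereal_dense2 by blast
      then have "bergman q \<alpha> f"
        using hardy_imp_bergman[OF 2(3,2) om, of q \<alpha>] by (simp add: mult.commute)
      then have "ereal q \<le> bergman_alpha_num \<alpha> f"
        unfolding bergman_alpha_num_def using q 2 by (intro Sup_upper) auto
      then show "y \<le> bergman_alpha_num \<alpha> f" using q by (auto intro: order_trans less_imp_le)
    qed
    then show ?thesis using 2 \<alpha> by (simp add: ereal_le_divide_pos)
  qed
qed

lemma bergman_alpha_num_le_bergman_num:
  assumes \<alpha>: "-1 < \<alpha>"
  shows "bergman_alpha_num \<alpha> f / ereal (\<alpha> + 2) \<le> bergman_num f"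
proof -
  have "bergman_alpha_num \<alpha> f \<le> ereal (\<alpha> + 2) * bergman_num f"
    unfolding bergman_alpha_num_def
  proof (rule Sup_least)
    fix x assume "x \<in> {0} \<union> {ereal p |p. 0 < p \<and> bergman p \<alpha> f}"
    then consider "x = 0" | p where "x = ereal p" "0 < p" "bergman p \<alpha> f" by auto
    then show "x \<le> ereal (\<alpha> + 2) * bergman_num f"
    proof cases
      case 1
      have "0 \<le> bergman_num f" unfolding bergman_num_def by (rule Sup_upper) auto
      then show ?thesis using 1 \<alpha> by simp
    next
      case 2
      have "ereal (p / (\<alpha> + 2)) \<le> bergman_num f"
        unfolding bergman_num_def using 2 \<alpha> by (intro Sup_upper) auto
      from ereal_mult_left_mono[OF this, of "ereal (\<alpha> + 2)"] show ?thesis using 2 \<alpha> by simp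
    qed
  qed
  then show ?thesis using \<alpha> by (simp add: ereal_divide_le_pos)
qed

lemma growth_if_less_bergman_num:
  assumes x: "0 < x" "ereal x < bergman_num f" and om: "\<And>z. norm z < 1 \<Longrightarrow> f z \<noteq> a"
  shows "growth (1 / x) f"
proof -
  from x(2) obtain p \<alpha> where p: "p > 0" "\<alpha> > -1" "bergman p \<alpha> f" "x < p / (\<alpha> + 2)"
    using x(1) unfolding bergman_num_def less_Sup_iff by auto
  have "(\<alpha> + 2) / p \<le> 1 / x" using p x by (simp add: field_simps)
  then show ?thesis using bergman_imp_growth[OF p(3,1,2) om] growth_mono by blast
qed

section \<open>Littlewood subordination and Prawitz' theorem\<close>

text \<open>Orthogonality of constants and functions of mean zero: the cross term 2 Re(cnj c K)
  integrates to K(0) = 0. This is the induction step of both square estimates that follow, and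
  replaces the orthogonality of all powers.\<close>

lemma circle_square_split:
  assumes hol: "K holomorphic_on cball 0 \<rho>" and K0: "K 0 = 0" and \<rho>: "0 < \<rho>"
  shows "integral {0..2*pi} (\<lambda>t. (norm (c + K (complex_of_real \<rho> * cis t)))\<^sup>2)
    = 2 * pi * (norm c)\<^sup>2 + integral {0..2*pi} (\<lambda>t. (norm (K (complex_of_real \<rho> * cis t)))\<^sup>2)"
proof (rule integral_unique)
  have cont: "continuous_on {0..2*pi} (\<lambda>t. K (complex_of_real \<rho> * cis t))"
    using continuous_on_circle[OF holomorphic_on_imp_continuous_on[OF hol], of "{0..2*pi}"] \<rho> by simp
  have "((\<lambda>t. K (complex_of_real \<rho> * cis t)) has_integral 0) {0..2*pi}"
    using mean_value_circle[OF hol \<rho>] K0 by simp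
  from has_integral_linear[OF has_integral_mult_right[OF this, of "cnj c"] bounded_linear_Re]
  have 1: "((\<lambda>t. Re (cnj c * K (complex_of_real \<rho> * cis t))) has_integral 0) {0..2*pi}"
    by (simp add: o_def)
  have 2: "((\<lambda>t. (norm (K (complex_of_real \<rho> * cis t)))\<^sup>2) has_integral
    integral {0..2*pi} (\<lambda>t. (norm (K (complex_of_real \<rho> * cis t)))\<^sup>2)) {0..2*pi}"
    by (intro integrable_integral integrable_continuous_real continuous_intros cont)
  have 3: "((\<lambda>t. (norm c)\<^sup>2) has_integral 2 * pi * (norm c)\<^sup>2) {0..2*pi}"
    using has_integral_const_real[of "(norm c)\<^sup>2" 0 "2*pi"] by simp
  have eq: "(norm (c + w))\<^sup>2 = (norm c)\<^sup>2 + 2 * Re (cnj c * w) + (norm w)\<^sup>2" for w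
    by (simp add: cmod_power2) (simp add: power2_eq_square algebra_simps)
  show "((\<lambda>t. (norm (c + K (complex_of_real \<rho> * cis t)))\<^sup>2) has_integral
    2 * pi * (norm c)\<^sup>2 + integral {0..2*pi} (\<lambda>t. (norm (K (complex_of_real \<rho> * cis t)))\<^sup>2)) {0..2*pi}"
    unfolding eq using has_integral_add[OF has_integral_add[OF 3 has_integral_mult_right[OF 1, of 2]] 2] by simp
qed

text \<open>Peeling off one coefficient at a time, H = b 0 + z H1, where the factor z contributes
  \<rho>^2 on the circle. The tail that remains after N steps is nonnegative and is dropped.\<close>

lemma Bessel_circle:
  assumes sums: "\<And>z. norm z < 1 \<Longrightarrow> (\<lambda>n. b n * z ^ n) sums H z" and \<rho>: "0 < \<rho>" "\<rho> < 1"
  shows "2 * pi * (\<Sum>n<N. (norm (b n))\<^sup>2 * \<rho> ^ (2 * n)) \<le>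
    integral {0..2*pi} (\<lambda>t. (norm (H (complex_of_real \<rho> * cis t)))\<^sup>2)"
  using sums
proof (induction N arbitrary: b H)
  case 0
  have "0 \<le> integral {0..2*pi} (\<lambda>t. (norm (H (complex_of_real \<rho> * cis t)))\<^sup>2)"
    using integral_nonneg not_integrable_integral by (metis order_refl zero_le_power2)
  then show ?case by simp
next
  case (Suc N)
  define H1 where "H1 z = (\<Sum>n. b (Suc n) * z ^ n)" for z
  have summ: "summable (\<lambda>n. b n * z ^ n)" if "norm z < 1" for z
    using Suc.prems[OF that] by (rule sums_summable)
  have sums1: "(\<lambda>n. b (Suc n) * z ^ n) sums H1 z" if "norm z < 1" for z
    unfolding H1_def using summ[OF that] by (intro summable_sums) (simp add: summable_powser_split_head)
  have H: "H z = b 0 + z * H1 z" if "norm z < 1" for z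
    using powser_split_head(1)[OF summ[OF that]] sums_unique[OF Suc.prems[OF that]]
    by (simp add: H1_def mult.commute)
  have "H1 holomorphic_on ball 0 1"
    using sums1 by (intro power_series_holomorphic[of 0 1 "\<lambda>n. b (Suc n)"]) auto
  then have hol1: "H1 holomorphic_on cball 0 \<rho>" by (rule holomorphic_on_subset) (use \<rho> in auto)
  then have holK: "(\<lambda>z. z * H1 z) holomorphic_on cball 0 \<rho>" by (intro holomorphic_intros)
  have "integral {0..2*pi} (\<lambda>t. (norm (H (complex_of_real \<rho> * cis t)))\<^sup>2) =
    integral {0..2*pi} (\<lambda>t. (norm (b 0 + (complex_of_real \<rho> * cis t) * H1 (complex_of_real \<rho> * cis t)))\<^sup>2)"
    using \<rho> by (subst H) (auto simp: norm_mult)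
  also have "\<dots> = 2 * pi * (norm (b 0))\<^sup>2 +
     integral {0..2*pi} (\<lambda>t. (norm ((complex_of_real \<rho> * cis t) * H1 (complex_of_real \<rho> * cis t)))\<^sup>2)"
    using circle_square_split[OF holK _ \<rho>(1), of "b 0"] by simp
  also have "\<dots> = 2 * pi * (norm (b 0))\<^sup>2 + \<rho>\<^sup>2 * integral {0..2*pi} (\<lambda>t. (norm (H1 (complex_of_real \<rho> * cis t)))\<^sup>2)"
    by (simp add: norm_mult power_mult_distrib)
  also have "\<dots> \<ge> 2 * pi * (norm (b 0))\<^sup>2 + \<rho>\<^sup>2 * (2 * pi * (\<Sum>n<N. (norm (b (Suc n)))\<^sup>2 * \<rho> ^ (2 * n)))"
    using Suc.IH[OF sums1] by (intro add_left_mono mult_left_mono) auto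
  also have "2 * pi * (norm (b 0))\<^sup>2 + \<rho>\<^sup>2 * (2 * pi * (\<Sum>n<N. (norm (b (Suc n)))\<^sup>2 * \<rho> ^ (2 * n))) =
    2 * pi * (\<Sum>n<Suc N. (norm (b n))\<^sup>2 * \<rho> ^ (2 * n))"
    by (subst sum.lessThan_Suc_shift) (simp add: sum_distrib_left algebra_simps power2_eq_square)
  finally show ?case by simp
qed

text \<open>Littlewood's induction: the polynomial in \<phi> is a 0 + \<phi> P with P of lower
  degree. As \<phi> vanishes at 0 the two terms are orthogonal, and then |\<phi>| \<le> 1 allows
  \<phi> to be discarded.\<close>

lemma Littlewood_polynomial:
  assumes \<phi>: "\<phi> holomorphic_on ball 0 1" "\<phi> 0 = 0" "\<And>z. norm z < 1 \<Longrightarrow> norm (\<phi> z) < 1"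
    and \<rho>: "0 < \<rho>" "\<rho> < 1"
  shows "integral {0..2*pi} (\<lambda>t. (norm (\<Sum>n<N. a n * \<phi> (complex_of_real \<rho> * cis t) ^ n))\<^sup>2)
    \<le> 2 * pi * (\<Sum>n<N. (norm (a n))\<^sup>2)"
proof (induction N arbitrary: a)
  case (Suc N)
  define P where "P z = (\<Sum>n<N. a (Suc n) * \<phi> z ^ n)" for z
  have holP: "P holomorphic_on ball 0 1" unfolding P_def[abs_def] by (intro holomorphic_intros \<phi>)
  have holK: "(\<lambda>z. \<phi> z * P z) holomorphic_on cball 0 \<rho>"
    by (rule holomorphic_on_subset[of _ "ball 0 1"], intro holomorphic_intros holP \<phi>) (use \<rho> in auto)
  have contP: "continuous_on {0..2*pi} (\<lambda>t. P (complex_of_real \<rho> * cis t))"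
    and cont\<phi>: "continuous_on {0..2*pi} (\<lambda>t. \<phi> (complex_of_real \<rho> * cis t))"
    using continuous_on_unit_circle[OF holP] continuous_on_unit_circle[OF \<phi>(1)] \<rho> by auto
  have "integral {0..2*pi} (\<lambda>t. (norm (\<Sum>n<Suc N. a n * \<phi> (complex_of_real \<rho> * cis t) ^ n))\<^sup>2) =
    integral {0..2*pi} (\<lambda>t. (norm (a 0 + \<phi> (complex_of_real \<rho> * cis t) * P (complex_of_real \<rho> * cis t)))\<^sup>2)"
    by (subst sum.lessThan_Suc_shift) (simp add: P_def sum_distrib_left mult_ac)
  also have "\<dots> = 2 * pi * (norm (a 0))\<^sup>2 +
    integral {0..2*pi} (\<lambda>t. (norm (\<phi> (complex_of_real \<rho> * cis t) * P (complex_of_real \<rho> * cis t)))\<^sup>2)"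
    using circle_square_split[OF holK _ \<rho>(1), of "a 0"] \<phi>(2) by simp
  also have "\<dots> \<le> 2 * pi * (norm (a 0))\<^sup>2 + integral {0..2*pi} (\<lambda>t. (norm (P (complex_of_real \<rho> * cis t)))\<^sup>2)"
  proof (intro add_left_mono integral_le integrable_continuous_real continuous_intros contP cont\<phi>)
    fix t
    have "norm (\<phi> (complex_of_real \<rho> * cis t)) \<le> 1" using \<phi>(3)[of "complex_of_real \<rho> * cis t"] \<rho> by (simp add: norm_mult)
    then have "norm (\<phi> (complex_of_real \<rho> * cis t) * P (complex_of_real \<rho> * cis t)) \<le> norm (P (complex_of_real \<rho> * cis t))"
      unfolding norm_mult by (intro mult_left_le_one_le) auto
    then show "(norm (\<phi> (complex_of_real \<rho> * cis t) * P (complex_of_real \<rho> * cis t)))\<^sup>2 \<le> (norm (P (complex_of_real \<rho> * cis t)))\<^sup>2"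
      by (intro power_mono) auto
  qed
  also have "\<dots> \<le> 2 * pi * (norm (a 0))\<^sup>2 + 2 * pi * (\<Sum>n<N. (norm (a (Suc n)))\<^sup>2)"
    unfolding P_def by (intro add_left_mono Suc.IH)
  also have "\<dots> = 2 * pi * (\<Sum>n<Suc N. (norm (a n))\<^sup>2)"
    by (subst sum.lessThan_Suc_shift) (simp add: algebra_simps)
  finally show ?case .
qed simp

text \<open>Fatou's lemma along the partial sums of the series of G at \<phi>; the bound for
  polynomials is uniform in their degree and in \<rho>.\<close>

lemma Littlewood_subordination:
  assumes \<phi>: "\<phi> holomorphic_on ball 0 1" "\<phi> 0 = 0" "\<And>z. norm z < 1 \<Longrightarrow> norm (\<phi> z) < 1"
    and sums: "\<And>z. norm z < 1 \<Longrightarrow> (\<lambda>n. a n * z ^ n) sums G z"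
    and B: "\<And>N. (\<Sum>n<N. (norm (a n))\<^sup>2) \<le> B" and \<rho>: "0 < \<rho>" "\<rho> < 1"
  shows "(\<integral>\<^sup>+ t\<in>{0..2*pi}. ennreal ((norm (G (\<phi> (complex_of_real \<rho> * cis t))))\<^sup>2) \<partial>lborel) \<le> ennreal (2 * pi * B)"
proof -
  define S where "S N t = (norm (\<Sum>n<N. a n * \<phi> (complex_of_real \<rho> * cis t) ^ n))\<^sup>2" for N t
  have contS: "continuous_on A (S N)" for A N
    using continuous_on_unit_circle[OF \<phi>(1), of \<rho> A] \<rho> unfolding S_def by (intro continuous_intros) auto
  have [measurable]: "S N \<in> borel_measurable borel" for N
    by (rule borel_measurable_continuous_onI[OF contS])
  have lim: "(\<lambda>N. ennreal (S N t) * indicator {0..2*pi} t) \<longlonglongrightarrow> ennreal ((norm (G (\<phi> (complex_of_real \<rho> * cis t))))\<^sup>2) * indicator {0..2*pi} t" for t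
  proof -
    have "norm (\<phi> (complex_of_real \<rho> * cis t)) < 1" using \<phi>(3)[of "complex_of_real \<rho> * cis t"] \<rho> by (simp add: norm_mult)
    from sums[OF this] have "(\<lambda>N. ennreal (S N t)) \<longlonglongrightarrow> ennreal ((norm (G (\<phi> (complex_of_real \<rho> * cis t))))\<^sup>2)"
      unfolding S_def sums_def by (intro tendsto_intros)
    then show ?thesis by (auto split: split_indicator)
  qed
  have "(\<integral>\<^sup>+ t\<in>{0..2*pi}. ennreal ((norm (G (\<phi> (complex_of_real \<rho> * cis t))))\<^sup>2) \<partial>lborel) =
    (\<integral>\<^sup>+ t. liminf (\<lambda>N. ennreal (S N t) * indicator {0..2*pi} t) \<partial>lborel)"
    by (simp add: lim_imp_Liminf[OF trivial_limit_sequentially lim])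
  also have "\<dots> \<le> liminf (\<lambda>N. \<integral>\<^sup>+ t. ennreal (S N t) * indicator {0..2*pi} t \<partial>lborel)"
    by (rule nn_integral_liminf) measurable
  also have "\<dots> \<le> ennreal (2 * pi * B)"
  proof (rule Liminf_le, simp, rule always_eventually, rule allI)
    fix N
    have "(\<integral>\<^sup>+ t. ennreal (S N t) * indicator {0..2*pi} t \<partial>lborel) = ennreal (integral {0..2*pi} (S N))"
      by (rule nn_integral_interval_continuous[OF contS]) (simp add: S_def)
    also have "\<dots> \<le> ennreal (2 * pi * (\<Sum>n<N. (norm (a n))\<^sup>2))"
      unfolding S_def[abs_def] by (intro ennreal_leI Littlewood_polynomial \<phi> \<rho>) auto
    also have "\<dots> \<le> ennreal (2 * pi * B)"
      using B by (intro ennreal_leI mult_left_mono) auto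
    finally show "(\<integral>\<^sup>+ t. ennreal (S N t) * indicator {0..2*pi} t \<partial>lborel) \<le> ennreal (2 * pi * B)" .
  qed
  finally show ?thesis .
qed

section \<open>Areas and Taylor coefficients\<close>

lemma nn_integral_ball_norm_powr:
  fixes a :: complex
  assumes p: "0 < p" and M: "0 \<le> M"
  shows "(\<integral>\<^sup>+ w\<in>ball a M. ennreal (norm (w - a) powr (p - 2)) \<partial>lborel) = ennreal (2 * pi * (M powr p / p))"
proof -
  have meas: "(\<lambda>w. ennreal (norm (w - a) powr (p - 2))) \<in> borel_measurable borel" for a :: complex
  proof -
    have [measurable]: "(\<lambda>w::complex. norm (w - a)) \<in> borel_measurable borel"
      by (intro borel_measurable_continuous_onI continuous_intros)
    show ?thesis by measurable
  qed
  have "(\<integral>\<^sup>+ w\<in>ball a M. ennreal (norm (w - a) powr (p - 2)) \<partial>lborel) =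
    (\<integral>\<^sup>+ r\<in>{0..M}. ennreal r * (\<integral>\<^sup>+ t\<in>{0..2*pi}. ennreal (norm (a + complex_of_real r * cis t - a) powr (p - 2)) \<partial>lborel) \<partial>lborel)"
    by (rule nn_integral_polar[OF meas])
  also have "\<dots> = (\<integral>\<^sup>+ r. ennreal (2 * pi) * (ennreal (r powr (p - 1)) * indicator {0..M} r) \<partial>lborel)"
  proof (rule nn_integral_cong_AE)
    show "AE r in lborel. ennreal r * (\<integral>\<^sup>+ t\<in>{0..2*pi}. ennreal (norm (a + complex_of_real r * cis t - a) powr (p - 2)) \<partial>lborel) * indicator {0..M} r =
      ennreal (2 * pi) * (ennreal (r powr (p - 1)) * indicator {0..M} r)"
      using AE_lborel_singleton[of 0]
    proof eventually_elim
      fix r :: real assume r: "r \<noteq> 0"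
      show "ennreal r * (\<integral>\<^sup>+ t\<in>{0..2*pi}. ennreal (norm (a + complex_of_real r * cis t - a) powr (p - 2)) \<partial>lborel) * indicator {0..M} r =
        ennreal (2 * pi) * (ennreal (r powr (p - 1)) * indicator {0..M} r)"
      proof (cases "r \<in> {0..M}")
        case True
        with r have r0: "0 < r" by auto
        have "r powr (p - 1) = r * r powr (p - 2)"
          using r0 powr_add[of r 1 "p - 2"] by simp
        then show ?thesis using True r0 by (simp add: norm_mult nn_integral_cmult_indicator ennreal_mult mult_ac)
      qed simp
    qed
  qed
  also have "\<dots> = ennreal (2 * pi) * ennreal (M powr p / p)"
    using nn_integral_powr_from_0[of "p - 1" M] p M by (subst nn_integral_cmult) auto
  also have "\<dots> = ennreal (2 * pi * (M powr p / p))" using p by (intro ennreal_mult[symmetric]) auto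
  finally show ?thesis .
qed

text \<open>One half of the classical formula that the area of the image of the disc of radius r,
  counted with multiplicity, is pi times the sum of n |a n|^2 r^(2n). Bessel's inequality on each
  circle suffices for it.\<close>

lemma area_coefficient_bound:
  assumes hol: "G holomorphic_on ball 0 1" and r: "0 < r" "r < 1"
    and bound: "(\<integral>\<^sup>+ z\<in>ball 0 r. ennreal ((norm (deriv G z))\<^sup>2) \<partial>lborel) \<le> ennreal K" and K: "0 \<le> K"
  shows "pi * (\<Sum>n<N. real (Suc n) * (norm ((deriv ^^ Suc n) G 0 / fact (Suc n)))\<^sup>2 * r ^ (2 * Suc n)) \<le> K"
proof -
  define b where "b n = (deriv ^^ n) (deriv G) 0 / fact n" for n
  have hol': "deriv G holomorphic_on ball 0 1" by (intro holomorphic_deriv hol) auto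
  have sums: "(\<lambda>n. b n * z ^ n) sums deriv G z" if "norm z < 1" for z
    using holomorphic_power_series[OF hol', of z] that by (simp add: b_def)
  have b: "(norm (b n))\<^sup>2 = (real (Suc n) * norm ((deriv ^^ Suc n) G 0 / fact (Suc n)))\<^sup>2" for n
  proof -
    have "(deriv ^^ n) (deriv G) = (deriv ^^ Suc n) G" by (simp add: funpow_swap1)
    then have "b n = of_nat (Suc n) * ((deriv ^^ Suc n) G 0 / fact (Suc n))"
      by (simp add: b_def field_simps del: of_nat_Suc funpow.simps)
    then show ?thesis by (simp only: norm_mult norm_of_nat)
  qed
  define F where "F z = indicator (ball 0 1) z *\<^sub>R (norm (deriv G z))\<^sup>2" for z
  have [measurable]: "F \<in> borel_measurable borel" unfolding F_def
    by (intro borel_measurable_continuous_on_indicator continuous_intros holomorphic_on_imp_continuous_on hol') auto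
  \<comment> \<open>The Bessel lower bound on the circle of radius \<rho>, times the \<rho> of polar
    coordinates. Integration divides by 2n + 2 and cancels one of the two factors n + 1 in |b
    n|^2.\<close>
  define Q where "Q \<rho> = (\<Sum>n<N. 2 * pi * (norm (b n))\<^sup>2 * \<rho> ^ (2 * n + 1))" for \<rho> :: real
  have Q0: "0 \<le> Q \<rho>" if "0 \<le> \<rho>" for \<rho> using that by (auto simp: Q_def intro!: sum_nonneg)
  have inner: "ennreal (Q \<rho>) \<le> ennreal \<rho> * (\<integral>\<^sup>+ t\<in>{0..2*pi}. ennreal (F (0 + complex_of_real \<rho> * cis t)) \<partial>lborel)"
    if \<rho>: "0 < \<rho>" "\<rho> < 1" for \<rho>
  proof -
    have "Q \<rho> = \<rho> * (2 * pi * (\<Sum>n<N. (norm (b n))\<^sup>2 * \<rho> ^ (2 * n)))"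
      by (simp add: Q_def sum_distrib_left mult_ac)
    also have "\<dots> \<le> \<rho> * integral {0..2*pi} (\<lambda>t. (norm (deriv G (complex_of_real \<rho> * cis t)))\<^sup>2)"
      using \<rho> by (intro mult_left_mono Bessel_circle sums) auto
    finally have "ennreal (Q \<rho>) \<le> ennreal (\<rho> * integral {0..2*pi} (\<lambda>t. (norm (deriv G (complex_of_real \<rho> * cis t)))\<^sup>2))"
      by (rule ennreal_leI)
    also have "\<dots> = ennreal \<rho> * ennreal (integral {0..2*pi} (\<lambda>t. (norm (deriv G (complex_of_real \<rho> * cis t)))\<^sup>2))"
      using \<rho> by (intro ennreal_mult integral_nonneg integrable_continuous_real continuous_intros continuous_on_unit_circle[OF hol']) auto
    also have "ennreal (integral {0..2*pi} (\<lambda>t. (norm (deriv G (complex_of_real \<rho> * cis t)))\<^sup>2)) =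
       (\<integral>\<^sup>+ t\<in>{0..2*pi}. ennreal ((norm (deriv G (complex_of_real \<rho> * cis t)))\<^sup>2) \<partial>lborel)"
      using \<rho> by (intro nn_integral_interval_continuous[symmetric] continuous_intros continuous_on_unit_circle[OF hol']) auto
    also have "\<dots> = (\<integral>\<^sup>+ t\<in>{0..2*pi}. ennreal (F (0 + complex_of_real \<rho> * cis t)) \<partial>lborel)"
      using \<rho> by (intro nn_integral_cong) (simp add: F_def norm_mult)
    finally show ?thesis .
  qed
  define P where "P = (\<Sum>n<N. 2 * pi * (norm (b n))\<^sup>2 * (r ^ (2 * n + 2) / real (2 * n + 2)))"
  have "((\<lambda>\<rho>. \<Sum>n<N. 2 * pi * (norm (b n))\<^sup>2 * \<rho> ^ (2 * n + 1)) has_integral P) {0..r}"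
    unfolding P_def
  proof (intro has_integral_sum has_integral_mult_right)
    fix n
    have "((\<lambda>\<rho>. \<rho> ^ (2 * n + 1)) has_integral (r ^ (2 * n + 2) / real (2 * n + 2) - 0 ^ (2 * n + 2) / real (2 * n + 2))) {0..r}"
    proof (rule fundamental_theorem_of_calculus)
      fix x
      have "((\<lambda>\<rho>. \<rho> ^ (2 * n + 2) / real (2 * n + 2)) has_real_derivative
          (real (2 * n + 2) * x ^ (2 * n + 2 - Suc 0)) / real (2 * n + 2)) (at x within {0..r})"
        by (intro DERIV_cdivide DERIV_pow)
      moreover have "(real (2 * n + 2) * x ^ (2 * n + 2 - Suc 0)) / real (2 * n + 2) = x ^ (2 * n + 1)" by simp
      ultimately show "((\<lambda>\<rho>. \<rho> ^ (2 * n + 2) / real (2 * n + 2)) has_vector_derivative x ^ (2 * n + 1)) (at x within {0..r})"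
        by (simp only: has_real_derivative_iff_has_vector_derivative)
    qed (use r in auto)
    then show "((\<lambda>\<rho>. \<rho> ^ (2 * n + 1)) has_integral r ^ (2 * n + 2) / real (2 * n + 2)) {0..r}" by simp
  qed auto
  then have intQ: "(Q has_integral P) {0..r}" unfolding Q_def[abs_def] .
  have "ennreal P = (\<integral>\<^sup>+ \<rho>\<in>{0..r}. ennreal (Q \<rho>) \<partial>lborel)"
    using Q0 by (intro nn_integral_interval_has_integral[symmetric] intQ borel_measurable_continuous_on_indicator)
      (auto simp: Q_def intro!: continuous_intros)
  also have "\<dots> \<le> (\<integral>\<^sup>+ \<rho>\<in>{0..r}. ennreal \<rho> * (\<integral>\<^sup>+ t\<in>{0..2*pi}. ennreal (F (0 + complex_of_real \<rho> * cis t)) \<partial>lborel) \<partial>lborel)"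
  proof (rule nn_integral_mono_AE)
    show "AE \<rho> in lborel. ennreal (Q \<rho>) * indicator {0..r} \<rho> \<le>
      ennreal \<rho> * (\<integral>\<^sup>+ t\<in>{0..2*pi}. ennreal (F (0 + complex_of_real \<rho> * cis t)) \<partial>lborel) * indicator {0..r} \<rho>"
      using AE_lborel_singleton[of 0]
      by eventually_elim (use inner r in \<open>auto split: split_indicator\<close>)
  qed
  also have "\<dots> = (\<integral>\<^sup>+ z\<in>ball 0 r. ennreal (F z) \<partial>lborel)"
    by (rule nn_integral_polar[symmetric]) simp
  also have "\<dots> = (\<integral>\<^sup>+ z\<in>ball 0 r. ennreal ((norm (deriv G z))\<^sup>2) \<partial>lborel)"
    using r by (intro nn_integral_cong) (auto simp: F_def split: split_indicator)
  also note bound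
  finally have "P \<le> K" using K by (subst (asm) ennreal_le_iff) auto
  moreover have "P = pi * (\<Sum>n<N. real (Suc n) * (norm ((deriv ^^ Suc n) G 0 / fact (Suc n)))\<^sup>2 * r ^ (2 * Suc n))"
    unfolding P_def b sum_distrib_left
  proof (rule sum.cong)
    fix n
    define A where "A = norm ((deriv ^^ Suc n) G 0 / fact (Suc n))"
    have "real (2 * n + 2) = 2 * real (Suc n)" by simp
    then show "2 * pi * (real (Suc n) * norm ((deriv ^^ Suc n) G 0 / fact (Suc n)))\<^sup>2 * (r ^ (2 * n + 2) / real (2 * n + 2))
      = pi * (real (Suc n) * (norm ((deriv ^^ Suc n) G 0 / fact (Suc n)))\<^sup>2 * r ^ (2 * Suc n))"
      unfolding A_def[symmetric] by (simp add: power2_eq_square field_simps del: of_nat_Suc)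
  qed simp
  ultimately show ?thesis by simp
qed

text \<open>For m(r) the sum of d n r^(2n+2), the assumption bounds r m'(r) / 2. As \<sigma> < 1,
  the bound is integrable up to r = 1, so m(1) is controlled by m(1/2).\<close>

lemma sum_bound_of_derivative_bound:
  fixes d :: "nat \<Rightarrow> real"
  assumes d: "\<And>n. 0 \<le> d n" and \<sigma>: "0 \<le> \<sigma>" "\<sigma> < 1" and K: "0 \<le> K"
    and bound: "\<And>r. \<lbrakk>0 < r; r < 1\<rbrakk> \<Longrightarrow> (\<Sum>n<N. real (Suc n) * d n * r ^ (2 * Suc n)) \<le> K * (1 - r) powr (-\<sigma>)"
  shows "(\<Sum>n<N. d n) \<le> K * 2 powr \<sigma> + 4 * K / (1 - \<sigma>)"
proof -
  define m where "m r = (\<Sum>n<N. d n * r ^ (2 * Suc n))" for r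
  \<comment> \<open>Integration of m' \<le> 4 K (1 - r)^(-\<sigma>) in the form of monotonicity:
    \<psi> is nonincreasing on [1/2, 1). The 4 is the bound for 2/x when x \<ge> 1/2.\<close>
  define \<psi> where "\<psi> r = m r + 4 * K / (1 - \<sigma>) * (1 - r) powr (1 - \<sigma>)" for r
  have le: "m r \<le> K * 2 powr \<sigma> + 4 * K / (1 - \<sigma>)" if r: "1/2 < r" "r < 1" for r
  proof -
    have "\<psi> r \<le> \<psi> (1/2)"
    proof (rule DERIV_nonpos_imp_nonincreasing[where f = \<psi> and a = "1/2" and b = r])
      fix x assume x: "1/2 \<le> x" "x \<le> r"
      have "(m has_real_derivative (\<Sum>n<N. d n * (real (2 * Suc n) * x ^ (2 * Suc n - 1)))) (at x)"
        unfolding m_def[abs_def] by (intro DERIV_sum DERIV_cmult DERIV_pow[THEN DERIV_cong]) auto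
      moreover have "((\<lambda>r. 4 * K / (1 - \<sigma>) * (1 - r) powr (1 - \<sigma>)) has_real_derivative (- (4 * K) * (1 - x) powr (-\<sigma>))) (at x)"
      proof -
        have d1: "((\<lambda>r. 1 - r) has_real_derivative (-1)) (at x)"
          by (auto intro!: derivative_eq_intros)
        have d2: "((\<lambda>y. y powr (1 - \<sigma>)) has_real_derivative (1 - \<sigma>) * (1 - x) powr (1 - \<sigma> - 1)) (at (1 - x))"
          using x r by (intro has_real_derivative_powr) auto
        show ?thesis
          using DERIV_cmult[OF DERIV_chain2[OF d2 d1], of "4 * K / (1 - \<sigma>)"] \<sigma> by (simp add: mult.assoc)
      qed
      ultimately have "(\<psi> has_real_derivative (\<Sum>n<N. d n * (real (2 * Suc n) * x ^ (2 * Suc n - 1))) + (- (4 * K) * (1 - x) powr (-\<sigma>))) (at x)"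
        unfolding \<psi>_def[abs_def] by (rule DERIV_add)
      moreover have "(\<Sum>n<N. d n * (real (2 * Suc n) * x ^ (2 * Suc n - 1))) = 2 / x * (\<Sum>n<N. real (Suc n) * d n * x ^ (2 * Suc n))"
        unfolding sum_distrib_left using x by (intro sum.cong) (auto simp: field_simps)
      moreover have "2 / x * (\<Sum>n<N. real (Suc n) * d n * x ^ (2 * Suc n)) \<le> 4 * (K * (1 - x) powr (-\<sigma>))"
      proof (rule mult_mono)
        show "2 / x \<le> 4" using x by (simp add: field_simps)
        show "(\<Sum>n<N. real (Suc n) * d n * x ^ (2 * Suc n)) \<le> K * (1 - x) powr (-\<sigma>)" using bound x r by auto
        show "0 \<le> (\<Sum>n<N. real (Suc n) * d n * x ^ (2 * Suc n))" using d x by (intro sum_nonneg mult_nonneg_nonneg) auto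
      qed simp
      ultimately show "\<exists>y. DERIV \<psi> x :> y \<and> y \<le> 0"
        by (intro exI[of _ "2 / x * (\<Sum>n<N. real (Suc n) * d n * x ^ (2 * Suc n)) + (- (4 * K) * (1 - x) powr (-\<sigma>))"]) simp
    qed (use r in auto)
    moreover have "m r \<le> \<psi> r" using K \<sigma> by (simp add: \<psi>_def)
    moreover have "m (1/2) \<le> K * 2 powr \<sigma>"
    proof -
      have "m (1/2) \<le> (\<Sum>n<N. real (Suc n) * d n * (1/2) ^ (2 * Suc n))"
        unfolding m_def
      proof (intro sum_mono mult_right_mono)
        fix n show "d n \<le> real (Suc n) * d n" using mult_right_mono[of 1 "real (Suc n)" "d n"] d[of n] by simp
      qed auto
      also have "\<dots> \<le> K * (1 - 1/2) powr (-\<sigma>)" by (rule bound) auto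
      also have "(1 - 1/2) powr (-\<sigma>) = (2::real) powr \<sigma>" by (simp add: powr_divide powr_minus)
      finally show ?thesis .
    qed
    moreover have "4 * K / (1 - \<sigma>) * (1 - 1/2) powr (1 - \<sigma>) \<le> 4 * K / (1 - \<sigma>) * 1"
      using K \<sigma> by (intro mult_left_mono powr_le1) auto
    ultimately show ?thesis unfolding \<psi>_def by linarith
  qed
  have "(m \<longlongrightarrow> m 1) (at_left 1)"
    unfolding m_def by (intro tendsto_intros)
  moreover have "eventually (\<lambda>r. m r \<le> K * 2 powr \<sigma> + 4 * K / (1 - \<sigma>)) (at_left 1)"
    unfolding eventually_at_left_field by (rule exI[of _ "1/2"]) (use le in auto)
  ultimately have "m 1 \<le> K * 2 powr \<sigma> + 4 * K / (1 - \<sigma>)"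
    using tendsto_upperbound trivial_limit_at_left_real by blast
  then show ?thesis by (simp add: m_def)
qed

text \<open>Prawitz' theorem: the area \<open>\<integral>\<bar>G'\<bar>\<^sup>2\<close> for \<open>G = (g - a)\<^bsup>p/2\<^esup>\<close> becomes \<open>\<integral>\<bar>w - a\<bar>\<^bsup>p-2\<^esup>\<close> over the
  image of \<open>g\<close>.\<close>

lemma univalent_growth_coefficients:
  assumes hol: "g holomorphic_on ball 0 1" and inj: "inj_on g (ball 0 1)"
    and om: "\<And>z. norm z < 1 \<Longrightarrow> g z \<noteq> a" and gr: "growth \<tau> g"
    and p: "0 < p" and \<tau>: "0 \<le> \<tau>" "p * \<tau> < 1"
  obtains A G B where "\<And>z. norm z < 1 \<Longrightarrow> (\<lambda>n. A n * z ^ n) sums G z"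
    "\<And>z. norm z < 1 \<Longrightarrow> (norm (G z))\<^sup>2 = norm (g z - a) powr p"
    "\<And>N. (\<Sum>n<N. (norm (A n))\<^sup>2) \<le> (B::real)"
proof -
  have holF: "(\<lambda>z. g z - a) holomorphic_on ball 0 1" by (intro holomorphic_intros hol)
  obtain G where G: "G holomorphic_on ball 0 1" "\<And>z. norm z < 1 \<Longrightarrow> norm (G z) = norm (g z - a) powr (p/2)"
    "\<And>z. norm z < 1 \<Longrightarrow> norm (deriv G z) = p/2 * norm (g z - a) powr (p/2 - 1) * norm (deriv (\<lambda>z. g z - a) z)"
    by (rule holomorphic_power[OF holF, of "p/2"]) (use om p in auto)
  define A where "A n = (deriv ^^ n) G 0 / fact n" for n
  have sums: "(\<lambda>n. A n * z ^ n) sums G z" if "norm z < 1" for z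
    using holomorphic_power_series[OF G(1), of z] that by (simp add: A_def)
  have sq: "(x powr (b/2))\<^sup>2 = x powr b" for x b :: real
    unfolding power2_eq_square powr_add[symmetric] by simp
  \<comment> \<open>The factor |g'|^2 is the Jacobian of \<open>g\<close>, so the area integral of G
    moves to the image of \<open>g\<close>.\<close>
  have dG: "(norm (deriv G z))\<^sup>2 = (norm (deriv g z))\<^sup>2 * (p\<^sup>2 / 4 * norm (g z - a) powr (p - 2))" if z: "norm z < 1" for z
  proof -
    have "deriv (\<lambda>z. g z - a) z = deriv g z"
      using z by (subst deriv_diff) (auto intro: holomorphic_on_imp_differentiable_at[OF hol])
    then show ?thesis unfolding G(3)[OF z] power_mult_distrib
      using sq[of "norm (g z - a)" "p - 2"] by (simp add: diff_divide_distrib power_divide)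
  qed
  obtain C where C: "C > 0" "\<And>z. norm z < 1 \<Longrightarrow> norm (g z) \<le> C * (1 - norm z) powr (-\<tau>)"
    using growthE[OF gr] by blast
  \<comment> \<open>Bounds |g - a| in place of |g|; the added 1 makes the inclusion in an open ball
    strict.\<close>
  define C2 where "C2 = C + norm a + 1"
  have C2: "C2 > 0" using C(1) by (simp add: C2_def add_pos_nonneg)
  define K where "K = p\<^sup>2 / 4 * (2 * pi * (C2 powr p / p))"
  have K: "0 \<le> K" using p by (simp add: K_def)
  have area: "(\<integral>\<^sup>+ z\<in>ball 0 r. ennreal ((norm (deriv G z))\<^sup>2) \<partial>lborel) \<le> ennreal (K * (1 - r) powr (-(p * \<tau>)))"
    if r: "0 < r" "r < 1" for r
  proof -
    define M where "M = C2 * (1 - r) powr (-\<tau>)"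
    have M: "0 \<le> M" using C2 by (simp add: M_def)
    have sub: "(ball 0 r :: complex set) \<subseteq> ball 0 1" using r by auto
    have [measurable]: "(\<lambda>w. ennreal (p\<^sup>2 / 4) * ennreal (norm (w - a) powr (p - 2))) \<in> borel_measurable borel"
    proof -
      have [measurable]: "(\<lambda>w::complex. norm (w - a)) \<in> borel_measurable borel"
        by (intro borel_measurable_continuous_onI continuous_intros)
      show ?thesis by measurable
    qed
    have "g ` ball 0 r \<subseteq> ball a M"
    proof clarify
      fix z :: complex assume z: "z \<in> ball 0 r"
      have one: "1 \<le> (1 - r) powr (-\<tau>)" using one_minus_powr_mono[of r 0 \<tau>] r \<tau> by auto
      have "norm (g z - a) \<le> norm (g z) + norm a" by (rule norm_triangle_ineq4)
      also have "norm (g z) \<le> C * (1 - norm z) powr (-\<tau>)" using C(2) z r by auto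
      also have "\<dots> \<le> C * (1 - r) powr (-\<tau>)"
        using C(1) z r \<tau> by (intro mult_left_mono powr_mono2') auto
      also have "norm a \<le> norm a * (1 - r) powr (-\<tau>)" using mult_left_mono[OF one, of "norm a"] by simp
      also have "C * (1 - r) powr (-\<tau>) + norm a * (1 - r) powr (-\<tau>) < M"
        using r by (simp add: M_def C2_def algebra_simps)
      finally show "g z \<in> ball a M" by (simp add: dist_norm norm_minus_commute)
    qed
    have "(\<integral>\<^sup>+ z\<in>ball 0 r. ennreal ((norm (deriv G z))\<^sup>2) \<partial>lborel) =
      (\<integral>\<^sup>+ z\<in>ball 0 r. ennreal ((norm (deriv g z))\<^sup>2) * (ennreal (p\<^sup>2 / 4) * ennreal (norm (g z - a) powr (p - 2))) \<partial>lborel)"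
      using r by (intro nn_integral_cong) (auto simp: dG ennreal_mult[symmetric] split: split_indicator)
    also have "\<dots> = (\<integral>\<^sup>+ w\<in>g ` ball 0 r. (ennreal (p\<^sup>2 / 4) * ennreal (norm (w - a) powr (p - 2))) \<partial>lborel)"
      by (rule nn_integral_holomorphic_image[symmetric])
         (use holomorphic_on_subset[OF hol sub] inj_on_subset[OF inj sub] in auto)
    also have "\<dots> \<le> (\<integral>\<^sup>+ w\<in>ball a M. (ennreal (p\<^sup>2 / 4) * ennreal (norm (w - a) powr (p - 2))) \<partial>lborel)"
      using \<open>g ` ball 0 r \<subseteq> ball a M\<close> by (intro nn_integral_mono) (auto split: split_indicator)
    also have "\<dots> = ennreal (p\<^sup>2 / 4) * (\<integral>\<^sup>+ w\<in>ball a M. ennreal (norm (w - a) powr (p - 2)) \<partial>lborel)"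
    proof -
      have [measurable]: "(\<lambda>w::complex. norm (w - a)) \<in> borel_measurable borel"
        by (intro borel_measurable_continuous_onI continuous_intros)
      have [measurable]: "ball a M \<in> sets borel" by simp
      have "(\<lambda>w. ennreal (norm (w - a) powr (p - 2)) * indicator (ball a M) w) \<in> borel_measurable lborel" by measurable
      from nn_integral_cmult[OF this] show ?thesis by (simp add: mult.assoc)
    qed
    also have "\<dots> = ennreal (p\<^sup>2 / 4) * ennreal (2 * pi * (M powr p / p))"
      unfolding nn_integral_ball_norm_powr[OF p M] ..
    also have "\<dots> = ennreal (p\<^sup>2 / 4 * (2 * pi * (M powr p / p)))"
      using p by (intro ennreal_mult[symmetric]) auto
    also have "M powr p = C2 powr p * (1 - r) powr (-(p * \<tau>))"
      using C2 r by (simp add: M_def powr_mult powr_powr mult.commute)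
    also have "p\<^sup>2 / 4 * (2 * pi * (C2 powr p * (1 - r) powr (-(p * \<tau>)) / p)) = K * (1 - r) powr (-(p * \<tau>))"
      by (simp add: K_def)
    finally show ?thesis .
  qed
  \<comment> \<open>The image of the disc of radius r lies in a ball of radius O((1 - r)^(-\<tau>)),
    hence the area bound of order (1 - r)^(-p \<tau>). The condition p \<tau> < 1 turns it into
    square summability.\<close>
  have "(\<Sum>n<N. (norm (A (Suc n)))\<^sup>2) \<le> K / pi * 2 powr (p * \<tau>) + 4 * (K / pi) / (1 - p * \<tau>)" for N
  proof (rule sum_bound_of_derivative_bound)
    fix r :: real assume r: "0 < r" "r < 1"
    have "pi * (\<Sum>n<N. real (Suc n) * (norm (A (Suc n)))\<^sup>2 * r ^ (2 * Suc n)) \<le> K * (1 - r) powr (-(p * \<tau>))"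
      unfolding A_def using area_coefficient_bound[OF G(1) r area[OF r]] K by auto
    then show "(\<Sum>n<N. real (Suc n) * (norm (A (Suc n)))\<^sup>2 * r ^ (2 * Suc n)) \<le> K / pi * (1 - r) powr (-(p * \<tau>))"
      by (simp add: field_simps)
  qed (use K p \<tau> in auto)
  note tail = this
  have "(\<Sum>n<N. (norm (A n))\<^sup>2) \<le> (norm (A 0))\<^sup>2 + (K / pi * 2 powr (p * \<tau>) + 4 * (K / pi) / (1 - p * \<tau>))" for N
  proof -
    have "(\<Sum>n<N. (norm (A n))\<^sup>2) \<le> (\<Sum>n<Suc N. (norm (A n))\<^sup>2)" by simp
    also have "\<dots> = (norm (A 0))\<^sup>2 + (\<Sum>n<N. (norm (A (Suc n)))\<^sup>2)" by (rule sum.lessThan_Suc_shift)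
    finally show ?thesis using tail[of N] by linarith
  qed
  moreover have "(norm (G z))\<^sup>2 = norm (g z - a) powr p" if "norm z < 1" for z
    unfolding G(2)[OF that] sq ..
  ultimately show ?thesis using that sums by blast
qed

text \<open>Any such f is g composed with the self-map \<phi> of the disc obtained from the inverse
  of g. The common value at 0 gives \<phi>(0) = 0, so subordination applies to G, whose squared
  modulus is |g - a|^p.\<close>

lemma hardy_if_univalent_growth:
  assumes hol: "g holomorphic_on ball 0 1" and inj: "inj_on g (ball 0 1)"
    and om: "\<And>z. norm z < 1 \<Longrightarrow> g z \<noteq> a" and gr: "growth \<tau> g"
    and p: "0 < p" and \<tau>: "0 \<le> \<tau>" "p * \<tau> < 1"
    and f: "f holomorphic_on ball 0 1" "f ` ball 0 1 \<subseteq> g ` ball 0 1" "f 0 = g 0"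
  shows "hardy p f"
proof -
  obtain A G B where AGB: "\<And>z. norm z < 1 \<Longrightarrow> (\<lambda>n. A n * z ^ n) sums G z"
    "\<And>z. norm z < 1 \<Longrightarrow> (norm (G z))\<^sup>2 = norm (g z - a) powr p"
    "\<And>N. (\<Sum>n<N. (norm (A n))\<^sup>2) \<le> (B::real)"
    using univalent_growth_coefficients[OF hol inj om gr p \<tau>] by blast
  obtain h where h: "h holomorphic_on (g ` ball 0 1)" "\<And>z. z \<in> ball 0 1 \<Longrightarrow> deriv g z * deriv h (g z) = 1"
    "\<And>z. z \<in> ball 0 1 \<Longrightarrow> h (g z) = z"
    using holomorphic_has_inverse[OF hol open_ball inj] by blast
  define \<phi> where "\<phi> = h \<circ> f"
  have hol\<phi>: "\<phi> holomorphic_on ball 0 1"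
    unfolding \<phi>_def by (rule holomorphic_on_compose_gen[OF f(1) h(1) f(2)])
  have \<phi>: "norm (\<phi> z) < 1" "g (\<phi> z) = f z" if z: "norm z < 1" for z
  proof -
    have "f z \<in> g ` ball 0 1" using f(2) z by (metis image_subset_iff mem_ball_0)
    then obtain w where "w \<in> ball 0 1" "f z = g w" by blast
    then show "norm (\<phi> z) < 1" "g (\<phi> z) = f z" using h(3) by (auto simp: \<phi>_def)
  qed
  have \<phi>0: "\<phi> 0 = 0" using h(3)[of 0] f(3) by (simp add: \<phi>_def)
  have B0: "0 \<le> B" using AGB(3)[of 0] by simp
  show ?thesis
  proof (rule hardyI[OF f(1)])
    fix r :: real assume r: "0 < r" "r < 1"
    have circ: "norm (complex_of_real r * cis t) < 1" for t using r by (simp add: norm_mult)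
    have "(\<integral>\<^sup>+ t\<in>{0..2*pi}. ennreal (norm (f (complex_of_real r * cis t) - a) powr p) \<partial>lborel) =
       (\<integral>\<^sup>+ t\<in>{0..2*pi}. ennreal ((norm (G (\<phi> (complex_of_real r * cis t))))\<^sup>2) \<partial>lborel)"
      using AGB(2)[OF \<phi>(1)[OF circ]] \<phi>(2)[OF circ] by (intro nn_integral_cong) simp
    also have "\<dots> \<le> ennreal (2 * pi * B)"
      by (rule Littlewood_subordination[OF hol\<phi> \<phi>0 \<phi>(1) AGB(1,3) r])
    finally have 1: "(\<integral>\<^sup>+ t\<in>{0..2*pi}. ennreal (norm (f (complex_of_real r * cis t) - a) powr p) \<partial>lborel) \<le> ennreal (2 * pi * B)" .
    \<comment> \<open>The shift by \<open>-a\<close> leads from the means of f - a back to those of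
      f.\<close>
    have "(\<integral>\<^sup>+ t\<in>{0..2*pi}. ennreal (norm (f (complex_of_real r * cis t) - a - (-a)) powr p) \<partial>lborel) \<le>
      ennreal (2 powr p) * ((\<integral>\<^sup>+ t\<in>{0..2*pi}. ennreal (norm (f (complex_of_real r * cis t) - a) powr p) \<partial>lborel)
        + ennreal (norm (-a) powr p) * emeasure lborel {0..2*pi})"
    proof (rule nn_integral_diff_powr_le)
      have "(\<lambda>z. f z - a) holomorphic_on ball 0 1" by (intro holomorphic_intros f(1))
      from measurable_circle_powr[OF this, of r p] r
      show "(\<lambda>t. ennreal (norm (f (complex_of_real r * cis t) - a) powr p) * indicator {0..2*pi} t) \<in> borel_measurable lborel"
        by auto
    qed (use p in auto)
    also have "\<dots> \<le> ennreal (2 powr p) * (ennreal (2 * pi * B) + ennreal (norm (-a) powr p) * emeasure lborel {0..2*pi})"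
      by (intro mult_left_mono add_right_mono 1) auto
    also have "\<dots> = ennreal (2 powr p * (2 * pi * B + norm (-a) powr p * (2 * pi)))"
      using B0 by (simp add: ennreal_mult ennreal_plus)
    finally show "(\<integral>\<^sup>+ t\<in>{0..2*pi}. ennreal (norm (f (complex_of_real r * cis t)) powr p) \<partial>lborel) \<le>
      ennreal (2 powr p * (2 * pi * B + norm (-a) powr p * (2 * pi)))" by simp
  qed
qed

section \<open>Filling the holes of a plane domain\<close>

lemma filled_holes_eq_inside: "filled_holes D = inside D"
  unfolding filled_holes_def inside_def components_def
proof (intro set_eqI iffI)
  fix x assume "x \<in> \<Union> {C. C \<in> connected_component_set (- D) ` (- D) \<and> bounded C}"
  then obtain y where y: "y \<notin> D" "connected_component (- D) y x" "bounded (connected_component_set (- D) y)"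
    by blast
  then have "connected_component_set (- D) x = connected_component_set (- D) y"
    by (metis connected_component_eq mem_Collect_eq)
  moreover have "x \<in> - D" using y(2) connected_component_in by blast
  ultimately show "x \<in> {x. x \<notin> D \<and> bounded (connected_component_set (- D) x)}" using y(3) by simp
next
  fix x assume "x \<in> {x. x \<notin> D \<and> bounded (connected_component_set (- D) x)}"
  then show "x \<in> \<Union> {C. C \<in> connected_component_set (- D) ` (- D) \<and> bounded C}"
    using connected_component_refl[of x "- D"] by blast
qed

text \<open>Holes may accumulate at a hole C, so C need not have a neighbourhood that meets no other
  hole. The Sura-Bura theorem provides a compact relatively clopen K between C and the complement of
  D. Components that meet K cannot leave it, so they are bounded, and K is cut out by an open set
  V.\<close>

lemma open_Un_inside:
  fixes D :: "'a::euclidean_space set"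
  assumes D: "open D"
  shows "open (D \<union> inside D)"
proof (subst open_subopen, intro ballI)
  fix x assume "x \<in> D \<union> inside D"
  then consider "x \<in> D" | "x \<in> inside D" by blast
  then show "\<exists>T. open T \<and> x \<in> T \<and> T \<subseteq> D \<union> inside D"
  proof cases
    case 1 then show ?thesis using D by blast
  next
    case 2
    define C where "C = connected_component_set (- D) x"
    have x: "x \<in> - D" "bounded C" using 2 by (auto simp: inside_def C_def)
    have C: "C \<in> components (- D)" using x by (auto simp: C_def components_def)
    have cD: "closed (- D)" using D by (simp add: closed_def)
    have cC: "compact C" using closed_components[OF cD C] x(2) by (simp add: compact_eq_bounded_closed)
    obtain K where K: "openin (top_of_set (- D)) K" "compact K" "C \<subseteq> K"
      using Sura_Bura_clopen_subset_alt[OF closed_imp_locally_compact[OF cD] C cC openin_subtopology_self]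
        C in_components_subset by (metis openin_subtopology_self)
    obtain V where V: "open V" "K = - D \<inter> V" using K(1) by (auto simp: openin_open)
    have "K \<subseteq> inside D"
    proof
      fix y assume y: "y \<in> K"
      define C' where "C' = connected_component_set (- D) y"
      have "C' \<subseteq> - D" by (simp add: C'_def connected_component_subset)
      then have "openin (top_of_set C') (C' \<inter> K)" using V by (auto simp: openin_open)
      moreover have "closedin (top_of_set C') (C' \<inter> K)" by (rule closedin_closed_Int[OF compact_imp_closed[OF K(2)]])
      moreover have "connected C'" by (simp add: C'_def)
      moreover have "y \<in> C'" using y V by (simp add: C'_def connected_component_refl)
      ultimately have "C' \<subseteq> K" using y unfolding connected_clopen by blast
      then have "connected_component_set (- D) y \<subseteq> K" by (simp add: C'_def)
      then show "y \<in> inside D"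
        using y V K(2) compact_imp_bounded bounded_subset unfolding inside_def by blast
    qed
    moreover have "x \<in> K" using K(3) x(1) by (auto simp: C_def connected_component_refl)
    ultimately have "open V \<and> x \<in> V \<and> V \<subseteq> D \<union> inside D" using V by blast
    then show ?thesis by blast
  qed
qed

text \<open>A separation has D on one side, say A, and a point of some hole C in the other, B; then
  C lies in B. Small balls about points of C stay in B and miss D, so they belong to C. Thus C is
  open, closed, bounded and nonempty, which is absurd.\<close>

lemma connected_Un_inside:
  fixes D :: "complex set"
  assumes D: "open D" "connected D" "D \<noteq> {}"
  shows "connected (D \<union> inside D)"
proof (rule ccontr)
  assume "\<not> connected (D \<union> inside D)"
  then obtain A B where AB: "open A" "open B" "A \<inter> B \<inter> (D \<union> inside D) = {}" "D \<union> inside D \<subseteq> A \<union> B"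
    "A \<inter> (D \<union> inside D) \<noteq> {}" "B \<inter> (D \<union> inside D) \<noteq> {}"
    unfolding connected_def by blast
  have no: False if AB: "open B" "A \<inter> B \<inter> (D \<union> inside D) = {}" "D \<union> inside D \<subseteq> A \<union> B" "open A"
    "B \<inter> (D \<union> inside D) \<noteq> {}" "D \<subseteq> A" for A B
  proof -
    obtain x where x: "x \<in> B" "x \<in> inside D" "x \<notin> D" using AB by blast
    define C where "C = connected_component_set (- D) x"
    have C: "connected C" "bounded C" "x \<in> C" using x by (auto simp: C_def inside_def)
    have Cin: "C \<subseteq> inside D" using x inside_same_component unfolding C_def by blast
    have "C \<in> components (- D)" using x by (auto simp: C_def components_def)
    moreover have "closed (- D)" using D by (simp add: closed_def)
    ultimately have cC: "closed C" using closed_components by blast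
    have CB: "C \<subseteq> B"
      using connectedD[OF C(1) AB(4,1)] AB x C Cin by blast
    have "open C"
    proof (subst open_subopen, intro ballI)
      fix y assume y: "y \<in> C"
      have oB: "open (B \<inter> (D \<union> inside D))" using AB(1) open_Un_inside[OF D(1)] by blast
      have "y \<in> B \<inter> (D \<union> inside D)" using y CB Cin by blast
      then obtain e where e: "e > 0" "ball y e \<subseteq> B \<inter> (D \<union> inside D)"
        using oB open_contains_ball by blast
      then have "ball y e \<subseteq> - D" using AB by blast
      then have "ball y e \<subseteq> connected_component_set (- D) y"
        using e by (intro connected_component_maximal) auto
      also have "\<dots> = C" using y connected_component_eq unfolding C_def by blast
      finally show "\<exists>T. open T \<and> y \<in> T \<and> T \<subseteq> C" using e by (intro exI[of _ "ball y e"]) auto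
    qed
    then have "C = {} \<or> C = UNIV" using cC clopen by blast
    then show False using C by auto
  qed
  have "A \<inter> D = {} \<or> B \<inter> D = {}" using connectedD[OF D(2) AB(1,2)] AB by blast
  then consider "D \<subseteq> A" | "D \<subseteq> B" using AB by blast
  then show False
  proof cases
    case 1 show ?thesis by (rule no[OF AB(2,3,4,1,6) 1])
  next
    case 2
    have "B \<inter> A \<inter> (D \<union> inside D) = {}" "D \<union> inside D \<subseteq> B \<union> A" using AB(3,4) by blast+
    then show ?thesis using no[OF AB(1) _ _ AB(2,5) 2] by simp
  qed
qed

text \<open>The complement of the filled domain is \<open>outside D\<close>, a union of unbounded
  components; filling creates no new holes.\<close>

lemma simply_connected_Un_inside:
  fixes D :: "complex set"
  assumes D: "open D" "connected D" "D \<noteq> {}"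
  shows "simply_connected (D \<union> inside D)"
proof -
  have "inside (D \<union> inside D) = {}"
  proof (rule ccontr)
    assume "inside (D \<union> inside D) \<noteq> {}"
    then obtain x where x: "x \<notin> D" "x \<notin> inside D" "bounded (connected_component_set (- (D \<union> inside D)) x)"
      unfolding inside_def[of "D \<union> inside D"] by blast
    then have xo: "x \<in> outside D" by (simp add: outside_inside)
    then have "connected_component_set (- D) x \<subseteq> outside D"
      using outside_same_component by blast
    then have "connected_component_set (- D) x \<subseteq> - (D \<union> inside D)" by (simp add: outside_inside)
    then have "connected_component_set (- D) x \<subseteq> connected_component_set (- (D \<union> inside D)) x"
      using x(1) by (intro connected_component_maximal) auto
    then have "bounded (connected_component_set (- D) x)" using x(3) bounded_subset by blast
    then show False using xo by (simp add: outside_def)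
  qed
  then show ?thesis
    using simply_connected_eq_empty_inside[OF open_Un_inside[OF D(1)]] connected_Un_inside[OF D] by simp
qed

section \<open>Length-area estimate in the strip\<close>

text \<open>\<open>a\<close> is the last parameter at which u \<le> p, and \<open>b\<close> is the
  first one after \<open>a\<close> at which q \<le> u.\<close>

lemma exists_crossing_interval_up:
  fixes u :: "real \<Rightarrow> real"
  assumes cont: "continuous_on {s..t} u" and st: "s \<le> t" and pq: "p < q" and u: "u s \<le> p" "q \<le> u t"
  shows "\<exists>a b. s \<le> a \<and> a < b \<and> b \<le> t \<and> u a \<le> p \<and> q \<le> u b \<and> (\<forall>y. a < y \<and> y < b \<longrightarrow> p < u y \<and> u y < q)"
proof -
  define A where "A = {y\<in>{s..t}. u y \<le> p}"
  have "closed A" unfolding A_def by (intro continuous_on_closed_Collect_le cont) auto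
  moreover have "bounded A" by (rule bounded_subset[of "{s..t}"]) (auto simp: A_def)
  ultimately have "compact A" by (simp add: compact_eq_bounded_closed)
  moreover have "s \<in> A" using st u by (simp add: A_def)
  ultimately obtain a where a: "a \<in> A" "\<And>y. y \<in> A \<Longrightarrow> y \<le> a"
    using compact_attains_sup[of A] by blast
  define B where "B = {y\<in>{a..t}. q \<le> u y}"
  have sa: "{a..t} \<subseteq> {s..t}" using a by (auto simp: A_def)
  have "closed B" unfolding B_def by (intro continuous_on_closed_Collect_le continuous_on_subset[OF cont sa]) auto
  moreover have "bounded B" by (rule bounded_subset[of "{a..t}"]) (auto simp: B_def)
  ultimately have "compact B" by (simp add: compact_eq_bounded_closed)
  moreover have "t \<in> B" using a u by (simp add: A_def B_def)
  ultimately obtain b where b: "b \<in> B" "\<And>y. y \<in> B \<Longrightarrow> b \<le> y"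
    using compact_attains_inf[of B] by blast
  have "a \<noteq> b" using a b pq by (auto simp: A_def B_def)
  moreover have "p < u y \<and> u y < q" if y: "a < y" "y < b" for y
    using a(1) a(2)[of y] b(1) b(2)[of y] y by (force simp: A_def B_def)
  ultimately show ?thesis using a(1) b(1)
    by (intro exI[of _ a] exI[of _ b]) (auto simp: A_def B_def)
qed

lemma exists_crossing_interval:
  fixes u :: "real \<Rightarrow> real"
  assumes cont: "continuous_on {s..t} u" and st: "s \<le> t" and pq: "p < q"
    and u: "u s \<le> p \<and> q \<le> u t \<or> q \<le> u s \<and> u t \<le> p"
  obtains a b where "s \<le> a" "a < b" "b \<le> t" "q - p \<le> \<bar>u b - u a\<bar>"
    "\<And>y. a < y \<Longrightarrow> y < b \<Longrightarrow> p < u y \<and> u y < q"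
  using u
proof
  assume "u s \<le> p \<and> q \<le> u t"
  then show ?thesis using exists_crossing_interval_up[OF cont st pq] that by fastforce
next
  assume *: "q \<le> u s \<and> u t \<le> p"
  \<comment> \<open>The reflection that exchanges p and q turns a downward crossing into an upward
    one.\<close>
  have "continuous_on {s..t} (\<lambda>y. p + q - u y)" by (intro continuous_intros cont)
  from exists_crossing_interval_up[OF this st pq] * obtain a b where
    "s \<le> a" "a < b" "b \<le> t" "p + q - u a \<le> p" "q \<le> p + q - u b"
    "\<forall>y. a < y \<and> y < b \<longrightarrow> p < p + q - u y \<and> p + q - u y < q" by auto
  then show ?thesis by (intro that[of a b]) auto
qed

text \<open>The length-area principle: a curve of \<open>y\<close>-length at most \<open>\<pi>\<close> whose image crosses the annulus has
  length at least \<open>q - p\<close> there, and the squared length is controlled by the area through AM-GM.\<close>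

lemma crossing_energy:
  assumes hol: "G holomorphic_on S" and S: "open S" and seg: "\<And>y. y \<in> {s..t} \<Longrightarrow> Complex x y \<in> S"
    and st: "s \<le> t" "t - s \<le> pi" and pq: "q - p = 1"
    and cross: "norm (G (Complex x s)) \<le> p \<and> q \<le> norm (G (Complex x t)) \<or> q \<le> norm (G (Complex x s)) \<and> norm (G (Complex x t)) \<le> p"
  shows "ennreal (1 / pi) \<le> (\<integral>\<^sup>+ y. indicator {z\<in>S. p < norm (G z) \<and> norm (G z) < q} (Complex x y) *
      ennreal ((norm (deriv G (Complex x y)))\<^sup>2) \<partial>lborel)"
proof -
  have contC: "continuous_on A (\<lambda>y. Complex x y)" for A by (intro continuous_intros)
  have cont: "continuous_on {s..t} (\<lambda>y. norm (G (Complex x y)))"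
    by (intro continuous_on_norm continuous_on_compose2[OF holomorphic_on_imp_continuous_on[OF hol] contC]) (use seg in auto)
  have "p < q" using pq by simp
  obtain a b where ab: "s \<le> a" "a < b" "b \<le> t" "q - p \<le> \<bar>norm (G (Complex x b)) - norm (G (Complex x a))\<bar>"
    "\<And>y. a < y \<Longrightarrow> y < b \<Longrightarrow> p < norm (G (Complex x y)) \<and> norm (G (Complex x y)) < q"
    using exists_crossing_interval[OF cont st(1) \<open>p < q\<close> cross] by blast
  define d where "d y = norm (deriv G (Complex x y))" for y
  have contd: "continuous_on {a..b} d"
    unfolding d_def by (intro continuous_on_norm continuous_on_compose2[OF holomorphic_on_imp_continuous_on[OF holomorphic_deriv[OF hol S]] contC])
      (use seg ab in auto)
  have ftc: "((\<lambda>y. \<i> * deriv G (Complex x y)) has_integral (G (Complex x b) - G (Complex x a))) {a..b}"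
  proof (rule fundamental_theorem_of_calculus)
    fix y assume y: "y \<in> {a..b}"
    have "((\<lambda>y. Complex x y) has_vector_derivative \<i>) (at y within {a..b})"
      unfolding has_vector_derivative_complex_iff by (auto intro!: derivative_eq_intros)
    moreover have "(G has_field_derivative deriv G (Complex x y)) (at (Complex x y))"
      by (rule holomorphic_derivI[OF hol S]) (use seg ab y in auto)
    ultimately have "((G \<circ> (\<lambda>y. Complex x y)) has_vector_derivative \<i> * deriv G (Complex x y)) (at y within {a..b})"
      by (rule field_vector_diff_chain_within[OF _ has_field_derivative_at_within])
    then show "((\<lambda>y. G (Complex x y)) has_vector_derivative \<i> * deriv G (Complex x y)) (at y within {a..b})"
      by (simp add: o_def)
  qed (use ab in auto)
  have "1 \<le> norm (G (Complex x b) - G (Complex x a))"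
    using ab(4) pq norm_triangle_ineq3[of "G (Complex x b)" "G (Complex x a)"] by linarith
  also have "\<dots> = norm (integral {a..b} (\<lambda>y. \<i> * deriv G (Complex x y)))"
    using integral_unique[OF ftc] by simp
  also have "\<dots> \<le> integral {a..b} (\<lambda>y. pi / 2 * (d y)\<^sup>2 + 1 / (2 * pi))"
  proof (rule integral_norm_bound_integral)
    show "(\<lambda>y. \<i> * deriv G (Complex x y)) integrable_on {a..b}" using ftc by blast
    show "(\<lambda>y. pi / 2 * (d y)\<^sup>2 + 1 / (2 * pi)) integrable_on {a..b}"
      by (intro integrable_continuous_real continuous_intros contd) auto
    fix y
    \<comment> \<open>AM-GM, with weights such that the constant term contributes at most 1/2 over a
      segment of length pi. At least 1/2 of the crossing length 1 remains for the energy, whence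
      1/pi.\<close>
    have "0 \<le> (pi * d y - 1)\<^sup>2 / (2 * pi)" by simp
    also have "\<dots> = pi / 2 * (d y)\<^sup>2 + 1 / (2 * pi) - d y" by (simp add: field_simps power2_eq_square)
    finally show "norm (\<i> * deriv G (Complex x y)) \<le> pi / 2 * (d y)\<^sup>2 + 1 / (2 * pi)" by (simp add: d_def norm_mult)
  qed
  also have "\<dots> = pi / 2 * integral {a..b} (\<lambda>y. (d y)\<^sup>2) + (b - a) * (1 / (2 * pi))"
    by (subst integral_add) (auto intro!: integrable_continuous_real continuous_intros contd simp: ab less_imp_le)
  also have "\<dots> \<le> pi / 2 * integral {a..b} (\<lambda>y. (d y)\<^sup>2) + pi * (1 / (2 * pi))"
    using ab st by (intro add_left_mono mult_right_mono) auto
  finally have "1 / pi \<le> integral {a..b} (\<lambda>y. (d y)\<^sup>2)"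
    by (simp add: field_simps)
  then have "ennreal (1 / pi) \<le> ennreal (integral {a..b} (\<lambda>y. (d y)\<^sup>2))" by (rule ennreal_leI)
  also have "\<dots> = (\<integral>\<^sup>+ y\<in>{a..b}. ennreal ((d y)\<^sup>2) \<partial>lborel)"
    by (intro nn_integral_interval_continuous[symmetric] continuous_intros contd) auto
  also have "\<dots> \<le> (\<integral>\<^sup>+ y. indicator {z\<in>S. p < norm (G z) \<and> norm (G z) < q} (Complex x y) *
      ennreal ((norm (deriv G (Complex x y)))\<^sup>2) \<partial>lborel)"
  proof (rule nn_integral_mono_AE)
    show "AE y in lborel. ennreal ((d y)\<^sup>2) * indicator {a..b} y \<le> indicator {z\<in>S. p < norm (G z) \<and> norm (G z) < q} (Complex x y) *
      ennreal ((norm (deriv G (Complex x y)))\<^sup>2)"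
      using AE_lborel_singleton[of a] AE_lborel_singleton[of b]
      by eventually_elim (use ab seg in \<open>auto simp: d_def split: split_indicator\<close>)
  qed
  finally show ?thesis .
qed

text \<open>The image of the right half-plane under \<open>Ln\<close>. The end where Re w is large
  corresponds to one boundary point of the disc, and the width pi bounds the length of vertical
  segments.\<close>

definition strip :: "complex set" where
  "strip = {w. \<bar>Im w\<bar> < pi / 2}"

lemma open_strip: "open strip"
  unfolding strip_def by (intro open_Collect_less continuous_intros)

lemma connected_halfstrip: "connected {w\<in>strip. X < Re w}"
proof -
  have "{w\<in>strip. X < Re w} = {w. Re w > X} \<inter> ({w. Im w < pi/2} \<inter> {w. Im w > -(pi/2)})" by (auto simp: strip_def)
  then have "convex {w\<in>strip. X < Re w}"
    by (simp only:) (intro convex_Int convex_halfspace_Re_gt convex_halfspace_Im_lt convex_halfspace_Im_gt)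
  then show ?thesis by (rule convex_connected)
qed

text \<open>No end of the strip can be mapped both near infinity and into a bounded set: otherwise every far
  vertical segment would cross the annulus \<open>R + 1 < \<bar>w\<bar> < R + 2\<close>, which has finite area.\<close>

lemma univalent_strip_escape:
  assumes hol: "G holomorphic_on strip" and inj: "inj_on G strip"
    and slices: "\<And>r. R < r \<Longrightarrow> connected (G ` strip \<inter> sphere 0 r) \<and> G ` strip \<inter> sphere 0 r \<noteq> {}"
    and unb: "\<And>X M. \<exists>w\<in>strip. X < Re w \<and> M < norm (G w)"
  shows "\<exists>X. \<forall>w\<in>strip. X < Re w \<longrightarrow> R < norm (G w)"
proof (rule ccontr)
  assume neg: "\<not> ?thesis"
  obtain h where h: "h holomorphic_on G ` strip" "\<And>z. z \<in> strip \<Longrightarrow> deriv G z * deriv h (G z) = 1"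
    "\<And>z. z \<in> strip \<Longrightarrow> h (G z) = z"
    using holomorphic_has_inverse[OF hol open_strip inj] by blast
  \<comment> \<open>Every half-strip contains points with |G| \<le> R and points with |G| > r, and
    it is connected.\<close>
  have far: "\<exists>w\<in>strip. X < Re w \<and> norm (G w) = r" if r: "R < r" for r X
  proof -
    have "continuous_on {w\<in>strip. X < Re w} (\<lambda>w. norm (G w))"
      by (intro continuous_on_norm continuous_on_subset[OF holomorphic_on_imp_continuous_on[OF hol]]) auto
    then have con: "connected ((\<lambda>w. norm (G w)) ` {w\<in>strip. X < Re w})"
      using connected_halfstrip by (rule connected_continuous_image)
    obtain w1 where w1: "w1 \<in> strip" "X < Re w1" "norm (G w1) \<le> R" using neg by (metis not_less)
    obtain w2 where w2: "w2 \<in> strip" "X < Re w2" "r < norm (G w2)" using unb by blast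
    have "r \<in> (\<lambda>w. norm (G w)) ` {w\<in>strip. X < Re w}"
      by (rule connectedD_interval[OF con, of "norm (G w1)" "norm (G w2)"]) (use w1 w2 r in auto)
    then show ?thesis by blast
  qed
  \<comment> \<open>Here connected slices are decisive: the preimage of a slice is connected, so its
    real parts form an interval, and by \<open>far\<close> this interval is unbounded to the
    right.\<close>
  have vertical: "\<exists>X. \<forall>x>X. \<exists>w\<in>strip. Re w = x \<and> norm (G w) = r" if r: "R < r" for r
  proof -
    obtain v where v: "v \<in> G ` strip \<inter> sphere 0 r" using slices[OF r] by blast
    then obtain w0 where w0: "w0 \<in> strip" "norm (G w0) = r" by auto
    have "continuous_on (G ` strip \<inter> sphere 0 r) (\<lambda>v. Re (h v))"
      by (intro continuous_on_Re continuous_on_subset[OF holomorphic_on_imp_continuous_on[OF h(1)]]) auto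
    then have con: "connected ((\<lambda>v. Re (h v)) ` (G ` strip \<inter> sphere 0 r))"
      using slices[OF r] by (intro connected_continuous_image) auto
    have mem: "Re w \<in> (\<lambda>v. Re (h v)) ` (G ` strip \<inter> sphere 0 r)" if "w \<in> strip" "norm (G w) = r" for w
      using h(3)[of w] that by (intro image_eqI[of _ _ "G w"]) auto
    have "\<exists>w\<in>strip. Re w = x \<and> norm (G w) = r" if x: "Re w0 < x" for x
    proof -
      obtain w where w: "w \<in> strip" "x < Re w" "norm (G w) = r" using far[OF r] by blast
      have "x \<in> (\<lambda>v. Re (h v)) ` (G ` strip \<inter> sphere 0 r)"
        by (rule connectedD_interval[OF con mem[OF w0] mem[OF w(1,3)]]) (use x w in auto)
      then show ?thesis using h(3) by auto
    qed
    then show ?thesis by blast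
  qed
  \<comment> \<open>Two radii above R at distance 1, the width of annulus that the energy estimate
    expects.\<close>
  obtain X1 where X1: "\<And>x. x > X1 \<Longrightarrow> \<exists>w\<in>strip. Re w = x \<and> norm (G w) = R + 1" using vertical[of "R + 1"] by auto
  obtain X2 where X2: "\<And>x. x > X2 \<Longrightarrow> \<exists>w\<in>strip. Re w = x \<and> norm (G w) = R + 2" using vertical[of "R + 2"] by auto
  define E where "E = {z\<in>strip. R + 1 < norm (G z) \<and> norm (G z) < R + 2}"
  have oE: "open E"
  proof -
    have "open (strip \<inter> (\<lambda>z. norm (G z)) -` {R + 1 <..< R + 2})"
      by (intro continuous_open_preimage continuous_on_norm holomorphic_on_imp_continuous_on[OF hol] open_strip) auto
    moreover have "E = strip \<inter> (\<lambda>z. norm (G z)) -` {R + 1 <..< R + 2}" by (auto simp: E_def)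
    ultimately show ?thesis by simp
  qed
  have Es: "E \<subseteq> strip" by (auto simp: E_def)
  have energy: "ennreal (1 / pi) \<le> (\<integral>\<^sup>+ y. indicator E (Complex x y) * ennreal ((norm (deriv G (Complex x y)))\<^sup>2) \<partial>lborel)"
    if x: "x > max X1 X2" for x
  proof -
    obtain w1 w2 where w: "w1 \<in> strip" "Re w1 = x" "norm (G w1) = R + 1" "w2 \<in> strip" "Re w2 = x" "norm (G w2) = R + 2"
      using X1[of x] X2[of x] x by auto
    define s where "s = min (Im w1) (Im w2)"
    define t where "t = max (Im w1) (Im w2)"
    have w12: "w1 = Complex x (Im w1)" "w2 = Complex x (Im w2)" using w by (auto simp: complex_eq_iff)
    show ?thesis unfolding E_def
    proof (rule crossing_energy[OF hol open_strip, of s t])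
      show "Complex x y \<in> strip" if "y \<in> {s..t}" for y
        using that w(1,4) unfolding strip_def s_def t_def by (auto simp: min_def max_def split: if_splits)
      show "s \<le> t" by (simp add: s_def t_def)
      show "t - s \<le> pi" using w(1,4) unfolding strip_def s_def t_def by (auto simp: min_def max_def abs_if split: if_splits)
      show "norm (G (Complex x s)) \<le> R + 1 \<and> R + 2 \<le> norm (G (Complex x t)) \<or>
        R + 2 \<le> norm (G (Complex x s)) \<and> norm (G (Complex x t)) \<le> R + 1"
      proof (cases "Im w1 \<le> Im w2")
        case True then show ?thesis using w w12 by (simp add: s_def t_def)
      next
        case False then show ?thesis using w w12 by (simp add: s_def t_def)
      qed
    qed simp
  qed
  define \<Phi> where "\<Phi> z = indicator E z * ennreal ((norm (deriv G z))\<^sup>2)" for z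
  have [measurable]: "\<Phi> \<in> borel_measurable borel"
  proof -
    define u where "u z = indicator E z *\<^sub>R (norm (deriv G z))\<^sup>2" for z
    have [measurable]: "u \<in> borel_measurable borel" unfolding u_def
      using oE Es by (intro borel_measurable_continuous_on_indicator continuous_intros
          continuous_on_subset[OF holomorphic_on_imp_continuous_on[OF holomorphic_deriv[OF hol open_strip]]]) auto
    have "\<Phi> = (\<lambda>z. ennreal (u z))" by (auto simp: \<Phi>_def u_def split: split_indicator)
    then show ?thesis by simp
  qed
  \<comment> \<open>Each far vertical line carries energy at least 1/pi, and these lines fill a
    half-line of abscissas.\<close>
  have "(\<integral>\<^sup>+ z. \<Phi> z \<partial>lborel) = \<infinity>"
  proof -
    have "emeasure lborel {a<..} = (\<infinity>::ennreal)" for a :: real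
    proof (rule ccontr)
      assume "\<not> ?thesis"
      then obtain m where m: "emeasure lborel {a<..} = ennreal m" "0 \<le> m"
        by (cases "emeasure lborel {a<..}" rule: ennreal_cases) auto
      have "ennreal (m + 1) = emeasure lborel {a<..a + (m + 1)}" using m by simp
      also have "\<dots> \<le> emeasure lborel {a<..}" by (rule emeasure_mono) auto
      finally show False using m by simp
    qed
    then have "(\<infinity>::ennreal) = ennreal (1/pi) * emeasure lborel {max X1 X2<..}"
      by (simp add: ennreal_mult_top)
    also have "\<dots> = (\<integral>\<^sup>+ x. ennreal (1/pi) * indicator {max X1 X2<..} x \<partial>lborel)"
      by (rule nn_integral_cmult_indicator[symmetric]) simp
    also have "\<dots> \<le> (\<integral>\<^sup>+ x. \<integral>\<^sup>+ y. \<Phi> (Complex x y) \<partial>lborel \<partial>lborel)"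
      using energy unfolding \<Phi>_def by (intro nn_integral_mono) (auto split: split_indicator)
    also have "\<dots> = (\<integral>\<^sup>+ z. \<Phi> z \<partial>lborel)" by (rule nn_integral_complex_Fubini[symmetric]) simp
    finally show ?thesis by (simp add: top_unique)
  qed
  \<comment> \<open>By injectivity the same integral is the area of a set inside the disc of radius
    R + 2.\<close>
  moreover have "(\<integral>\<^sup>+ z. \<Phi> z \<partial>lborel) < \<infinity>"
  proof -
    have "(\<integral>\<^sup>+ z. \<Phi> z \<partial>lborel) = (\<integral>\<^sup>+ z\<in>E. ennreal ((norm (deriv G z))\<^sup>2) * 1 \<partial>lborel)"
      by (intro nn_integral_cong) (simp add: \<Phi>_def mult.commute)
    also have "\<dots> = (\<integral>\<^sup>+ w\<in>G ` E. 1 \<partial>lborel)"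
      by (rule nn_integral_holomorphic_image[symmetric, OF oE holomorphic_on_subset[OF hol Es] inj_on_subset[OF inj Es]]) simp
    also have "\<dots> \<le> (\<integral>\<^sup>+ w\<in>ball (0::complex) (R + 2). 1 \<partial>lborel)"
      by (intro nn_integral_mono) (auto simp: E_def split: split_indicator)
    also have "\<dots> = emeasure lborel (ball (0::complex) (R + 2))" by simp
    also have "\<dots> < \<infinity>" by (rule emeasure_bounded_finite) simp
    finally show ?thesis .
  qed
  ultimately show False by simp
qed

section \<open>Conformal coordinates near a boundary point\<close>

text \<open>Schwarz-Pick in the form 1 - |\<phi>(z)| \<ge> c (1 - |z|): a Moebius map moves
  \<phi>(0) to 0, and Schwarz's lemma is applied to the composition.\<close>

lemma growth_compose:
  assumes gr: "growth \<tau> F" and \<tau>: "0 \<le> \<tau>"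
    and \<phi>: "\<phi> holomorphic_on ball 0 1" "\<And>z. norm z < 1 \<Longrightarrow> norm (\<phi> z) < 1"
    and f: "\<And>z. norm z < 1 \<Longrightarrow> f z = F (\<phi> z)"
  shows "growth \<tau> f"
proof -
  define b where "b = \<phi> 0"
  have b: "norm b < 1" using \<phi>(2)[of 0] by (simp add: b_def)
  \<comment> \<open>The square is a lower bound for |1 - cnj b w|^2; the 2 comes from 1 - |w|^2
    \<le> 2 (1 - |w|).\<close>
  define c where "c = (1 - norm b)\<^sup>2 / 2"
  have c: "0 < c" using b by (simp add: c_def)
  define \<psi> where "\<psi> = Moebius_function 0 b \<circ> \<phi>"
  have "\<psi> holomorphic_on ball 0 1"
    unfolding \<psi>_def
    by (rule holomorphic_on_compose_gen[OF \<phi>(1) Moebius_function_holomorphic[OF b]]) (use \<phi>(2) in auto)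
  moreover have "\<psi> 0 = 0" by (simp add: \<psi>_def b_def Moebius_function_eq_zero)
  moreover have "norm (\<psi> z) < 1" if "norm z < 1" for z
    using Moebius_function_norm_lt_1[OF b \<phi>(2)[OF that]] by (simp add: \<psi>_def)
  ultimately have \<psi>: "norm (\<psi> z) \<le> norm z" if "norm z < 1" for z
    using Schwarz_Lemma(1) that by blast
  have dist: "c * (1 - norm z) \<le> 1 - norm (\<phi> z)" if z: "norm z < 1" for z
  proof -
    define w where "w = \<phi> z"
    have w: "norm w < 1" using \<phi>(2)[OF z] by (simp add: w_def)
    have lower: "1 - norm b \<le> norm (1 - cnj b * w)"
    proof -
      have "norm (cnj b * w) \<le> norm b" unfolding norm_mult complex_mod_cnj
        using w by (intro mult_left_le) auto
      then show ?thesis using norm_triangle_ineq2[of 1 "cnj b * w"] by simp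
    qed
    then have pos: "0 < norm (1 - cnj b * w)" using b by linarith
    have id: "(norm (1 - cnj b * w))\<^sup>2 - (norm (w - b))\<^sup>2 = (1 - (norm b)\<^sup>2) * (1 - (norm w)\<^sup>2)"
      by (simp add: cmod_power2) (simp add: power2_eq_square algebra_simps)
    have "norm (\<psi> z) = norm (w - b) / norm (1 - cnj b * w)"
      by (simp add: \<psi>_def w_def Moebius_function_simple norm_divide)
    then have "1 - (norm (\<psi> z))\<^sup>2 = ((norm (1 - cnj b * w))\<^sup>2 - (norm (w - b))\<^sup>2) / (norm (1 - cnj b * w))\<^sup>2"
      using pos by (simp add: power_divide diff_divide_distrib)
    then have eq: "(1 - (norm (\<psi> z))\<^sup>2) * (norm (1 - cnj b * w))\<^sup>2 = (1 - (norm b)\<^sup>2) * (1 - (norm w)\<^sup>2)"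
      using pos id by simp
    have "(1 - norm z) * (1 - norm b)\<^sup>2 \<le> (1 - (norm (\<psi> z))\<^sup>2) * (norm (1 - cnj b * w))\<^sup>2"
    proof (rule mult_mono)
      have "(norm (\<psi> z))\<^sup>2 \<le> (norm z)\<^sup>2" using \<psi>[OF z] by (intro power_mono) auto
      also have "(norm z)\<^sup>2 \<le> norm z" using z by (simp add: power2_eq_square mult_left_le)
      finally show "1 - norm z \<le> 1 - (norm (\<psi> z))\<^sup>2" by simp
      show "(1 - norm b)\<^sup>2 \<le> (norm (1 - cnj b * w))\<^sup>2" using lower b by (intro power_mono) auto
      show "0 \<le> 1 - (norm (\<psi> z))\<^sup>2" using \<psi>[OF z] z by (simp add: power_le_one)
    qed auto
    also have "\<dots> \<le> 1 * (1 - (norm w)\<^sup>2)"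
      unfolding eq using w by (intro mult_right_mono) (auto simp: power_le_one)
    also have "1 - (norm w)\<^sup>2 = (1 + norm w) * (1 - norm w)" by (simp add: power2_eq_square algebra_simps)
    also have "1 * ((1 + norm w) * (1 - norm w)) \<le> 2 * (1 - norm w)" using w by (simp only: mult_1) (intro mult_right_mono, auto)
    finally show ?thesis by (simp add: c_def w_def mult.commute)
  qed
  obtain C where C: "C > 0" "\<And>z. norm z < 1 \<Longrightarrow> norm (F z) \<le> C * (1 - norm z) powr (-\<tau>)"
    using growthE[OF gr] by blast
  have "norm (f z) \<le> C * c powr (-\<tau>) * (1 - norm z) powr (-\<tau>)" if z: "norm z < 1" for z
  proof -
    have "norm (f z) \<le> C * (1 - norm (\<phi> z)) powr (-\<tau>)" unfolding f[OF z] by (rule C(2)[OF \<phi>(2)[OF z]])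
    also have "\<dots> \<le> C * (c * (1 - norm z)) powr (-\<tau>)"
      using dist[OF z] c z C(1) \<tau> by (intro mult_left_mono powr_mono2') auto
    also have "\<dots> = C * c powr (-\<tau>) * (1 - norm z) powr (-\<tau>)" using c z by (simp add: powr_mult)
    finally show ?thesis .
  qed
  then show ?thesis by (rule growthI)
qed

section \<open>Cayley and Joukowski coordinates\<close>

lemma cayley_norm:
  assumes "0 < Re h"
  shows "1 - (norm ((h - 1) / (h + 1)))\<^sup>2 = 4 * Re h / (norm (h + 1))\<^sup>2"
proof -
  have "h + 1 \<noteq> 0" using assms by (auto simp: complex_eq_iff)
  moreover have "(norm (h + 1))\<^sup>2 - (norm (h - 1))\<^sup>2 = 4 * Re h"
    by (simp add: cmod_power2) (simp add: power2_eq_square algebra_simps)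
  moreover from \<open>h + 1 \<noteq> 0\<close> have "1 - (norm ((h - 1) / (h + 1)))\<^sup>2 = ((norm (h + 1))\<^sup>2 - (norm (h - 1))\<^sup>2) / (norm (h + 1))\<^sup>2"
    unfolding norm_divide power_divide by (simp add: diff_divide_distrib)
  ultimately show ?thesis by simp
qed

lemma cayley_lt_1:
  assumes "0 < Re h"
  shows "norm ((h - 1) / (h + 1)) < 1"
proof -
  have "h + 1 \<noteq> 0" using assms by (auto simp: complex_eq_iff)
  then have "0 < 1 - (norm ((h - 1) / (h + 1)))\<^sup>2" unfolding cayley_norm[OF assms] using assms by simp
  then have "(norm ((h - 1) / (h + 1)))\<^sup>2 < 1\<^sup>2" by simp
  then show ?thesis by (rule power_less_imp_less_base) simp
qed

lemma inverse_cayley: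
  assumes "norm z < 1"
  shows "0 < Re ((1 + z) / (1 - z))" "((1 + z) / (1 - z) - 1) / ((1 + z) / (1 - z) + 1) = z"
proof -
  have z: "1 - z \<noteq> 0" using assms by auto
  have "(norm z)\<^sup>2 < 1" using assms by (simp add: abs_square_less_1)
  then have "(Re z)\<^sup>2 + (Im z)\<^sup>2 < 1" by (simp add: cmod_power2)
  then have "0 < (1 + Re z) * (1 - Re z) - Im z * Im z" by (simp add: power2_eq_square algebra_simps)
  moreover have "0 < (1 - Re z)\<^sup>2 + (Im z)\<^sup>2"
    using z by (auto simp: complex_eq_iff sum_power2_gt_zero_iff)
  ultimately show "0 < Re ((1 + z) / (1 - z))" by (simp add: Re_divide)
  have "(1 + z) / (1 - z) - 1 = 2 * z / (1 - z)" "(1 + z) / (1 - z) + 1 = 2 / (1 - z)"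
    using z by (simp_all add: field_simps)
  then show "((1 + z) / (1 - z) - 1) / ((1 + z) / (1 - z) + 1) = z" using z by simp
qed

lemma inverse_cayley_cayley:
  assumes "0 < Re h"
  shows "(1 + (h - 1) / (h + 1)) / (1 - (h - 1) / (h + 1)) = h"
proof -
  have "h + 1 \<noteq> 0" using assms by (auto simp: complex_eq_iff)
  then have "1 + (h - 1) / (h + 1) = 2 * h / (h + 1)" "1 - (h - 1) / (h + 1) = 2 / (h + 1)"
    by (simp_all add: field_simps)
  then show ?thesis using \<open>h + 1 \<noteq> 0\<close> by simp
qed

text \<open>(h - 1/h)/2 is the Joukowski map conjugated by a quarter turn. It takes the part |h| > 1
  of the right half-plane onto the right half-plane, and the unit half-circle to the imaginary
  axis.\<close>

lemma Re_Joukowski: "Re ((h - inverse h) / 2) = (Re h - Re h / (norm h)\<^sup>2) / 2"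
  by (simp add: cmod_power2)

lemma Re_inverse_eq: "Re (inverse h) = Re h / (norm h)\<^sup>2"
  by (simp add: cmod_power2)

text \<open>The solution h of h - 1/h = 2u with the principal root. The root has nonnegative real
  part, so Re h > 0; then Re h - Re h / |h|^2 = 2 Re u > 0 forces |h| > 1.\<close>

lemma inverse_Joukowski:
  assumes u: "0 < Re u"
  shows "0 < Re (u + csqrt (u\<^sup>2 + 1))" "1 < norm (u + csqrt (u\<^sup>2 + 1))"
proof -
  define h where "h = u + csqrt (u\<^sup>2 + 1)"
  have h: "0 < Re h" unfolding h_def plus_complex.sel using u Re_csqrt[of "u\<^sup>2 + 1"] by linarith
  have "h * (csqrt (u\<^sup>2 + 1) - u) = (csqrt (u\<^sup>2 + 1))\<^sup>2 - u\<^sup>2" by (simp add: h_def power2_eq_square algebra_simps)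
  then have "h * (csqrt (u\<^sup>2 + 1) - u) = 1" by simp
  then have "inverse h = csqrt (u\<^sup>2 + 1) - u" by (rule inverse_unique)
  then have "Re h - Re (inverse h) = 2 * Re u" by (simp add: h_def)
  then have "Re h / (norm h)\<^sup>2 < Re h" using u unfolding Re_inverse_eq by linarith
  moreover have "h \<noteq> 0" using h by auto
  ultimately have "1\<^sup>2 < (norm h)\<^sup>2" using h by (simp add: field_simps)
  then have "1 < norm h" by (rule power_less_imp_less_base) simp
  with h show "0 < Re (u + csqrt (u\<^sup>2 + 1))" "1 < norm (u + csqrt (u\<^sup>2 + 1))" by (simp_all add: h_def)
qed

text \<open>The radicand is the square of (h + 1/h)/2, whose real part is positive, so the principal
  root returns exactly this value.\<close>

lemma Joukowski_right_inverse:
  assumes h: "0 < Re h" "1 < norm h"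
  shows "0 < Re ((h - inverse h) / 2)" "(h - inverse h) / 2 + csqrt (((h - inverse h) / 2)\<^sup>2 + 1) = h"
proof -
  have h0: "h \<noteq> 0" using h by auto
  have "1 < (norm h)\<^sup>2" using h by (simp add: one_less_power)
  then have "Re h / (norm h)\<^sup>2 < Re h" using h h0 by (simp add: field_simps)
  then show "0 < Re ((h - inverse h) / 2)" unfolding Re_Joukowski by simp
  have eq: "Re ((h + inverse h) / 2) = (Re h + Re h / (norm h)\<^sup>2) / 2" by (simp add: cmod_power2)
  have "0 < Re ((h + inverse h) / 2)" unfolding eq using h by (simp add: add_pos_nonneg)
  then have "csqrt (((h + inverse h) / 2)\<^sup>2) = (h + inverse h) / 2" by (intro csqrt_square disjI1)
  moreover have "((h - inverse h) / 2)\<^sup>2 + 1 = ((h + inverse h) / 2)\<^sup>2"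
    using h0 by (simp add: power2_eq_square field_simps)
  ultimately have "csqrt (((h - inverse h) / 2)\<^sup>2 + 1) = (h + inverse h) / 2"
    by simp
  then show "(h - inverse h) / 2 + csqrt (((h - inverse h) / 2)\<^sup>2 + 1) = h" by (simp add: field_simps)
qed

text \<open>The branch cut is reached only if the square of f z is real and at most -1, which
  requires f z to be purely imaginary.\<close>

lemma holomorphic_csqrt_Joukowski:
  assumes "f holomorphic_on A" "\<And>z. z \<in> A \<Longrightarrow> 0 < Re (f z)"
  shows "(\<lambda>z. csqrt ((f z)\<^sup>2 + 1)) holomorphic_on A"
proof -
  have "(f z)\<^sup>2 + 1 \<notin> \<real>\<^sub>\<le>\<^sub>0" if z: "z \<in> A" for z
  proof
    assume neg: "(f z)\<^sup>2 + 1 \<in> \<real>\<^sub>\<le>\<^sub>0"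
    then have "Im ((f z)\<^sup>2) = 0" "Re ((f z)\<^sup>2) \<le> -1" by (auto simp: complex_nonpos_Reals_iff)
    then have "Im (f z) = 0" using assms(2)[OF z] by (simp add: power2_eq_square)
    with \<open>Re ((f z)\<^sup>2) \<le> -1\<close> have "(Re (f z))\<^sup>2 \<le> -1" by (simp add: power2_eq_square)
    then show False using zero_le_power2[of "Re (f z)"] by linarith
  qed
  then show ?thesis by (intro holomorphic_intros assms(1)) auto
qed

text \<open>In half-plane coordinates \<open>\<psi>\<close> is the inverse Joukowski map onto the half-plane minus a large disc.\<close>

lemma exists_boundary_cap_map:
  assumes \<zeta>: "norm \<zeta> = 1" and \<Lambda>: "1 \<le> \<Lambda>"
  obtains \<psi> where "\<psi> holomorphic_on ball 0 1"
    "\<And>v. norm v < 1 \<Longrightarrow> \<exists>h. 0 < Re h \<and> \<Lambda> < norm h \<and> \<psi> v = \<zeta> * ((h - 1) / (h + 1))"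
    "\<And>h. \<lbrakk>0 < Re h; 2 * \<Lambda> \<le> norm h\<rbrakk> \<Longrightarrow>
      \<exists>v. norm v < 1 \<and> \<psi> v = \<zeta> * ((h - 1) / (h + 1)) \<and> 1 - norm ((h - 1) / (h + 1)) \<le> 8 * (1 - norm v)"
proof -
  define U where "U v = (1 + v) / (1 - v)" for v :: complex
  \<comment> \<open>Disc to half-plane by U, then to |h| > 1 by the inverse Joukowski map; the
    scaling yields |H| > \<Lambda>.\<close>
  define H where "H v = complex_of_real \<Lambda> * (U v + csqrt ((U v)\<^sup>2 + 1))" for v
  define \<psi> where "\<psi> v = \<zeta> * ((H v - 1) / (H v + 1))" for v
  have U: "0 < Re (U v)" if "norm v < 1" for v using inverse_cayley(1)[OF that] by (simp add: U_def)
  have H: "0 < Re (H v)" "\<Lambda> < norm (H v)" if "norm v < 1" for v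
  proof -
    show "0 < Re (H v)" using inverse_Joukowski(1)[OF U[OF that]] \<Lambda> by (simp add: H_def)
    have "\<Lambda> * 1 < \<Lambda> * norm (U v + csqrt ((U v)\<^sup>2 + 1))"
      using inverse_Joukowski(2)[OF U[OF that]] \<Lambda> by (intro mult_strict_left_mono) auto
    then show "\<Lambda> < norm (H v)" using \<Lambda> by (simp add: H_def norm_mult)
  qed
  have holU: "U holomorphic_on ball 0 1" unfolding U_def[abs_def] by (intro holomorphic_intros) auto
  have holH: "H holomorphic_on ball 0 1"
    unfolding H_def[abs_def] by (intro holomorphic_intros holomorphic_csqrt_Joukowski holU) (use U in auto)
  have nz: "H v + 1 \<noteq> 0" if "norm v < 1" for v using H(1)[OF that] by (auto simp: complex_eq_iff)
  have hol\<psi>: "\<psi> holomorphic_on ball 0 1"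
    unfolding \<psi>_def[abs_def] by (intro holomorphic_intros holH) (use nz in auto)
  have inv: "\<exists>v. norm v < 1 \<and> \<psi> v = \<zeta> * ((h - 1) / (h + 1)) \<and> 1 - norm ((h - 1) / (h + 1)) \<le> 8 * (1 - norm v)"
    if h: "0 < Re h" "2 * \<Lambda> \<le> norm h" for h
  proof -
    define k where "k = h / complex_of_real \<Lambda>"
    have k: "0 < Re k" "2 \<le> norm k" "h = complex_of_real \<Lambda> * k"
      using h \<Lambda> by (auto simp: k_def norm_divide field_simps)
    define u where "u = (k - inverse k) / 2"
    have u: "0 < Re u" "u + csqrt (u\<^sup>2 + 1) = k"
      using Joukowski_right_inverse[of k] k by (auto simp: u_def)
    define v where "v = (u - 1) / (u + 1)"
    have v: "norm v < 1" unfolding v_def by (rule cayley_lt_1[OF u(1)])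
    have "U v = u" unfolding U_def v_def by (rule inverse_cayley_cayley[OF u(1)])
    then have "H v = h" using u(2) k(3) by (simp add: H_def)
    then have \<psi>v: "\<psi> v = \<zeta> * ((h - 1) / (h + 1))" by (simp add: \<psi>_def)
    have k0: "0 < norm k" using k by linarith
    \<comment> \<open>For |k| \<ge> 2 the map (k - 1/k)/2 is close to k/2. The constants 3/8 here
      and 9/8 below are what |k|^2 \<ge> 4 and 1 \<le> |k|/2 give.\<close>
    have Re_u: "3 / 8 * Re k \<le> Re u"
    proof -
      have "4 \<le> (norm k)\<^sup>2" using power_mono[OF k(2), of 2] by simp
      then have "Re k / (norm k)\<^sup>2 \<le> Re k / 4" using k by (intro divide_left_mono) auto
      then show ?thesis unfolding u_def Re_Joukowski by simp
    qed
    have norm_u: "norm (u + 1) \<le> 9 / 8 * norm k"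
    proof -
      have "norm (u + 1) \<le> norm u + 1" using norm_triangle_ineq[of u 1] by simp
      moreover have "norm u \<le> (norm k + inverse (norm k)) / 2"
        using norm_triangle_ineq4[of k "inverse k"] by (simp add: u_def norm_divide norm_inverse)
      moreover have "inverse (norm k) \<le> 1 / 2" using le_imp_inverse_le[OF k(2)] by simp
      moreover have "x \<le> 9 / 8 * c" if "x \<le> y + 1" "y \<le> (c + i) / 2" "i \<le> 1 / 2" "2 \<le> c" for x y c i :: real
        using that by (simp add: field_simps)
      ultimately show ?thesis using k(2) by blast
    qed
    have u1: "0 < norm (u + 1)" using u by (auto simp: complex_eq_iff)
    \<comment> \<open>In half-plane coordinates the distance to the unit circle is comparable to Re
      h / |h + 1|^2, so these quotients are compared. The numbers fit because (9/8)^2 = 81/64 \<le>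
      4 * 3/8.\<close>
    have "Re k / (norm k)\<^sup>2 \<le> 4 * Re u / (norm (u + 1))\<^sup>2"
    proof -
      have "(norm (u + 1))\<^sup>2 \<le> (9 / 8 * norm k)\<^sup>2" using norm_u by (intro power_mono) auto
      then have "Re k * (norm (u + 1))\<^sup>2 \<le> Re k * (81 / 64 * (norm k)\<^sup>2)"
        using k by (intro mult_left_mono) (auto simp: power_mult_distrib power_divide)
      also have "\<dots> = (81 / 64 * Re k) * (norm k)\<^sup>2" by simp
      also have "\<dots> \<le> (4 * Re u) * (norm k)\<^sup>2" using Re_u k by (intro mult_right_mono) auto
      finally show ?thesis using u1 k0 by (simp add: field_simps)
    qed
    also have "\<dots> = 1 - (norm v)\<^sup>2" unfolding v_def by (rule cayley_norm[OF u(1), symmetric])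
    also have "\<dots> = (1 + norm v) * (1 - norm v)" by (simp add: power2_eq_square algebra_simps)
    also have "\<dots> \<le> 2 * (1 - norm v)" using v by (intro mult_right_mono) auto
    finally have vk: "Re k / (norm k)\<^sup>2 \<le> 2 * (1 - norm v)" .
    have h0: "0 < norm h" using h \<Lambda> by linarith
    have "norm ((h - 1) / (h + 1)) < 1" by (rule cayley_lt_1[OF h(1)])
    then have "1 - norm ((h - 1) / (h + 1)) \<le> 1 - (norm ((h - 1) / (h + 1)))\<^sup>2"
      by (simp add: power2_eq_square mult_left_le)
    also have "\<dots> = 4 * Re h / (norm (h + 1))\<^sup>2" by (rule cayley_norm[OF h(1)])
    also have "\<dots> \<le> 4 * Re h / (norm h)\<^sup>2"
    proof -
      have "(norm h)\<^sup>2 \<le> (norm (h + 1))\<^sup>2"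
        unfolding cmod_power2 using h by (simp add: power2_eq_square algebra_simps)
      moreover have "0 < norm (h + 1)" using h by (auto simp: complex_eq_iff)
      ultimately show ?thesis using h(1) h0
        by (intro divide_left_mono mult_pos_pos zero_less_power) auto
    qed
    also have "\<dots> = 4 * (Re k / (norm k)\<^sup>2) / \<Lambda>"
      using \<Lambda> k0 unfolding k(3) by (simp add: norm_mult power_mult_distrib power2_eq_square)
    also have "\<dots> \<le> 4 * (Re k / (norm k)\<^sup>2)"
    proof -
      have "0 \<le> 4 * (Re k / (norm k)\<^sup>2)" using k(1) by simp
      from divide_left_mono[OF \<Lambda> this] show ?thesis using \<Lambda> by simp
    qed
    also have "\<dots> \<le> 8 * (1 - norm v)" using vk by simp
    finally show ?thesis using v \<psi>v by blast
  qed
  show ?thesis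
  proof (rule that[OF hol\<psi> _ inv])
    show "\<exists>h. 0 < Re h \<and> \<Lambda> < norm h \<and> \<psi> v = \<zeta> * ((h - 1) / (h + 1))" if "norm v < 1" for v
      using H[OF that] by (auto simp: \<psi>_def)
  qed
qed

text \<open>On the real radius with y = 1/(1 - r) the modulus is c exp(2y - 1), which beats
  y^\<tau>. This map deals with the whole plane: it omits 0, and its modulus exceeds c, so a
  suitable c also keeps it away from bounded holes.\<close>

lemma exp_map_not_growth:
  assumes c: "0 < c"
  shows "\<not> growth \<tau> (\<lambda>z. complex_of_real c * exp ((1 + z) / (1 - z)))"
proof
  assume gr: "growth \<tau> (\<lambda>z. complex_of_real c * exp ((1 + z) / (1 - z)))"
  obtain C where C: "C > 0"
    "\<And>z. norm z < 1 \<Longrightarrow> norm (complex_of_real c * exp ((1 + z) / (1 - z))) \<le> C * (1 - norm z) powr (-\<tau>)"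
    using growthE[OF gr] by blast
  have "((\<lambda>y. y powr \<tau> / exp (2 * y - 1)) \<longlongrightarrow> 0) at_top" by real_asymp
  then have "eventually (\<lambda>y. y powr \<tau> / exp (2 * y - 1) < c / C) at_top"
    using c C(1) by (intro order_tendstoD(2)) auto
  moreover have "eventually (\<lambda>y::real. y > 1) at_top" by (rule eventually_gt_at_top)
  ultimately have "eventually (\<lambda>y. y powr \<tau> / exp (2 * y - 1) < c / C \<and> y > 1) at_top" by eventually_elim auto
  then obtain y :: real where y: "y powr \<tau> / exp (2 * y - 1) < c / C" "y > 1"
    by (metis (mono_tags, lifting) eventually_happens' trivial_limit_at_top_linorder)
  define r where "r = 1 - 1 / y"
  have r: "0 < r" "r < 1" "1 - r = 1 / y" using y(2) by (auto simp: r_def field_simps)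
  have "(1 + complex_of_real r) / (1 - complex_of_real r) = complex_of_real ((1 + r) / (1 - r))" by simp
  also have "(1 + r) / (1 - r) = 2 * y - 1" unfolding r(3) using y(2) by (simp add: r_def field_simps)
  finally have e: "(1 + complex_of_real r) / (1 - complex_of_real r) = complex_of_real (2 * y - 1)" .
  have "c * exp (2 * y - 1) \<le> C * (1 - r) powr (-\<tau>)"
    using C(2)[of "complex_of_real r"] r(1,2) c unfolding e by (simp add: norm_mult norm_exp_eq_Re del: of_real_diff)
  also have "(1 - r) powr (-\<tau>) = y powr \<tau>" unfolding r(3) using y(2) by (simp add: powr_divide powr_minus field_simps)
  finally show False using y c C(1) by (simp add: field_simps)
qed

lemma exp_map_holomorphic:
  "(\<lambda>z. complex_of_real c * exp ((1 + z) / (1 - z))) holomorphic_on ball 0 1"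
  by (intro holomorphic_intros) auto

lemma exp_map_norm:
  assumes "0 < c" "norm z < 1"
  shows "c < norm (complex_of_real c * exp ((1 + z) / (1 - z)))"
  using inverse_cayley(1)[OF assms(2)] assms(1) by (simp add: norm_mult)

text \<open>Points that defeat every constant accumulate at a boundary point \<zeta>. On a cap at
  \<zeta> the values of g exceed R in modulus and hence lie in D, so g composed with the cap map
  obeys the growth bound. The cap map changes boundary distances at most by a factor 8, and the
  bound returns to g.\<close>

lemma univalent_growth_transfer:
  assumes hol: "g holomorphic_on ball 0 1" and inj: "inj_on g (ball 0 1)"
    and slices: "\<And>r. R < r \<Longrightarrow> connected (g ` ball 0 1 \<inter> sphere 0 r) \<and> g ` ball 0 1 \<inter> sphere 0 r \<noteq> {}"
    and D: "\<And>w. \<lbrakk>w \<in> g ` ball 0 1; R < norm w\<rbrakk> \<Longrightarrow> w \<in> D"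
    and om: "\<And>z. norm z < 1 \<Longrightarrow> g z \<noteq> a"
    and growth: "\<And>k. \<lbrakk>k holomorphic_on ball 0 1; k ` ball 0 1 \<subseteq> D; \<And>z. norm z < 1 \<Longrightarrow> k z \<noteq> a\<rbrakk> \<Longrightarrow> growth \<tau> k"
    and \<tau>: "0 \<le> \<tau>"
  shows "growth \<tau> g"
proof (rule ccontr)
  assume neg: "\<not> growth \<tau> g"
  have "\<exists>z. norm z < 1 \<and> (real n + 1) * (1 - norm z) powr (-\<tau>) < norm (g z)" for n :: nat
    using neg growthI[of g "real n + 1" \<tau>] by (meson not_less)
  then obtain z where z: "\<And>n. norm (z n) < 1" "\<And>n. (real n + 1) * (1 - norm (z n)) powr (-\<tau>) < norm (g (z n))"
    by metis
  have big: "real n < norm (g (z n))" for n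
  proof -
    have "1 \<le> (1 - norm (z n)) powr (-\<tau>)" using one_minus_powr_mono[of "norm (z n)" 0 \<tau>] z(1)[of n] \<tau> by auto
    then have "(real n + 1) * 1 \<le> (real n + 1) * (1 - norm (z n)) powr (-\<tau>)" by (intro mult_left_mono) auto
    from order_le_less_trans[OF this z(2)] show ?thesis by simp
  qed
  have "\<forall>n. z n \<in> cball 0 1" using z(1) by (simp add: less_imp_le)
  then obtain \<zeta> \<rho> where \<zeta>: "\<zeta> \<in> cball 0 1" and \<rho>: "strict_mono \<rho>" "(z \<circ> \<rho>) \<longlonglongrightarrow> \<zeta>"
    using compact_cball[of "0::complex" 1] unfolding compact_def by blast
  have lim: "(\<lambda>n. z (\<rho> n)) \<longlonglongrightarrow> \<zeta>" using \<rho>(2) by (simp add: o_def)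
  have \<rho>n: "real n \<le> real (\<rho> n)" for n using seq_suble[OF \<rho>(1), of n] by simp
  \<comment> \<open>Near an interior limit point g would stay bounded, whereas |g| tends to infinity
    along the sequence.\<close>
  have norm\<zeta>: "norm \<zeta> = 1"
  proof (rule ccontr)
    assume "norm \<zeta> \<noteq> 1"
    then have "\<zeta> \<in> ball 0 1" using \<zeta> by simp
    then have "isCont g \<zeta>"
      using holomorphic_on_imp_continuous_on[OF hol] continuous_on_eq_continuous_at open_ball by blast
    then have "(\<lambda>n. g (z (\<rho> n))) \<longlonglongrightarrow> g \<zeta>" using lim by (rule isCont_tendsto_compose)
    then have "Bseq (\<lambda>n. g (z (\<rho> n)))" by (intro convergent_imp_Bseq) (auto simp: convergent_def)
    then obtain K where K: "\<And>n. norm (g (z (\<rho> n))) \<le> K" unfolding Bseq_def by blast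
    obtain n where "K < real n" using reals_Archimedean2 by blast
    then show False using K[of n] big[of "\<rho> n"] \<rho>n[of n] by linarith
  qed
  have c\<zeta>: "cnj \<zeta> * \<zeta> = 1" using norm\<zeta> complex_norm_square[of \<zeta>] by (simp add: mult.commute)
  \<comment> \<open>Rotation of \<zeta> to 1, so that the inverse Cayley transform sends \<zeta> to
    infinity in the half-plane.\<close>
  define y where "y w = cnj \<zeta> * w" for w
  have y: "norm (y w) = norm w" "\<zeta> * y w = w" for w
    using norm\<zeta> c\<zeta> by (auto simp: y_def norm_mult mult.assoc[symmetric] mult.commute[of \<zeta>])
  define h where "h n = (1 + y (z (\<rho> n))) / (1 - y (z (\<rho> n)))" for n
  have h: "0 < Re (h n)" "\<zeta> * ((h n - 1) / (h n + 1)) = z (\<rho> n)" for n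
    using inverse_cayley[of "y (z (\<rho> n))"] z(1)[of "\<rho> n"] y unfolding h_def by auto
  have h_lim: "filterlim (\<lambda>n. norm (h n)) at_top sequentially"
  proof (rule filterlim_at_infinity_imp_norm_at_top)
    have ylim: "(\<lambda>n. y (z (\<rho> n))) \<longlonglongrightarrow> 1"
      unfolding y_def using tendsto_mult[OF tendsto_const[of "cnj \<zeta>"] lim] c\<zeta> by simp
    have "(\<lambda>n. 1 - y (z (\<rho> n))) \<longlonglongrightarrow> 1 - 1" by (intro tendsto_intros ylim)
    moreover have "1 - y (z (\<rho> n)) \<noteq> 0" for n using z(1)[of "\<rho> n"] y(1)[of "z (\<rho> n)"] by auto
    ultimately have "filterlim (\<lambda>n. 1 - y (z (\<rho> n))) (at 0) sequentially"
      unfolding filterlim_at by auto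
    then have "filterlim (\<lambda>n. inverse (1 - y (z (\<rho> n)))) at_infinity sequentially"
      by (rule filterlim_compose[OF filterlim_inverse_at_infinity])
    moreover have "(\<lambda>n. 1 + y (z (\<rho> n))) \<longlonglongrightarrow> 2"
      using tendsto_add[OF tendsto_const[of 1] ylim] by simp
    ultimately show "filterlim h at_infinity sequentially"
      unfolding h_def[abs_def] divide_inverse
      by (intro tendsto_mult_filterlim_at_infinity[where c = 2]) auto
  qed
  \<comment> \<open>Strip to half-plane by exp, to the disc by Cayley, then rotated back: the right
    end of the strip is sent to \<zeta>.\<close>
  define T where "T w = \<zeta> * ((exp w - 1) / (exp w + 1))" for w
  have Re_exp: "0 < Re (exp w)" if "w \<in> strip" for w
    using that cos_gt_zero_pi[of "Im w"] by (auto simp: strip_def Re_exp)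
  have T_ball: "norm (T w) < 1" if "w \<in> strip" for w
    unfolding T_def norm_mult norm\<zeta> using cayley_lt_1[OF Re_exp[OF that]] by simp
  have Ln: "Ln k \<in> strip" "T (Ln k) = \<zeta> * ((k - 1) / (k + 1))" "Re (Ln k) = ln (norm k)" if "0 < Re k" for k
  proof -
    have k: "k \<noteq> 0" using that by auto
    show "Ln k \<in> strip" using Re_Ln_pos_lt[OF k] that by (simp add: strip_def)
    show "T (Ln k) = \<zeta> * ((k - 1) / (k + 1))" using k by (simp add: T_def)
    show "Re (Ln k) = ln (norm k)" using k by simp
  qed
  have holT: "T holomorphic_on strip"
  proof -
    have "exp w + 1 \<noteq> 0" if "w \<in> strip" for w :: complex
      using Re_exp[OF that] by (auto simp: complex_eq_iff)
    then show ?thesis unfolding T_def[abs_def] by (intro holomorphic_intros) auto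
  qed
  have injT: "inj_on T strip"
  proof (rule inj_onI)
    fix v w assume v: "v \<in> strip" and w: "w \<in> strip" and eq: "T v = T w"
    have "\<zeta> \<noteq> 0" using norm\<zeta> by auto
    then have "(exp v - 1) / (exp v + 1) = (exp w - 1) / (exp w + 1)" using eq mult_left_cancel unfolding T_def by blast
    then have "exp v = exp w"
      using inverse_cayley_cayley[OF Re_exp[OF v]] inverse_cayley_cayley[OF Re_exp[OF w]] by metis
    moreover have "Ln (exp v) = v" "Ln (exp w) = w"
      using v w by (auto simp: strip_def intro!: Ln_exp)
    ultimately show "v = w" by metis
  qed
  define G where "G = g \<circ> T"
  have holG: "G holomorphic_on strip"
    unfolding G_def by (rule holomorphic_on_compose_gen[OF holT hol]) (use T_ball in auto)
  have injG: "inj_on G strip"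
    unfolding G_def by (rule comp_inj_on[OF injT inj_on_subset[OF inj]]) (use T_ball in auto)
  have "T ` strip = ball 0 1"
  proof
    show "T ` strip \<subseteq> ball 0 1" using T_ball by auto
    show "ball 0 1 \<subseteq> T ` strip"
    proof
      fix w :: complex assume "w \<in> ball 0 1"
      then have "norm (y w) < 1" using y by simp
      from inverse_cayley[OF this] Ln[of "(1 + y w) / (1 - y w)"] y(2)[of w]
      show "w \<in> T ` strip" by (metis image_eqI)
    qed
  qed
  then have G_image: "G ` strip = g ` ball 0 1" by (metis G_def image_comp)
  have unb: "\<exists>w\<in>strip. X < Re w \<and> M < norm (G w)" for X M
  proof -
    have "eventually (\<lambda>n. exp X < norm (h n)) sequentially"
      using h_lim by (simp add: filterlim_at_top_dense)
    moreover have "eventually (\<lambda>n. M < real n) sequentially"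
      using filterlim_real_sequentially by (simp add: filterlim_at_top_dense)
    ultimately have "eventually (\<lambda>n. exp X < norm (h n) \<and> M < real n) sequentially" by eventually_elim auto
    then obtain n where n: "exp X < norm (h n)" "M < real n"
      by (metis (mono_tags, lifting) eventually_happens' sequentially_bot)
    have "X < ln (norm (h n))" using n(1) by (metis exp_gt_zero ln_exp ln_less_cancel_iff order_less_trans)
    moreover have "G (Ln (h n)) = g (z (\<rho> n))" using Ln(2)[OF h(1)] h(2) by (simp add: G_def)
    ultimately show ?thesis
      using Ln[OF h(1)[of n]] big[of "\<rho> n"] \<rho>n[of n] n(2) by (intro bexI[of _ "Ln (h n)"]) auto
  qed
  obtain X where X: "\<And>w. \<lbrakk>w \<in> strip; X < Re w\<rbrakk> \<Longrightarrow> R < norm (G w)"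
    using univalent_strip_escape[OF holG injG slices[folded G_image] unb] by blast
  \<comment> \<open>|k| > exp X places Ln k beyond X in the strip, where |G| > R; the 1 meets the
    assumption on cap maps.\<close>
  define \<Lambda> where "\<Lambda> = max 1 (exp X)"
  have \<Lambda>: "1 \<le> \<Lambda>" by (simp add: \<Lambda>_def)
  obtain \<psi> where \<psi>: "\<psi> holomorphic_on ball 0 1"
    "\<And>v. norm v < 1 \<Longrightarrow> \<exists>h. 0 < Re h \<and> \<Lambda> < norm h \<and> \<psi> v = \<zeta> * ((h - 1) / (h + 1))"
    "\<And>h. \<lbrakk>0 < Re h; 2 * \<Lambda> \<le> norm h\<rbrakk> \<Longrightarrow>
      \<exists>v. norm v < 1 \<and> \<psi> v = \<zeta> * ((h - 1) / (h + 1)) \<and> 1 - norm ((h - 1) / (h + 1)) \<le> 8 * (1 - norm v)"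
    using exists_boundary_cap_map[OF norm\<zeta> \<Lambda>] by metis
  have \<psi>_ball: "norm (\<psi> v) < 1 \<and> R < norm (g (\<psi> v))" if "norm v < 1" for v
  proof -
    obtain k where k: "0 < Re k" "\<Lambda> < norm k" "\<psi> v = \<zeta> * ((k - 1) / (k + 1))" using \<psi>(2)[OF \<open>norm v < 1\<close>] by blast
    have "exp X < norm k" using k(2) by (simp add: \<Lambda>_def)
    then have "X < ln (norm k)" by (metis exp_gt_zero ln_exp ln_less_cancel_iff order_less_trans)
    then have "R < norm (G (Ln k))" using X[OF Ln(1)[OF k(1)]] Ln(3)[OF k(1)] by simp
    then show ?thesis using T_ball[OF Ln(1)[OF k(1)]] Ln(2)[OF k(1)] k(3) by (simp add: G_def)
  qed
  have "growth \<tau> (g \<circ> \<psi>)"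
  proof (rule growth)
    show "g \<circ> \<psi> holomorphic_on ball 0 1"
      by (rule holomorphic_on_compose_gen[OF \<psi>(1) hol]) (use \<psi>_ball in auto)
    show "(g \<circ> \<psi>) ` ball 0 1 \<subseteq> D" using \<psi>_ball D by auto
    show "(g \<circ> \<psi>) v \<noteq> a" if "norm v < 1" for v using om \<psi>_ball that by simp
  qed
  then obtain C where C: "C > 0" "\<And>v. norm v < 1 \<Longrightarrow> norm ((g \<circ> \<psi>) v) \<le> C * (1 - norm v) powr (-\<tau>)"
    using growthE by blast
  have "eventually (\<lambda>n. 2 * \<Lambda> < norm (h n)) sequentially"
    using h_lim by (simp add: filterlim_at_top_dense)
  \<comment> \<open>Beyond this index the transferred bound contradicts the choice of the points,
    whose constants are unbounded; 8 is the distortion of the cap map.\<close>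
  moreover have "eventually (\<lambda>n. C * 8 powr \<tau> < real n) sequentially"
    using filterlim_real_sequentially by (simp add: filterlim_at_top_dense)
  ultimately have "eventually (\<lambda>n. 2 * \<Lambda> < norm (h n) \<and> C * 8 powr \<tau> < real n) sequentially" by eventually_elim auto
  then obtain n where n: "2 * \<Lambda> < norm (h n)" "C * 8 powr \<tau> < real n"
    by (metis (mono_tags, lifting) eventually_happens' sequentially_bot)
  define x where "x = z (\<rho> n)"
  have x: "norm x < 1" "(real (\<rho> n) + 1) * (1 - norm x) powr (-\<tau>) < norm (g x)" using z by (auto simp: x_def)
  have "norm (\<zeta> * ((h n - 1) / (h n + 1))) = norm ((h n - 1) / (h n + 1))" unfolding norm_mult norm\<zeta> by simp
  then have normx: "norm ((h n - 1) / (h n + 1)) = norm x" unfolding h(2) x_def by simp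
  obtain v where v: "norm v < 1" "\<psi> v = x" "1 - norm x \<le> 8 * (1 - norm v)"
    using \<psi>(3)[OF h(1)[of n]] n(1) unfolding h(2) normx x_def by (auto simp: x_def)
  have "norm (g x) \<le> C * (1 - norm v) powr (-\<tau>)" using C(2)[OF v(1)] v(2) by simp
  also have "\<dots> \<le> C * ((1 - norm x) / 8) powr (-\<tau>)"
    using v x C(1) \<tau> by (intro mult_left_mono powr_mono2') auto
  also have "\<dots> = C * 8 powr \<tau> * (1 - norm x) powr (-\<tau>)"
    using x by (simp add: powr_divide powr_minus field_simps)
  also have "\<dots> \<le> (real (\<rho> n) + 1) * (1 - norm x) powr (-\<tau>)"
    using n(2) \<rho>n[of n] by (intro mult_right_mono) auto
  finally show False using x(2) by simp
qed

section \<open>Comparison of the Hardy and Bergman numbers\<close>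

text \<open>The growth assumption quantifies over all omitted values because two occur: 0 for the
  exponential map, and a point outside \<Omega> for the Riemann map.\<close>

lemma hardy_of_growth_into_domain:
  fixes D :: "complex set"
  assumes D: "open D" "connected D" "D \<noteq> {}" and bF: "bounded (filled_holes D)"
    and circ: "\<exists>R>0. \<forall>r>R. card (components ((D \<union> filled_holes D) \<inter> sphere 0 r)) = 1"
    and \<tau>: "0 < \<tau>"
    and growth: "\<And>k a. \<lbrakk>k holomorphic_on ball 0 1; k ` ball 0 1 \<subseteq> D; \<And>z. norm z < 1 \<Longrightarrow> k z \<noteq> a\<rbrakk> \<Longrightarrow> growth \<tau> k"
    and f: "f holomorphic_on ball 0 1" "f ` ball 0 1 \<subseteq> D \<union> filled_holes D"
    and p: "0 < p" "p * \<tau> < 1"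
  shows "hardy p f"
proof -
  define \<Omega> where "\<Omega> = D \<union> filled_holes D"
  have \<Omega>: "\<Omega> = D \<union> inside D" by (simp add: \<Omega>_def filled_holes_eq_inside)
  have open\<Omega>: "open \<Omega>" unfolding \<Omega> by (rule open_Un_inside[OF D(1)])
  have sc: "simply_connected \<Omega>" unfolding \<Omega> by (rule simply_connected_Un_inside[OF D])
  obtain R0 where R0: "0 < R0" "\<And>r. R0 < r \<Longrightarrow> card (components (\<Omega> \<inter> sphere 0 r)) = 1"
    using circ unfolding \<Omega>_def by blast
  obtain R1 where R1: "\<And>w. w \<in> filled_holes D \<Longrightarrow> norm w \<le> R1" using bF unfolding bounded_iff by blast
  define R where "R = max R0 R1"
  have R: "0 < R" using R0(1) by (simp add: R_def)
  have slices: "connected (\<Omega> \<inter> sphere 0 r) \<and> \<Omega> \<inter> sphere 0 r \<noteq> {}" if r: "R < r" for r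
  proof -
    \<comment> \<open>Cardinality 1 makes the slice equal to its only component, hence both
      connected and nonempty.\<close>
    have "card (components (\<Omega> \<inter> sphere 0 r)) = 1" using R0(2) r by (simp add: R_def)
    then obtain C where C: "components (\<Omega> \<inter> sphere 0 r) = {C}" by (rule card_1_singletonE)
    then have "C \<in> components (\<Omega> \<inter> sphere 0 r)" by simp
    then have "connected C" "C \<noteq> {}" by (simp_all add: in_components_connected in_components_nonempty)
    moreover have "\<Omega> \<inter> sphere 0 r = C" using Union_components[of "\<Omega> \<inter> sphere 0 r"] C by simp
    ultimately show ?thesis by simp
  qed
  have inD: "w \<in> D" if "w \<in> \<Omega>" "R < norm w" for w
    using that R1[of w] by (auto simp: \<Omega>_def R_def)
  \<comment> \<open>Otherwise R exp((1+z)/(1-z)), whose modulus exceeds R, would map into D and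
    violate the growth assumption. The Riemann mapping theorem requires this exclusion.\<close>
  have "\<Omega> \<noteq> UNIV"
  proof
    assume UNIV: "\<Omega> = UNIV"
    define k where "k z = complex_of_real R * exp ((1 + z) / (1 - z))" for z
    have "growth \<tau> k"
    proof (rule growth)
      show "k holomorphic_on ball 0 1" unfolding k_def[abs_def] by (rule exp_map_holomorphic)
      show "k ` ball 0 1 \<subseteq> D"
        using exp_map_norm[OF R] inD UNIV by (auto simp: k_def)
      show "k z \<noteq> 0" for z using R by (simp add: k_def)
    qed
    then show False using exp_map_not_growth[OF R] unfolding k_def[abs_def] by blast
  qed
  moreover have "\<Omega> \<noteq> {}" using D(3) by (auto simp: \<Omega>_def)
  ultimately obtain F G0 where FG: "F holomorphic_on \<Omega>" "G0 holomorphic_on ball 0 1"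
    "\<forall>z\<in>\<Omega>. F z \<in> ball 0 1 \<and> G0 (F z) = z" "\<forall>z\<in>ball 0 1. G0 z \<in> \<Omega> \<and> F (G0 z) = z"
    using Riemann_mapping_theorem[of \<Omega>] open\<Omega> sc by blast
  obtain a where a: "a \<notin> \<Omega>" using \<open>\<Omega> \<noteq> UNIV\<close> by blast
  have f0: "f 0 \<in> \<Omega>" using f(2) unfolding \<Omega>_def by (meson centre_in_ball image_subset_iff zero_less_one)
  define b where "b = F (f 0)"
  have b: "b \<in> ball 0 1" using FG(3) f0 by (simp add: b_def)
  \<comment> \<open>An automorphism of the disc normalises the Riemann map so that g 0 = f 0, as
    subordination demands.\<close>
  obtain m m' where m: "m b = 0" "m holomorphic_on ball 0 1" "m ` ball 0 1 \<subseteq> ball 0 1"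
    "m' holomorphic_on ball 0 1" "m' ` ball 0 1 \<subseteq> ball 0 1"
    "\<And>z. z \<in> ball 0 1 \<Longrightarrow> m (m' z) = z" "\<And>z. z \<in> ball 0 1 \<Longrightarrow> m' (m z) = z"
    using ball_biholomorphism_exists[OF b] by metis
  define g where "g = G0 \<circ> m'"
  have holg: "g holomorphic_on ball 0 1"
    unfolding g_def by (rule holomorphic_on_compose_gen[OF m(4) FG(2) m(5)])
  have m'_in: "m' z \<in> ball 0 1" if "z \<in> ball 0 1" for z using m(5) that by blast
  have g_in: "g z \<in> \<Omega>" if "z \<in> ball 0 1" for z
    using FG(4) m'_in[OF that] by (simp add: g_def)
  have inj: "inj_on g (ball 0 1)"
  proof (rule inj_onI)
    fix v w assume v: "v \<in> ball 0 1" and w: "w \<in> ball 0 1" and eq: "g v = g w"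
    have "F (g v) = m' v" "F (g w) = m' w" using FG(4) m'_in[OF v] m'_in[OF w] by (simp_all add: g_def)
    then have "m' v = m' w" using eq by simp
    then show "v = w" using m(6) v w by metis
  qed
  have gimg: "g ` ball 0 1 = \<Omega>"
  proof
    show "g ` ball 0 1 \<subseteq> \<Omega>" using g_in by blast
    show "\<Omega> \<subseteq> g ` ball 0 1"
    proof
      fix w assume w: "w \<in> \<Omega>"
      then have Fw: "F w \<in> ball 0 1" "G0 (F w) = w" using FG(3) by auto
      then have "w = g (m (F w))" using m(7) by (simp add: g_def)
      moreover have "m (F w) \<in> ball 0 1" using m(3) Fw by blast
      ultimately show "w \<in> g ` ball 0 1" by blast
    qed
  qed
  have "m' 0 = b" using m(1) m(7)[OF b] by simp
  then have g0: "f 0 = g 0" using FG(3) f0 by (simp add: g_def b_def)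
  have om: "g z \<noteq> a" if "norm z < 1" for z using g_in[of z] a that by auto
  have "growth \<tau> g"
  proof (rule univalent_growth_transfer[OF holg inj])
    show "connected (g ` ball 0 1 \<inter> sphere 0 r) \<and> g ` ball 0 1 \<inter> sphere 0 r \<noteq> {}" if "R < r" for r
      unfolding gimg by (rule slices[OF that])
    show "w \<in> D" if "w \<in> g ` ball 0 1" "R < norm w" for w using that inD unfolding gimg by blast
    show "g z \<noteq> a" if "norm z < 1" for z by (rule om[OF that])
    show "growth \<tau> k" if "k holomorphic_on ball 0 1" "k ` ball 0 1 \<subseteq> D" "\<And>z. norm z < 1 \<Longrightarrow> k z \<noteq> a" for k
      using growth[OF that] .
  qed (use \<tau> in simp)
  moreover have "f ` ball 0 1 \<subseteq> g ` ball 0 1" using f(2) unfolding gimg \<Omega>_def .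
  ultimately show ?thesis
    using hardy_if_univalent_growth[OF holg inj om _ p(1) _ p(2) f(1) _ g0] \<tau> by simp
qed

section \<open>From functions to domains\<close>

lemma hardy_num_nonneg: "0 \<le> hardy_num f"
  unfolding hardy_num_def by (rule Sup_upper) auto

lemma bergman_alpha_num_nonneg: "0 \<le> bergman_alpha_num \<alpha> f"
  unfolding bergman_alpha_num_def by (rule Sup_upper) auto

lemma hardy_dom_antimono: "D \<subseteq> E \<Longrightarrow> hardy_dom E \<le> hardy_dom D"
  unfolding hardy_dom_def by (rule Inf_superset_mono) blast

lemma bergman_dom_antimono: "D \<subseteq> E \<Longrightarrow> bergman_dom E \<le> bergman_dom D"
  unfolding bergman_dom_def by (rule Inf_superset_mono) blast

lemma le_hardy_num:
  assumes "0 < x" "\<And>p. \<lbrakk>0 < p; p < x\<rbrakk> \<Longrightarrow> hardy p f"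
  shows "ereal x \<le> hardy_num f"
proof (rule dense_le)
  fix y assume y: "y < ereal x"
  then have "max y 0 < ereal x" using assms(1) by simp
  then obtain p where p: "max y 0 < ereal p" "ereal p < ereal x" using ereal_dense2 by blast
  then have "hardy p f" using assms(2)[of p] by simp
  then have "ereal p \<le> hardy_num f" unfolding hardy_num_def using p by (intro Sup_upper) auto
  then show "y \<le> hardy_num f" using p by (auto intro: order_trans less_imp_le)
qed

text \<open>A proper subset of the plane omits a value that is common to all competitors, and the
  inequality for single functions applies. For the whole plane the exponential map makes the
  left-hand side at most 0.\<close>

lemma hardy_dom_le_bergman_alpha_dom:
  assumes \<alpha>: "-1 < \<alpha>"
  shows "hardy_dom D \<le> bergman_alpha_dom \<alpha> D / ereal (\<alpha> + 2)"
proof -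
  have "ereal (\<alpha> + 2) * hardy_dom D \<le> bergman_alpha_num \<alpha> f"
    if f: "f holomorphic_on ball 0 1" "f ` ball 0 1 \<subseteq> D" for f
  proof (cases "D = UNIV")
    case True
    define k where "k z = complex_of_real 1 * exp ((1 + z) / (1 - z))" for z
    have k0: "k z \<noteq> 0" for z by (simp add: k_def)
    have "bergman_num k \<le> 0"
    proof (rule ccontr)
      assume "\<not> ?thesis"
      then obtain x where x: "0 < ereal x" "ereal x < bergman_num k" using ereal_dense2 not_le by metis
      then have "growth (1 / x) k" using growth_if_less_bergman_num[of x k 0] k0 by simp
      then show False using exp_map_not_growth[of 1] unfolding k_def[abs_def] by simp
    qed
    then have "hardy_num k \<le> 0"
      using hardy_num_le_bergman_alpha_num[OF \<alpha>, of k 0] bergman_alpha_num_le_bergman_num[OF \<alpha>, of k] k0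
      by (meson order_trans)
    moreover have "hardy_dom D \<le> hardy_num k"
      unfolding hardy_dom_def True k_def[abs_def] using exp_map_holomorphic[of 1] by (intro Inf_lower) blast
    ultimately have "hardy_dom D \<le> 0" by (rule order_trans[rotated])
    then have "ereal (\<alpha> + 2) * hardy_dom D \<le> 0"
      using ereal_mult_left_mono[of "hardy_dom D" 0 "ereal (\<alpha> + 2)"] \<alpha> by simp
    then show ?thesis using bergman_alpha_num_nonneg order_trans by blast
  next
    case False
    then obtain a where "a \<notin> D" by blast
    then have om: "f z \<noteq> a" if "norm z < 1" for z using f(2) that by (metis image_subset_iff mem_ball_0)
    have "hardy_dom D \<le> hardy_num f" unfolding hardy_dom_def using f by (intro Inf_lower) blast
    also have "\<dots> \<le> bergman_alpha_num \<alpha> f / ereal (\<alpha> + 2)"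
      by (rule hardy_num_le_bergman_alpha_num[OF \<alpha> om])
    finally show ?thesis using \<alpha> by (simp add: ereal_le_divide_pos)
  qed
  then have "ereal (\<alpha> + 2) * hardy_dom D \<le> bergman_alpha_dom \<alpha> D"
    unfolding bergman_alpha_dom_def by (intro Inf_greatest) blast
  then show ?thesis using \<alpha> by (simp add: ereal_le_divide_pos)
qed

lemma bergman_alpha_dom_le_bergman_dom:
  assumes \<alpha>: "-1 < \<alpha>"
  shows "bergman_alpha_dom \<alpha> D / ereal (\<alpha> + 2) \<le> bergman_dom D"
  unfolding bergman_dom_def
proof (rule Inf_greatest, clarify)
  fix f assume f: "f holomorphic_on ball 0 1" "f ` ball 0 1 \<subseteq> D"
  have "bergman_alpha_dom \<alpha> D \<le> bergman_alpha_num \<alpha> f"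
    unfolding bergman_alpha_dom_def using f by (intro Inf_lower) blast
  then have "bergman_alpha_dom \<alpha> D / ereal (\<alpha> + 2) \<le> bergman_alpha_num \<alpha> f / ereal (\<alpha> + 2)"
    using \<alpha> by (intro ereal_divide_right_mono) auto
  also have "\<dots> \<le> bergman_num f" by (rule bergman_alpha_num_le_bergman_num[OF \<alpha>])
  finally show "bergman_alpha_dom \<alpha> D / ereal (\<alpha> + 2) \<le> bergman_num f" .
qed

text \<open>The threshold \<beta> is left open because it is used twice, with the Bergman number of
  the domain and with that of a covering map.\<close>

lemma le_hardy_dom_if_growth:
  fixes D :: "complex set"
  assumes D: "open D" "connected D" "D \<noteq> {}" and bF: "bounded (filled_holes D)"
    and circ: "\<exists>R>0. \<forall>r>R. card (components ((D \<union> filled_holes D) \<inter> sphere 0 r)) = 1"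
    and growth: "\<And>x k a. \<lbrakk>0 < x; ereal x < \<beta>; k holomorphic_on ball 0 1; k ` ball 0 1 \<subseteq> D;
      \<And>z. norm z < 1 \<Longrightarrow> k z \<noteq> a\<rbrakk> \<Longrightarrow> growth (1 / x) k"
  shows "\<beta> \<le> hardy_dom (D \<union> filled_holes D)"
proof (rule dense_le)
  fix y assume y: "y < \<beta>"
  show "y \<le> hardy_dom (D \<union> filled_holes D)"
    unfolding hardy_dom_def
  proof (rule Inf_greatest, clarify)
    fix f assume f: "f holomorphic_on ball 0 1" "f ` ball 0 1 \<subseteq> D \<union> filled_holes D"
    show "y \<le> hardy_num f"
    proof (cases "y \<le> 0")
      case True
      then show ?thesis using hardy_num_nonneg order_trans by blast
    next
      case False
      then obtain x where x: "y = ereal x" "0 < x" using y by (cases y) auto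
      have "ereal x \<le> hardy_num f"
      proof (rule le_hardy_num[OF x(2)])
        fix p assume p: "0 < p" "p < x"
        show "hardy p f"
        proof (rule hardy_of_growth_into_domain[OF D bF circ _ _ f p(1)])
          show "0 < 1 / x" "p * (1 / x) < 1" using x p by auto
          show "growth (1 / x) k" if "k holomorphic_on ball 0 1" "k ` ball 0 1 \<subseteq> D" "\<And>z. norm z < 1 \<Longrightarrow> k z \<noteq> a" for k a
            using growth[OF x(2) _ that] x(1) y by simp
        qed
      qed
      then show ?thesis using x by simp
    qed
  qed
qed

theorem theorem1p4:
  fixes \<alpha> :: real and D :: "complex set"
  assumes alpha: "\<alpha> > -1"
    and dom: "open D" "connected D" "D \<noteq> {}"
    and unb: "\<not> bounded D"
    and bF: "bounded (filled_holes D)"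
    and circ: "\<exists>R>0. \<forall>r>R. card (components ((D \<union> filled_holes D) \<inter> sphere 0 r)) = 1"
  shows "hardy_dom D = bergman_dom D
       \<and> bergman_dom D = hardy_dom (D \<union> filled_holes D)
       \<and> hardy_dom (D \<union> filled_holes D) = bergman_dom (D \<union> filled_holes D)
       \<and> bergman_dom (D \<union> filled_holes D) = bergman_alpha_dom \<alpha> D / ereal (\<alpha> + 2)
       \<and> bergman_alpha_dom \<alpha> D / ereal (\<alpha> + 2)
           = bergman_alpha_dom \<alpha> (D \<union> filled_holes D) / ereal (\<alpha> + 2)
       \<and> (\<forall>f. (\<exists>a b. a \<noteq> b \<and> a \<notin> D \<and> b \<notin> D) \<and> 0 \<in> D \<and>
             f holomorphic_on ball 0 1 \<and> covering_space (ball 0 1) f D \<and> f 0 = 0 \<longrightarrow>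
           hardy_num f = bergman_num f \<and> bergman_num f = bergman_alpha_num \<alpha> f / ereal (\<alpha> + 2))"
proof -
  let ?\<Omega> = "D \<union> filled_holes D"
  have sub: "D \<subseteq> ?\<Omega>" by blast
  have up: "bergman_dom D \<le> hardy_dom ?\<Omega>"
  proof (rule le_hardy_dom_if_growth[OF dom bF circ])
    fix x k a assume x: "0 < x" "ereal x < bergman_dom D"
      and k: "k holomorphic_on ball 0 1" "k ` ball 0 1 \<subseteq> D" "\<And>z. norm z < 1 \<Longrightarrow> k z \<noteq> a"
    have "bergman_dom D \<le> bergman_num k" unfolding bergman_dom_def using k(1,2) by (intro Inf_lower) blast
    then show "growth (1 / x) k"
      by (intro growth_if_less_bergman_num[OF x(1) _ k(3)]) (use x(2) in auto)
  qed
  have cover: "hardy_num f = bergman_num f \<and> bergman_num f = bergman_alpha_num \<alpha> f / ereal (\<alpha> + 2)"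
    if a: "a \<notin> D" and f: "f holomorphic_on ball 0 1" "covering_space (ball 0 1) f D" for f a
  proof -
    have fD: "f ` ball 0 1 = D" using f(2) by (rule covering_space_imp_surjective)
    then have om: "f z \<noteq> a" if "norm z < 1" for z using a that by force
    have "bergman_num f \<le> hardy_dom ?\<Omega>"
    proof (rule le_hardy_dom_if_growth[OF dom bF circ])
      fix x k c assume x: "0 < x" "ereal x < bergman_num f"
        and k: "k holomorphic_on ball 0 1" "k ` ball 0 1 \<subseteq> D"
      have gr: "growth (1 / x) f" by (rule growth_if_less_bergman_num[OF x om])
      \<comment> \<open>The disc is simply connected, so \<open>k\<close> lifts through the covering
        as f composed with a holomorphic self-map of the disc. The growth of the single function f
        thus bounds that of all maps into D.\<close>
      obtain \<phi> where \<phi>: "\<phi> holomorphic_on ball 0 1" "\<phi> \<in> ball 0 1 \<rightarrow> ball 0 1" "\<And>z. z \<in> ball 0 1 \<Longrightarrow> f (\<phi> z) = k z"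
        by (rule covering_space_lift_holomorphic[OF f(2) open_ball f(1) k(1)])
           (use k(2) in \<open>auto simp: convex_imp_simply_connected convex_imp_locally_path_connected\<close>)
      show "growth (1 / x) k"
        by (rule growth_compose[OF gr _ \<phi>(1)]) (use x \<phi>(2,3) in auto)
    qed
    also have "\<dots> \<le> hardy_dom D" by (rule hardy_dom_antimono[OF sub])
    also have "\<dots> \<le> hardy_num f" unfolding hardy_dom_def using f(1) fD by (intro Inf_lower) blast
    finally have "bergman_num f \<le> hardy_num f" .
    moreover have "hardy_num f \<le> bergman_alpha_num \<alpha> f / ereal (\<alpha> + 2)"
      by (rule hardy_num_le_bergman_alpha_num[OF alpha om])
    moreover have "bergman_alpha_num \<alpha> f / ereal (\<alpha> + 2) \<le> bergman_num f"
      by (rule bergman_alpha_num_le_bergman_num[OF alpha])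
    ultimately show ?thesis by (meson antisym order_trans)
  qed
  \<comment> \<open>For either domain the \<alpha>-number lies between h and b; together with
    monotonicity and \<open>up\<close> the inequalities close up at h(\<Omega>).\<close>
  have chain: "hardy_dom ?\<Omega> \<le> hardy_dom D" "hardy_dom D \<le> bergman_alpha_dom \<alpha> D / ereal (\<alpha> + 2)"
    "bergman_alpha_dom \<alpha> D / ereal (\<alpha> + 2) \<le> bergman_dom D"
    "hardy_dom ?\<Omega> \<le> bergman_alpha_dom \<alpha> ?\<Omega> / ereal (\<alpha> + 2)"
    "bergman_alpha_dom \<alpha> ?\<Omega> / ereal (\<alpha> + 2) \<le> bergman_dom ?\<Omega>" "bergman_dom ?\<Omega> \<le> bergman_dom D"
    using hardy_dom_antimono[OF sub] bergman_dom_antimono[OF sub]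
      hardy_dom_le_bergman_alpha_dom[OF alpha] bergman_alpha_dom_le_bergman_dom[OF alpha] by blast+
  have "hardy_dom D = hardy_dom ?\<Omega>" "bergman_dom D = hardy_dom ?\<Omega>" "bergman_dom ?\<Omega> = hardy_dom ?\<Omega>"
    "bergman_alpha_dom \<alpha> D / ereal (\<alpha> + 2) = hardy_dom ?\<Omega>"
    "bergman_alpha_dom \<alpha> ?\<Omega> / ereal (\<alpha> + 2) = hardy_dom ?\<Omega>"
    using up chain by (meson antisym order_trans)+
  then show ?thesis using cover by auto
qed

end
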